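(* Let $e,\ell\ge 2$ be integers. (a) Let $\mathcal{A}$ and $\mathcal{A}'$ be $\ell$-abaci. There is an arrow $\mathcal{A}\to\mathcal{A}'$ in the $\mathfrak{sl}_\infty$-crystal if and only if for some $k\in\mathbb{N}$, $\mathcal{A}'$ is obtained from $\mathcal{A}$ by shifting the $k$'th fore period $P_k$ of $\mathcal{A}$ one unit to the right, and the right shift $\tilde{P}_k$ of $P_k$ is equal to $Q_k'$, the $k$'th aft period of $\mathcal{A}'$. (b) Let $\mathcal{A}$ be an $\ell$-abacus and let $\theta$ be its position in the $\mathfrak{sl}_\infty$-crystal, i.e. the unique partition such that $\mathcal{A}=\tilde b_\theta\mathcal{A}^\circ$ with $\mathcal{A}^\circ$ a highest weight vertex for $\mathfrak{sl}_\infty$. For $k\in\mathbb{N}$ let $\alpha_k=\max\{q\in\mathbb{Z}_{\ge 0}\mid (\Upsilon_k^-)^q(\mathcal{A})\neq 0\}$, let $r=\max\{n\in\mathbb{N}\mid \alpha_n\neq 0\}$, and set $\delta_k=\sum_{m=k}^r\alpha_m$ for $1\le k\le r$. Then $\theta=(\delta_1,\delta_2,\dots,\delta_r)$ (with $\theta=\emptyset$ if all $\alpha_n=0$).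
   Context: Throughout $e,\ell\ge 2$ are fixed integers and $\mathbb{N}=\{1,2,\dots\}$. Abaci. An $\ell$-abacus is a subset $\mathcal{A}\subset\mathbb{Z}\times\{1,\dots,\ell\}$ such that for some $m_-,m_+\in\mathbb{Z}$ and all $j$: $(\beta,j)\in\mathcal{A}$ for all $\beta\le m_-$ and $(\beta,j)\notin\mathcal{A}$ for all $\beta\ge m_+$. Elements $b=(\beta,j)\in\mathcal{A}$ are beads, in column $\beta(b)=\beta$ and row $j(b)=j$ (row 1 is the bottom row); pairs not in $\mathcal{A}$ are spaces. For $\mathbf{s}\in\mathbb{Z}^\ell$ and an $\ell$-partition $\boldsymbol\lambda=(\lambda^1,\dots,\lambda^\ell)$ put $\mathcal{A}(\boldsymbol\lambda,\mathbf{s})=\{(\lambda^j_k+s_j-k+1,j)\mid 1\le j\le\ell,\ k\ge 1\}$. Every $\ell$-abacus is of this form for a unique pair $(\boldsymbol\lambda,\mathbf{s})$; $\mathbf{s}$ is its charge. Quasiperiods. Beads are totally ordered by: $b<b'$ iff $\beta(b)<\beta(b')$, or $\beta(b)=\beta(b')$ and $j(b)>j(b')$. An $e$-quasiperiod (quasiperiod) of $\mathcal{A}$ is a sequence of $e$ beads $(b_1,\dots,b_e)$ with $\beta(b_{i+1})=\beta(b_i)-1$ and $j(b_i)\ge j(b_{i+1})$ for $1\le i\le e-1$. Quasiperiods are ordered lexicographically. Fore periods. The first fore period $P_1$ of $\mathcal{A}$ is its largest quasiperiod; inductively the $k$'th fore period $P_k$ is the largest quasiperiod with $P_k<P_{k-1}$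 and $P_k\cap P_i=\emptyset$ for all $i<k$. Write $b_k^{(1)}>\dots>b_k^{(e)}$ for the beads of $P_k$. A bead in no fore period is a free bead. Vessels and aft periods. The $k$'th vessel $V_k$ of $\mathcal{A}$ is the union of $P_k$ and the set of free beads $b=(\beta,j)$ with $\beta(b_{k+1}^{(e)})\le\beta\le\beta(b_k^{(1)})$ satisfying (recursively in decreasing $\beta$): (i) if $\beta=\beta(b_k^{(i)})$ for some $i$ then $j>j(b_k^{(i)})$; (ii) if $\beta=\beta(b_{k+1}^{(i)})$ for some $i$ then $j<j(b_{k+1}^{(i)})$; (iii) if $\beta<\beta(b_k^{(e)})$ then there is $j'$ with $(\beta+1,j')\in V_k$. The $k$'th aft period $Q_k$ is the smallest quasiperiod contained in $V_k$. Shifts. A quasiperiod $P$ is right-shiftable if for each row $j$ that it meets, with $\beta_0=\max\{\beta\mid(\beta,j)\in P\}$, one has $(\beta_0+1,j)\notin\mathcal{A}$. Its right shift is $\tilde P=\{(\beta+1,j)\mid(\beta,j)\in P\}$, and shifting $P$ one unit to the right means replacing $\mathcal{A}$ by $(\mathcal{A}\setminus P)\cup\tilde P$. Left-shiftability, left shifts and shifting to the left are defined symmetrically. The $\mathfrak{sl}_\infty$-crystal. For a partition $\sigma=(\sigma_1\ge\sigma_2\ge\cdots)$, the operator $\tilde b_\sigma$ acts on $\ell$-abaci (preserving charge) by shifting the first fore period (of the current abacus) one unit to the right $\sigma_1$ times, then shifting the second fore period (of the current abacus) one unit to the right $\sigma_2$ times, and so on (these shifts are always defined). An abacus is a highest weight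 vertex for $\mathfrak{sl}_\infty$ if it is not of the form $\tilde b_\sigma\mathcal{B}$ with $\sigma\ne\emptyset$. It is known that every $\ell$-abacus is $\mathcal{A}=\tilde b_\theta\mathcal{A}^\circ$ for a unique partition $\theta$ and a unique highest weight vertex $\mathcal{A}^\circ$. The $\mathfrak{sl}_\infty$-crystal (for given $e$ and charge) is the directed graph on all $\ell$-abaci of that charge with an arrow $\tilde b_\theta\mathcal{A}^\circ\to\tilde b_\rho\mathcal{A}^\circ$, for each highest weight vertex $\mathcal{A}^\circ$, whenever $\rho$ is obtained from $\theta$ by adding one box. The operators $\Upsilon_k^{\pm}$. For $\mathcal{A}=\tilde b_\theta\mathcal{A}^\circ$ and $k\in\mathbb{N}$: $\Upsilon_k^+\mathcal{A}=\tilde b_\rho\mathcal{A}^\circ$ if adding a box to row $k$ of $\theta$ gives a partition $\rho$, and $\Upsilon_k^+\mathcal{A}=0$ otherwise; $\Upsilon_k^-\mathcal{A}=\tilde b_\rho\mathcal{A}^\circ$ if removing a box from row $k$ of $\theta$ gives a partition $\rho$, and $\Upsilon_k^-\mathcal{A}=0$ otherwise. Also $\Upsilon_k^\pm 0=0$. *)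

theory Defs
  imports Main
begin

text \<open>A bead is a pair (column, row); rows are numbered from \<open>1\<close> (bottom) to \<open>l\<close>.\<close>

type_synonym bead = "int \<times> nat"

definition abacus :: "nat \<Rightarrow> bead set \<Rightarrow> bool" where
  "abacus l A \<longleftrightarrow> A \<subseteq> UNIV \<times> {1..l} \<and>
     (\<exists>m n. \<forall>j\<in>{1..l}. (\<forall>c\<le>m. (c, j) \<in> A) \<and> (\<forall>c\<ge>n. (c, j) \<notin> A))"

text \<open>A partition is the list of its positive parts; \<open>part \<sigma> k\<close> is its \<open>k\<close>-th part, with
  \<open>k\<close> counted from \<open>1\<close> and infinitely many trailing zeros.\<close>

definition partition :: "nat list \<Rightarrow> bool" where
  "partition \<sigma> \<longleftrightarrow> sorted_wrt (\<ge>) \<sigma> \<and> 0 \<notin> set \<sigma>"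

definition part :: "nat list \<Rightarrow> nat \<Rightarrow> nat" where
  "part \<sigma> k = (if 1 \<le> k \<and> k \<le> length \<sigma> then \<sigma> ! (k - 1) else 0)"

definition abacus_of :: "nat \<Rightarrow> (nat \<Rightarrow> nat list) \<Rightarrow> (nat \<Rightarrow> int) \<Rightarrow> bead set" where
  "abacus_of l \<mu> s = {(int (part (\<mu> j) k) + s j - int k + 1, j) | j k. j \<in> {1..l} \<and> 1 \<le> k}"

text \<open>Only the values of the charge \<open>s\<close> on \<open>{1..l}\<close> are relevant.\<close>

definition has_charge :: "nat \<Rightarrow> bead set \<Rightarrow> (nat \<Rightarrow> int) \<Rightarrow> bool" where
  "has_charge l A s \<longleftrightarrow> (\<exists>\<mu>. (\<forall>j\<in>{1..l}. partition (\<mu> j)) \<and> A = abacus_of l \<mu> s)"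

definition bead_less :: "bead rel" where
  "bead_less = {(b, b'). fst b < fst b' \<or> (fst b = fst b' \<and> snd b > snd b')}"

definition quasiperiod :: "nat \<Rightarrow> bead set \<Rightarrow> bead list \<Rightarrow> bool" where
  "quasiperiod e A P \<longleftrightarrow> length P = e \<and> set P \<subseteq> A \<and>
     (\<forall>i. Suc i < e \<longrightarrow> fst (P ! Suc i) = fst (P ! i) - 1 \<and> snd (P ! i) \<ge> snd (P ! Suc i))"

definition largest :: "bead list set \<Rightarrow> bead list" where
  "largest S = (THE P. P \<in> S \<and> (\<forall>P'\<in>S. P' \<noteq> P \<longrightarrow> (P', P) \<in> lexord bead_less))"

definition smallest :: "bead list set \<Rightarrow> bead list" where
  "smallest S = (THE P. P \<in> S \<and> (\<forall>P'\<in>S. P' \<noteq> P \<longrightarrow> (P, P') \<in> lexord bead_less))"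

text \<open>Fore periods, vessels and aft periods are numbered from \<open>1\<close>; the index \<open>0\<close> carries
  no meaning.\<close>

function fore_period :: "nat \<Rightarrow> bead set \<Rightarrow> nat \<Rightarrow> bead list" where
  "fore_period e A k = largest {P. quasiperiod e A P \<and>
     (1 < k \<longrightarrow> (P, fore_period e A (k - 1)) \<in> lexord bead_less) \<and>
     (\<forall>i\<in>{1..<k}. set P \<inter> set (fore_period e A i) = {})}"
  by pat_completeness auto
termination
  by (relation "measure (\<lambda>(e, A, k). k)") auto

declare fore_period.simps [simp del]

definition free_bead :: "nat \<Rightarrow> bead set \<Rightarrow> bead \<Rightarrow> bool" where
  "free_bead e A b \<longleftrightarrow> b \<in> A \<and> (\<forall>k\<ge>1. b \<notin> set (fore_period e A k))"

text \<open>Membership in column \<open>c\<close> of the vessel depends only on column \<open>c + 1\<close>, and the columns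
  are bounded above, so the inductive set is the recursion on decreasing columns.\<close>

inductive_set vessel :: "nat \<Rightarrow> bead set \<Rightarrow> nat \<Rightarrow> bead set"
  for e :: nat and A :: "bead set" and k :: nat where
  fore: "b \<in> set (fore_period e A k) \<Longrightarrow> b \<in> vessel e A k"
| free: "\<lbrakk> free_bead e A (c, j);
    fst (last (fore_period e A (Suc k))) \<le> c; c \<le> fst (hd (fore_period e A k));
    \<forall>b\<in>set (fore_period e A k). c = fst b \<longrightarrow> j > snd b;
    \<forall>b\<in>set (fore_period e A (Suc k)). c = fst b \<longrightarrow> j < snd b;
    c < fst (last (fore_period e A k)) \<longrightarrow> (\<exists>j'. (c + 1, j') \<in> vessel e A k) \<rbrakk>
    \<Longrightarrow> (c, j) \<in> vessel e A k"

definition aft_period :: "nat \<Rightarrow> bead set \<Rightarrow> nat \<Rightarrow> bead list" where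
  "aft_period e A k = smallest {P. quasiperiod e A P \<and> set P \<subseteq> vessel e A k}"

definition right_shiftable :: "bead set \<Rightarrow> bead set \<Rightarrow> bool" where
  "right_shiftable A P \<longleftrightarrow> (\<forall>j\<in>snd ` P. (Max {c. (c, j) \<in> P} + 1, j) \<notin> A)"

definition right_shift :: "bead set \<Rightarrow> bead set" where
  "right_shift P = {(c + 1, j) | c j. (c, j) \<in> P}"

definition shift_right :: "bead set \<Rightarrow> bead set \<Rightarrow> bead set" where
  "shift_right A P = (A - P) \<union> right_shift P"

text \<open>All shifts performed by \<open>b_op e \<sigma>\<close> on an abacus are of right-shiftable fore periods when
  \<open>\<sigma>\<close> is a partition, hence no case distinction is needed.\<close>

definition b_op :: "nat \<Rightarrow> nat list \<Rightarrow> bead set \<Rightarrow> bead set" where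
  "b_op e \<sigma> A =
     fold (\<lambda>k. (\<lambda>B. shift_right B (set (fore_period e B k))) ^^ part \<sigma> k) [1..<Suc (length \<sigma>)] A"

definition highest_weight :: "nat \<Rightarrow> nat \<Rightarrow> bead set \<Rightarrow> bool" where
  "highest_weight e l A \<longleftrightarrow> abacus l A \<and>
     \<not> (\<exists>\<sigma> B. partition \<sigma> \<and> \<sigma> \<noteq> [] \<and> abacus l B \<and> A = b_op e \<sigma> B)"

definition crystal_decomp :: "nat \<Rightarrow> nat \<Rightarrow> bead set \<Rightarrow> nat list \<times> bead set" where
  "crystal_decomp e l A =
     (THE (\<theta>, B). partition \<theta> \<and> highest_weight e l B \<and> A = b_op e \<theta> B)"

definition position :: "nat \<Rightarrow> nat \<Rightarrow> bead set \<Rightarrow> nat list" where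
  "position e l A = fst (crystal_decomp e l A)"

definition source :: "nat \<Rightarrow> nat \<Rightarrow> bead set \<Rightarrow> bead set" where
  "source e l A = snd (crystal_decomp e l A)"

definition adds_box :: "nat \<Rightarrow> nat list \<Rightarrow> nat list \<Rightarrow> bool" where
  "adds_box k \<theta> \<rho> \<longleftrightarrow> 1 \<le> k \<and> partition \<theta> \<and> partition \<rho> \<and>
     part \<rho> = (part \<theta>)(k := part \<theta> k + 1)"

definition sl_inf_crystal :: "nat \<Rightarrow> nat \<Rightarrow> (nat \<Rightarrow> int) \<Rightarrow> bead set rel" where
  "sl_inf_crystal e l s = {(A, A').
     abacus l A \<and> has_charge l A s \<and> abacus l A' \<and> has_charge l A' s \<and>
     (\<exists>B \<theta> \<rho> k. highest_weight e l B \<and> adds_box k \<theta> \<rho> \<and> A = b_op e \<theta> B \<and> A' = b_op e \<rho> B)}"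

text \<open>\<open>None\<close> plays the role of \<open>0\<close>.\<close>

definition upsilon_minus :: "nat \<Rightarrow> nat \<Rightarrow> nat \<Rightarrow> bead set option \<Rightarrow> bead set option" where
  "upsilon_minus e l k X = (case X of None \<Rightarrow> None | Some A \<Rightarrow>
     (if \<exists>\<rho>. adds_box k \<rho> (position e l A)
      then Some (b_op e (THE \<rho>. adds_box k \<rho> (position e l A)) (source e l A))
      else None))"

end

theory Submission
  imports Defs
begin

text \<open>Identify \<open>(c, j)\<close> with \<open>(c + e, j + l)\<close>: the abacus unfolds to a subset \<open>M\<close> of
  \<open>\<int> \<times> \<int>\<close> invariant under this translation, and quasiperiods become loops, i.e. monotone
  functions \<open>x\<close> on \<open>\<int>\<close> with \<open>x (c + e) = x c + l\<close> whose graph lies in \<open>M\<close>. Loops form a lattice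
  for the pointwise order, so \<open>P\<^sub>1\<close> is the pointwise smallest loop, \<open>P\<^bsub>k+1\<^esub>\<close> is the smallest
  loop avoiding \<open>P\<^sub>1, \<dots>, P\<^sub>k\<close>, and \<open>Q\<^sub>k\<close> is the largest loop below \<open>P\<^bsub>k+1\<^esub>\<close> made of free beads
  and beads of \<open>P\<^sub>k\<close>.

  Let \<open>S\<^sub>k\<close> shift \<open>P\<^sub>k\<close> to the right, and regard it as defined only when the shifted period stays
  above \<open>P\<^bsub>k-1\<^esub>\<close>. Then \<open>S\<^sub>k\<close> changes no other fore period and turns \<open>P\<^sub>k\<close> into the aft period
  \<open>Q\<^sub>k\<close>, so it is injective; its image is the domain of \<open>S\<^bsub>k+1\<^esub>\<close>, and the \<open>S\<^sub>k\<close> commute where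
  defined. These facts alone force that the number of times that \<open>S\<^bsub>k+1\<^esub>\<close> can be applied to
  \<open>b\<^sub>\<theta> A\<close>, with \<open>A\<close> of highest weight, is \<open>\<theta>\<^sub>k - \<theta>\<^bsub>k+1\<^esub>\<close>, hence existence and uniqueness of the
  position and the description of the arrows.\<close>

section \<open>Loops on the cylinder\<close>

text \<open>A quasiperiod closes up on the cylinder because its rows lie between 1 and
  \<open>l\<close>: the last row plus \<open>l\<close> is at least the first, so the periodic
  extension is monotone. There is then no distinguished first column, and on comparable loops the
  lexicographic order is the reversed pointwise one.

  Right-shiftability only tests whether adjacent positions are occupied; it does not say where the
  shifted period lies relative to the earlier periods. Hence the stronger condition on
  \<open>S\<^sub>k\<close>.

  One argument recurs. Because \<open>rsh p (c + 1) = p c\<close>, a loop may change between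
  \<open>p\<close> and \<open>rsh p\<close> in any column and stay monotone. Pasted loops of this
  kind contradict the extremality of a fore or aft loop, or else they consist of free beads only;
  the latter is impossible because the fore loops rise beyond every bound.\<close>

definition graph :: "(int \<Rightarrow> int) \<Rightarrow> (int \<times> int) set" where
  "graph x = {(c, y). y = x c}"

definition below :: "(int \<Rightarrow> int) \<Rightarrow> (int \<Rightarrow> int) \<Rightarrow> bool" where
  "below x y \<longleftrightarrow> (\<forall>c. x c < y c)"

definition rsh :: "(int \<Rightarrow> int) \<Rightarrow> int \<Rightarrow> int" where
  "rsh x = (\<lambda>c. x (c - 1))"

definition lsh :: "(int \<Rightarrow> int) \<Rightarrow> int \<Rightarrow> int" where
  "lsh x = (\<lambda>c. x (c + 1))"

lemma mem_graph [simp]: "(c, y) \<in> graph x \<longleftrightarrow> y = x c"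
  by (simp add: graph_def)

lemma rsh_lsh [simp]: "rsh (lsh x) = x" and lsh_rsh [simp]: "lsh (rsh x) = x"
  by (simp_all add: rsh_def lsh_def)

lemma rsh_inject: "rsh x = rsh y \<Longrightarrow> x = y"
  by (metis lsh_rsh)

locale cylinder =
  fixes e l :: nat
  assumes e_pos: "0 < e" and l_pos: "0 < l"
begin

definition loop :: "(int \<Rightarrow> int) \<Rightarrow> bool" where
  "loop x \<longleftrightarrow> (\<forall>c. x c \<le> x (c + 1)) \<and> (\<forall>c. x (c + int e) = x c + int l)"

definition loop_in :: "(int \<times> int) set \<Rightarrow> (int \<Rightarrow> int) \<Rightarrow> bool" where
  "loop_in M x \<longleftrightarrow> loop x \<and> graph x \<subseteq> M"

definition periodic :: "(int \<times> int) set \<Rightarrow> bool" where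
  "periodic M \<longleftrightarrow> (\<forall>c y. (c + int e, y + int l) \<in> M \<longleftrightarrow> (c, y) \<in> M)"

text \<open>A step loop that rises by \<open>l\<close> in \<open>e\<close> columns, hence at bounded
  distance from every loop. Bounds on beads are taken relative to it because an absolute bound is
  not invariant under the translation.\<close>

definition base :: "int \<Rightarrow> int" where
  "base c = int l * (c div int e)"

definition bounded_from_below :: "(int \<times> int) set \<Rightarrow> bool" where
  "bounded_from_below M \<longleftrightarrow> (\<exists>K. \<forall>c y. (c, y) \<in> M \<longrightarrow> base c + K \<le> y)"

definition full_above :: "(int \<times> int) set \<Rightarrow> bool" where
  "full_above M \<longleftrightarrow> (\<exists>K. \<forall>c y. base c + K \<le> y \<longrightarrow> (c, y) \<in> M)"

definition admissible :: "(int \<times> int) set \<Rightarrow> bool" where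
  "admissible M \<longleftrightarrow> periodic M \<and> bounded_from_below M \<and> full_above M"

definition minloop :: "(int \<times> int) set \<Rightarrow> int \<Rightarrow> int" where
  "minloop M = (THE x. loop_in M x \<and> (\<forall>z. loop_in M z \<longrightarrow> x \<le> z))"

section \<open>Elementary properties of loops and their envelopes\<close>

lemma loop_step: "loop x \<Longrightarrow> x c \<le> x (c + 1)"
  by (simp add: loop_def)

lemma loop_step': "loop x \<Longrightarrow> x (c - 1) \<le> x c"
  using loop_step[of x "c - 1"] by simp

lemma loop_mono:
  assumes "loop x" "c \<le> d" shows "x c \<le> x d"
  using assms(2)
proof (induction d rule: int_ge_induct)
  case (step i)
  then show ?case using loop_step[OF assms(1), of i] by simp
qed simp

lemma loop_period: "loop x \<Longrightarrow> x (c + int e) = x c + int l"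
  by (simp add: loop_def)

lemma loop_period_nat: "loop x \<Longrightarrow> x (c + int e * int t) = x c + int l * int t"
proof (induction t)
  case (Suc t)
  then show ?case using loop_period[of x "c + int e * int t"] by (simp add: algebra_simps)
qed simp

lemma loop_period_int:
  assumes "loop x" shows "x (c + int e * t) = x c + int l * t"
proof (cases "0 \<le> t")
  case True
  then show ?thesis using loop_period_nat[OF assms, of c "nat t"] by simp
next
  case False
  then show ?thesis
    using loop_period_nat[OF assms, of "c + int e * t" "nat (- t)"] by (simp add: algebra_simps)
qed

lemma loop_base_bounds:
  assumes "loop x"
  shows "base c + x 0 \<le> x c" "x c \<le> base c + x 0 + int l"
proof -
  have c: "c = c mod int e + int e * (c div int e)" by simp
  have m: "0 \<le> c mod int e" "c mod int e \<le> 0 + int e" using e_pos by (simp_all add: less_imp_le)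
  have "x c = x (c mod int e) + base c"
    using loop_period_int[OF assms, of "c mod int e" "c div int e"] by (simp add: base_def)
  moreover have "x 0 \<le> x (c mod int e)" "x (c mod int e) \<le> x (0 + int e)"
    using loop_mono[OF assms] m by blast+
  ultimately show "base c + x 0 \<le> x c" "x c \<le> base c + x 0 + int l"
    using loop_period[OF assms, of 0] by auto
qed

lemma loop_base: "loop (\<lambda>c. base c + K)"
  using e_pos by (auto simp: loop_def base_def algebra_simps div_add_self2
      intro!: mult_left_mono zdiv_mono1)

lemma loop_min: "loop x \<Longrightarrow> loop y \<Longrightarrow> loop (\<lambda>c. min (x c) (y c))"
  unfolding loop_def by (auto simp: min_def) (metis order_trans linear)+

lemma loop_max: "loop x \<Longrightarrow> loop y \<Longrightarrow> loop (\<lambda>c. max (x c) (y c))"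
  unfolding loop_def by (auto simp: max_def) (metis order_trans linear)+

lemma loop_rsh: "loop x \<Longrightarrow> loop (rsh x)"
  unfolding loop_def rsh_def by (metis add_diff_cancel_right' add_diff_eq diff_add_eq)

lemma loop_lsh: "loop x \<Longrightarrow> loop (lsh x)"
  unfolding loop_def lsh_def by (metis add.commute add.left_commute)

lemma rsh_le: "loop x \<Longrightarrow> rsh x c \<le> x c"
  by (simp add: rsh_def loop_step')

lemma lsh_ge: "loop x \<Longrightarrow> x c \<le> lsh x c"
  by (simp add: lsh_def loop_step)

lemma loop_in_iff: "loop_in M x \<longleftrightarrow> loop x \<and> (\<forall>c. (c, x c) \<in> M)"
  by (auto simp: loop_in_def)

lemma loop_inD: "loop_in M x \<Longrightarrow> loop x" "loop_in M x \<Longrightarrow> (c, x c) \<in> M"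
  by (auto simp: loop_in_iff)

lemma loop_in_mono: "loop_in M x \<Longrightarrow> M \<subseteq> N \<Longrightarrow> loop_in N x"
  by (auto simp: loop_in_def)

text \<open>Going round the cylinder makes one-sided propagation reach every column: each
  \<open>b\<close> has a translate by a multiple of \<open>e\<close> to the right of
  \<open>a\<close>.\<close>

lemma propagate:
  assumes per: "\<And>c. R (c + int e) \<longleftrightarrow> R c" and step: "\<And>c. R c \<Longrightarrow> R (c + 1)" and "R a"
  shows "R b"
proof -
  have up: "R d" if "a \<le> d" for d
    using that by (induction d rule: int_ge_induct) (auto intro: step \<open>R a\<close>)
  have "R (d + int e * int t) \<longleftrightarrow> R d" for d t
  proof (induction t)
    case (Suc t)
    then show ?case using per[of "d + int e * int t"] by (simp add: algebra_simps)
  qed simp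
  moreover have "a \<le> b + int e * int (nat (a - b))"
  proof -
    have "int (nat (a - b)) \<le> int e * int (nat (a - b))"
      using e_pos by (simp add: mult_le_cancel_right1)
    then show ?thesis by linarith
  qed
  ultimately show ?thesis using up by blast
qed

text \<open>Pointwise least values exist because the values are integers bounded below by
  \<open>f\<close>. That each value is attained by a member of \<open>Z\<close> is what keeps the
  envelope inside a given bead set.\<close>

lemma all_loops_least:
  assumes "Z \<noteq> {}" and lp: "\<And>z. z \<in> Z \<Longrightarrow> loop z" and lo: "\<And>z c. z \<in> Z \<Longrightarrow> f c \<le> z c"
  obtains x where "loop x" "\<And>c. \<exists>z\<in>Z. x c = z c" "\<And>z. z \<in> Z \<Longrightarrow> x \<le> z"
proof -
  have ex: "\<exists>z\<in>Z. \<forall>z'\<in>Z. z c \<le> z' c" for c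
  proof -
    obtain z where z: "z \<in> Z" "\<forall>z'. z' \<in> Z \<longrightarrow> nat (z c - f c) \<le> nat (z' c - f c)"
      using ex_has_least_nat[of "\<lambda>z. z \<in> Z" _ "\<lambda>z. nat (z c - f c)"] assms(1) by blast
    moreover have "z c \<le> z' c" if "z' \<in> Z" for z'
      using z(2) lo[OF that, of c] lo[OF z(1), of c] that by force
    ultimately show ?thesis by blast
  qed
  then obtain w where w: "\<And>c. w c \<in> Z" "\<And>c z. z \<in> Z \<Longrightarrow> w c c \<le> z c"
    by metis
  have "loop (\<lambda>c. w c c)"
    unfolding loop_def
  proof (intro conjI allI)
    fix c
    show "w c c \<le> w (c + 1) (c + 1)"
      using w(2)[of "w (c + 1)" c] w(1)[of "c + 1"] loop_step[OF lp[OF w(1)], of "c + 1" c] by simp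
    show "w (c + int e) (c + int e) = w c c + int l"
      using w(2)[OF w(1)[of "c + int e"], of c] w(2)[OF w(1)[of c], of "c + int e"]
        loop_period[OF lp[OF w(1)], of "c + int e" c] loop_period[OF lp[OF w(1)], of c c] by simp
  qed
  then show ?thesis using that[of "\<lambda>c. w c c"] w by (auto simp: le_fun_def)
qed

lemma all_loops_greatest:
  assumes "Z \<noteq> {}" and lp: "\<And>z. z \<in> Z \<Longrightarrow> loop z" and hi: "\<And>z c. z \<in> Z \<Longrightarrow> z c \<le> f c"
  obtains x where "loop x" "\<And>c. \<exists>z\<in>Z. x c = z c" "\<And>z. z \<in> Z \<Longrightarrow> z \<le> x"
proof -
  \<comment> \<open>The half-turn (c, y) to (-c, -y) preserves loops and exchanges upper and lower
    envelopes.\<close>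
  define r :: "(int \<Rightarrow> int) \<Rightarrow> int \<Rightarrow> int" where "r = (\<lambda>z c. - z (- c))"
  have rr: "r (r z) = z" for z by (simp add: r_def)
  have lr: "loop (r z)" if "loop z" for z
    unfolding loop_def r_def
  proof (intro conjI allI)
    fix c
    show "- z (- c) \<le> - z (- (c + 1))" using loop_step[OF that, of "- c - 1"] by simp
    show "- z (- (c + int e)) = - z (- c) + int l"
      using loop_period[OF that, of "- c - int e"] by simp
  qed
  obtain x where x: "loop x" "\<And>c. \<exists>z\<in>r ` Z. x c = z c" "\<And>z. z \<in> r ` Z \<Longrightarrow> x \<le> z"
  proof (rule all_loops_least[of "r ` Z" "r f"])
    show "loop z" if "z \<in> r ` Z" for z using that lr lp by auto
    show "r f c \<le> z c" if "z \<in> r ` Z" for z c using that hi by (auto simp: r_def)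
  qed (use assms(1) that in auto)
  show ?thesis
  proof (rule that)
    show "loop (r x)" by (rule lr[OF x(1)])
    show "\<exists>z\<in>Z. r x c = z c" for c using x(2)[of "- c"] by (auto simp: r_def)
    show "z \<le> r x" if "z \<in> Z" for z
    proof (rule le_funI)
      fix c
      have "x (- c) \<le> r z (- c)" using x(3)[of "r z"] that by (simp add: le_fun_def)
      then show "z c \<le> r x c" by (simp add: r_def)
    qed
  qed
qed

lemma minloop_eqI:
  assumes "loop_in M x" "\<And>z. loop_in M z \<Longrightarrow> x \<le> z"
  shows "minloop M = x"
  unfolding minloop_def using assms by (intro the_equality) (auto intro: order_antisym)

lemma minloop:
  assumes "bounded_from_below M" "loop_in M w"
  shows "loop_in M (minloop M)" and "\<And>z. loop_in M z \<Longrightarrow> minloop M \<le> z"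
proof -
  obtain K where K: "\<And>c y. (c, y) \<in> M \<Longrightarrow> base c + K \<le> y"
    using assms(1) by (auto simp: bounded_from_below_def)
  obtain x where x: "loop x" "\<And>c. \<exists>z\<in>{z. loop_in M z}. x c = z c"
      "\<And>z. z \<in> {z. loop_in M z} \<Longrightarrow> x \<le> z"
  proof (rule all_loops_least[of "{z. loop_in M z}" "\<lambda>c. base c + K"])
    show "{z. loop_in M z} \<noteq> {}" using assms(2) by blast
    show "loop z" if "z \<in> {z. loop_in M z}" for z using that loop_inD by blast
    show "base c + K \<le> z c" if "z \<in> {z. loop_in M z}" for z c using that loop_inD(2) K by blast
  qed (use that in blast)
  have "loop_in M x"
    unfolding loop_in_iff
  proof (intro conjI allI)
    show "(c, x c) \<in> M" for c
      using x(2)[of c] by (auto dest: loop_inD)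
  qed (rule x(1))
  then have "minloop M = x"
    using x(3) by (intro minloop_eqI) auto
  then show "loop_in M (minloop M)" "\<And>z. loop_in M z \<Longrightarrow> minloop M \<le> z"
    using \<open>loop_in M x\<close> x(3) by auto
qed

section \<open>Admissible bead sets and their smallest loops\<close>

lemma admissible_diff_graph:
  assumes "admissible M" "loop x" shows "admissible (M - graph x)"
proof -
  obtain K where K: "\<And>c y. base c + K \<le> y \<Longrightarrow> (c, y) \<in> M"
    using assms(1) by (auto simp: admissible_def full_above_def)
  have "(c, y) \<in> M - graph x" if "base c + max K (x 0 + int l + 1) \<le> y" for c y
    using that K[of c y] loop_base_bounds(2)[OF assms(2), of c] by auto
  then have "full_above (M - graph x)"
    unfolding full_above_def by blast
  moreover have "bounded_from_below (M - graph x)"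
    using assms(1) by (auto simp: admissible_def bounded_from_below_def)
  moreover have "periodic (M - graph x)"
    using assms(1) loop_period[OF assms(2)] by (auto simp: admissible_def periodic_def)
  ultimately show ?thesis
    by (simp add: admissible_def)
qed

lemma admissible_Un_graph:
  assumes "admissible M" "loop x" shows "admissible (M \<union> graph x)"
proof -
  obtain K where K: "\<And>c y. (c, y) \<in> M \<Longrightarrow> base c + K \<le> y"
    using assms(1) by (auto simp: admissible_def bounded_from_below_def)
  have "base c + min K (x 0) \<le> y" if "(c, y) \<in> M \<union> graph x" for c y
    using that K[of c y] loop_base_bounds(1)[OF assms(2), of c] by auto
  then have "bounded_from_below (M \<union> graph x)"
    unfolding bounded_from_below_def by blast
  moreover have "full_above (M \<union> graph x)"
    using assms(1) by (auto simp: admissible_def full_above_def)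
  moreover have "periodic (M \<union> graph x)"
    using assms(1) loop_period[OF assms(2)] by (auto simp: admissible_def periodic_def)
  ultimately show ?thesis
    by (simp add: admissible_def)
qed

lemma admissible_minloop:
  assumes "admissible M"
  shows "loop_in M (minloop M)" and "\<And>z. loop_in M z \<Longrightarrow> minloop M \<le> z"
proof -
  obtain K where K: "\<And>c y. base c + K \<le> y \<Longrightarrow> (c, y) \<in> M"
    using assms by (auto simp: admissible_def full_above_def)
  then have "loop_in M (\<lambda>c. base c + K)"
    by (simp add: loop_in_iff loop_base)
  then show "loop_in M (minloop M)" and "\<And>z. loop_in M z \<Longrightarrow> minloop M \<le> z"
    using minloop assms by (auto simp: admissible_def)
qed

section \<open>Fore loops and free beads\<close>

primrec rest :: "(int \<times> int) set \<Rightarrow> nat \<Rightarrow> (int \<times> int) set" where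
  "rest M 0 = M"
| "rest M (Suc k) = rest M k - graph (minloop (rest M k))"

text \<open>The numbering starts at \<open>0\<close> here: \<open>fore M k\<close> stands for the fore period with number \<open>k + 1\<close>.\<close>

definition fore :: "(int \<times> int) set \<Rightarrow> nat \<Rightarrow> int \<Rightarrow> int" where
  "fore M k = minloop (rest M k)"

definition free :: "(int \<times> int) set \<Rightarrow> (int \<times> int) set" where
  "free M = {(c, y). (c, y) \<in> M \<and> (\<forall>k. y \<noteq> fore M k c)}"

lemma mem_rest: "(c, y) \<in> rest M k \<longleftrightarrow> (c, y) \<in> M \<and> (\<forall>i<k. y \<noteq> fore M i c)"
  by (induction k) (auto simp: fore_def less_Suc_eq)

lemma free_in_rest: "(c, y) \<in> free M \<Longrightarrow> (c, y) \<in> rest M j"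
  by (simp add: free_def mem_rest)

lemma free_not_fore: "(c, fore M j c) \<notin> free M"
  by (auto simp: free_def)

lemma admissible_rest: "admissible M \<Longrightarrow> admissible (rest M k)"
  by (induction k) (auto intro: admissible_diff_graph loop_inD admissible_minloop)

declare rest.simps(2) [simp del]

context
  fixes M :: "(int \<times> int) set"
  assumes adm: "admissible M"
begin

lemma loop_in_rest_fore: "loop_in (rest M k) (fore M k)"
  unfolding fore_def by (intro admissible_minloop admissible_rest adm)

lemma fore_le: "loop_in (rest M k) z \<Longrightarrow> fore M k \<le> z"
  unfolding fore_def by (intro admissible_minloop admissible_rest adm)

lemma fore_le': "loop_in (rest M k) z \<Longrightarrow> fore M k c \<le> z c"
  using fore_le by (simp add: le_fun_def)

lemma loop_fore: "loop (fore M k)"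
  using loop_in_rest_fore loop_inD by blast

lemma fore_mem: "(c, fore M k c) \<in> M"
  using loop_inD(2)[OF loop_in_rest_fore] by (simp add: mem_rest)

text \<open>Fore loops never cross: the later loop competes in the minimisation that defines the
  earlier one, and avoids it.\<close>

lemma fore_less: 
  assumes "i < j" shows "fore M i c < fore M j c"
proof -
  have "loop_in (rest M i) (fore M j)"
    using loop_in_rest_fore[of j] assms by (auto simp: loop_in_iff mem_rest)
  then have "fore M i c \<le> fore M j c" using fore_le by (simp add: le_fun_def)
  moreover have "fore M j c \<noteq> fore M i c"
    using loop_inD(2)[OF loop_in_rest_fore[of j]] assms by (auto simp: mem_rest)
  ultimately show ?thesis by simp
qed

lemma fore_less_iff: "fore M i c < fore M j c \<longleftrightarrow> i < j"
  using fore_less by (metis linorder_neqE_nat order_less_asym order_less_irrefl)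

lemma fore_eq_iff: "fore M i c = fore M j c \<longleftrightarrow> i = j"
  using fore_less by (metis linorder_neqE_nat order_less_irrefl)

lemma fore_le_iff: "fore M i c \<le> fore M j c \<longleftrightarrow> i \<le> j"
  using fore_less_iff by (metis linorder_not_less)

lemma fore_ge: "fore M 0 c + int k \<le> fore M k c"
proof (induction k)
  case (Suc k)
  then show ?case using fore_less[of k "Suc k" c] by simp
qed simp

text \<open>A free loop would survive in every \<open>rest M k\<close> and so bound all fore loops
  from above, while these rise by at least one with each index.\<close>

lemma no_loop_in_free: "\<not> loop_in (free M) z"
proof
  assume z: "loop_in (free M) z"
  have "fore M k 0 \<le> z 0" for k
    using fore_le[of k z] z by (auto simp: loop_in_iff mem_rest free_def le_fun_def)
  then show False using fore_ge[of 0 "nat (z 0 - fore M 0 0 + 1)"] by (smt (verit) int_nat_eq)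
qed

lemma free_or_fore: "(c, y) \<in> M \<Longrightarrow> (c, y) \<in> free M \<or> (\<exists>i. y = fore M i c)"
  by (auto simp: free_def)

lemma periodic_M: "(c + int e, y + int l) \<in> M \<longleftrightarrow> (c, y) \<in> M"
  using adm by (simp add: admissible_def periodic_def)

end

text \<open>Checks a candidate sequence without circularity: the sets over which one minimises are
  described by the candidate \<open>f\<close> instead of the unknown \<open>fore M\<close>.\<close>

lemma fore_eqI:
  assumes "\<And>k. loop_in {(c, y). (c, y) \<in> M \<and> (\<forall>i<k. y \<noteq> f i c)} (f k)"
    and "\<And>k z. loop_in {(c, y). (c, y) \<in> M \<and> (\<forall>i<k. y \<noteq> f i c)} z \<Longrightarrow> f k \<le> z"
  shows "fore M = f"
proof
  fix k show "fore M k = f k"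
  proof (induction k rule: less_induct)
    case (less k)
    have "rest M k = {(c, y). (c, y) \<in> M \<and> (\<forall>i<k. y \<noteq> f i c)}"
      using less by (auto simp: mem_rest)
    then show ?case unfolding fore_def using assms by (intro minloop_eqI) auto
  qed
qed

text \<open>The reason why shifting is reversible: \<open>p\<close> is the smallest loop of \<open>X \<union> p\<close>, so a loop
  above \<open>rsh p\<close> cannot leave \<open>rsh p\<close> and come back to it, since replacing \<open>rsh p\<close> by \<open>p\<close> along
  it would give a loop that is not above \<open>p\<close>.\<close>

lemma above_rsh_dichotomy:
  assumes p: "loop p" and v: "loop v" and ge: "rsh p \<le> v"
    and X: "\<And>c. v c \<noteq> rsh p c \<Longrightarrow> (c, v c) \<in> X" and pX: "\<And>c. (c, p c) \<notin> X"
    and least: "\<And>w. loop_in (X \<union> graph p) w \<Longrightarrow> p \<le> w"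
  shows "v = rsh p \<or> below (rsh p) v"
proof (cases "v = rsh p")
  case False
  then obtain a where a: "v a \<noteq> rsh p a" by blast
  define w where "w c = (if v c = rsh p c then p c else v c)" for c
  have ge': "rsh p c \<le> v c" for c using ge by (simp add: le_fun_def)
  have p1: "p c = rsh p (c + 1)" for c by (simp add: rsh_def)
  have "loop w" unfolding loop_def
  proof (intro conjI allI)
    fix c
    show "w c \<le> w (c + 1)"
      using ge'[of "c + 1"] p1[of c] loop_step[OF v, of c] loop_step[OF p, of c]
      by (auto simp: w_def)
    show "w (c + int e) = w c + int l"
      using loop_period[OF v, of c] loop_period[OF p, of c] loop_period[OF loop_rsh[OF p], of c]
      by (auto simp: w_def)
  qed
  then have "loop_in (X \<union> graph p) w"
    using X by (auto simp: loop_in_iff w_def)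
  then have pw: "p c \<le> w c" for c using least by (simp add: le_fun_def)
  have "v c \<noteq> rsh p c" for c
  proof (rule propagate[of "\<lambda>c. v c \<noteq> rsh p c" a])
    show "v (c + int e) \<noteq> rsh p (c + int e) \<longleftrightarrow> v c \<noteq> rsh p c" for c
      using loop_period[OF v, of c] loop_period[OF loop_rsh[OF p], of c] by auto
    \<comment> \<open>Off \<open>rsh p\<close> one has \<open>p c < v c\<close>, and
      \<open>p c\<close> is the value of \<open>rsh p\<close> in the next column, so the monotone
      \<open>v\<close> cannot meet it there.\<close>
    show "v (c + 1) \<noteq> rsh p (c + 1)" if "v c \<noteq> rsh p c" for c
    proof -
      have "p c \<le> v c" using pw[of c] that by (simp add: w_def)
      moreover have "p c \<noteq> v c" using X[OF that] pX[of c] by metis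
      ultimately show ?thesis using loop_step[OF v, of c] p1[of c] by auto
    qed
  qed (rule a)
  then show ?thesis using ge' by (metis below_def order_le_imp_less_or_eq)
qed simp

section \<open>Vessels, aft loops and the condition for a shift\<close>

definition vessel_loops :: "(int \<times> int) set \<Rightarrow> nat \<Rightarrow> (int \<Rightarrow> int) set" where
  "vessel_loops M k =
     {z. loop_in (free M \<union> graph (fore M k)) z \<and> below z (fore M (Suc k))}"

definition aft :: "(int \<times> int) set \<Rightarrow> nat \<Rightarrow> int \<Rightarrow> int" where
  "aft M k = (THE x. x \<in> vessel_loops M k \<and> (\<forall>z\<in>vessel_loops M k. z \<le> x))"

lemma aft_eqI:
  assumes "x \<in> vessel_loops M k" "\<And>z. z \<in> vessel_loops M k \<Longrightarrow> z \<le> x"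
  shows "aft M k = x"
  unfolding aft_def using assms by (intro the_equality) (auto intro: order_antisym)

text \<open>Stronger than right-shiftability: the shifted loop must not cross earlier fore periods.\<close>

definition shiftable :: "(int \<times> int) set \<Rightarrow> nat \<Rightarrow> bool" where
  "shiftable M k \<longleftrightarrow> (\<forall>j<k. below (fore M j) (rsh (fore M k)))"

definition shift :: "nat \<Rightarrow> (int \<times> int) set \<Rightarrow> (int \<times> int) set" where
  "shift k M = (M - graph (fore M k)) \<union> graph (rsh (fore M k))"

lemma mem_shift: "(c, y) \<in> shift k M \<longleftrightarrow> y = rsh (fore M k) c \<or> (c, y) \<in> M \<and> y \<noteq> fore M k c"
  by (auto simp: shift_def)

lemma below_rsh: "below (rsh x) (rsh y) \<longleftrightarrow> below x y"
  unfolding below_def rsh_def by (metis add_diff_cancel_right')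

lemma below_le: "x \<le> y \<Longrightarrow> below y z \<Longrightarrow> below x z"
  unfolding below_def le_fun_def using order_le_less_trans by blast

lemma le_below: "below x y \<Longrightarrow> y \<le> z \<Longrightarrow> below x z"
  unfolding below_def le_fun_def using order_less_le_trans by blast

context
  fixes M :: "(int \<times> int) set"
  assumes adm: "admissible M"
begin

lemma below_fore: "i < j \<Longrightarrow> below (fore M i) (fore M j)"
  by (simp add: below_def fore_less[OF adm])

lemma fore_mono: "i \<le> j \<Longrightarrow> fore M i \<le> fore M j"
  by (simp add: le_fun_def fore_le_iff[OF adm])

lemma fore_le_vessel: "z \<in> vessel_loops M k \<Longrightarrow> fore M k \<le> z"
proof (rule fore_le[OF adm])
  assume z: "z \<in> vessel_loops M k"
  have "(c, z c) \<in> rest M k" for c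
  proof (cases "z c = fore M k c")
    case True
    then show ?thesis using loop_inD(2)[OF loop_in_rest_fore[OF adm]] by simp
  next
    case False
    then have "(c, z c) \<in> free M" using z by (auto simp: vessel_loops_def loop_in_iff)
    then show ?thesis by (simp add: mem_rest free_def)
  qed
  then show "loop_in (rest M k) z"
    using z by (simp add: vessel_loops_def loop_in_iff)
qed

text \<open>The family contains \<open>fore M k\<close> and is bounded by
  \<open>fore M (Suc k)\<close>. Its upper envelope attains its values columnwise, so it stays in
  the bead set and strictly below the bound.\<close>

lemma aft:
  shows aft_in: "aft M k \<in> vessel_loops M k"
    and le_aft: "\<And>z. z \<in> vessel_loops M k \<Longrightarrow> z \<le> aft M k"
proof -
  have "fore M k \<in> vessel_loops M k"
    by (auto simp: vessel_loops_def loop_in_iff loop_fore[OF adm] below_fore)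
  then have ne: "vessel_loops M k \<noteq> {}" by blast
  have V: "loop z" "(c, z c) \<in> free M \<union> graph (fore M k)" "z c < fore M (Suc k) c"
    if "z \<in> vessel_loops M k" for z c
    using that by (auto simp: vessel_loops_def loop_in_iff below_def)
  obtain x where x: "loop x" "\<And>c. \<exists>z\<in>vessel_loops M k. x c = z c"
      "\<And>z. z \<in> vessel_loops M k \<Longrightarrow> z \<le> x"
    by (rule all_loops_greatest[OF ne, of "fore M (Suc k)"]) (use V less_imp_le in blast)+
  have "(c, x c) \<in> free M \<union> graph (fore M k) \<and> x c < fore M (Suc k) c" for c
    using x(2)[of c] V by metis
  then have "x \<in> vessel_loops M k"
    using x(1) unfolding vessel_loops_def loop_in_iff below_def by blast
  then have "aft M k = x" using x by (intro aft_eqI)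
  then show "aft M k \<in> vessel_loops M k" "\<And>z. z \<in> vessel_loops M k \<Longrightarrow> z \<le> aft M k"
    using x \<open>x \<in> vessel_loops M k\<close> by auto
qed

lemma loop_aft: "loop (aft M k)"
  and below_aft: "below (aft M k) (fore M (Suc k))"
  and aft_mem: "(c, aft M k c) \<in> free M \<or> aft M k c = fore M k c"
  and fore_le_aft: "fore M k \<le> aft M k"
  using aft_in[of k] fore_le_vessel by (auto simp: vessel_loops_def loop_in_iff)

lemma shiftable_0 [simp]: "shiftable M 0"
  by (simp add: shiftable_def)

lemma shiftable_Suc: "shiftable M (Suc k) \<longleftrightarrow> below (fore M k) (rsh (fore M (Suc k)))"
proof
  assume "below (fore M k) (rsh (fore M (Suc k)))"
  then show "shiftable M (Suc k)"
    unfolding shiftable_def less_Suc_eq_le using fore_mono below_le by blast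
qed (simp add: shiftable_def)

text \<open>The right side says that the aft loop can move left without reaching
  \<open>fore M (Suc k)\<close>, so this compares the domain of one shift with the image of the
  preceding one. If the shifted \<open>fore M (Suc k)\<close> stayed above \<open>fore M k\<close>
  but somewhere not above \<open>aft M k\<close>, a detour along the aft loop would undercut
  \<open>fore M (Suc k)\<close>.\<close>

lemma shiftable_Suc_iff_aft:
  "shiftable M (Suc k) \<longleftrightarrow> below (lsh (aft M k)) (fore M (Suc k))"
proof -
  let ?y = "fore M (Suc k)" and ?q = "aft M k"
  have ly: "loop ?y" and lq: "loop ?q" by (simp_all add: loop_fore[OF adm] loop_aft)
  have eq: "below (lsh ?q) ?y \<longleftrightarrow> below ?q (rsh ?y)"
    using below_rsh[of "lsh ?q" ?y] by simp
  have "below ?q (rsh ?y)" if sh: "below (fore M k) (rsh ?y)"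
  proof -
    \<comment> \<open>Where \<open>u\<close> follows \<open>?q\<close> it is above
      \<open>fore M k\<close>, hence on free beads. Entering \<open>?q\<close> in column
      \<open>c + 1\<close> preserves monotonicity, because the case condition there reads
      \<open>?y c <= ?q (c + 1)\<close>.\<close>
    define u where "u c = (if rsh ?y c \<le> ?q c then ?q c else ?y c)" for c
    have qy: "?q c < ?y c" for c using below_aft[of k] by (simp add: below_def)
    have y1: "?y c = rsh ?y (c + 1)" for c by (simp add: rsh_def)
    have "loop u" unfolding loop_def
    proof (intro conjI allI)
      fix c
      show "u c \<le> u (c + 1)"
        using qy[of c] y1[of c] loop_step[OF ly, of c] by (auto simp: u_def)
      show "u (c + int e) = u c + int l"
        using loop_period[OF lq, of c] loop_period[OF ly, of c] loop_period[OF loop_rsh[OF ly], of c]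
        by (auto simp: u_def)
    qed
    moreover have "(c, u c) \<in> rest M (Suc k)" for c
    proof (cases "rsh ?y c \<le> ?q c")
      case True
      moreover have "fore M k c < rsh ?y c" using sh by (simp add: below_def)
      ultimately have "(c, ?q c) \<in> free M" using aft_mem[of c k] by auto
      then show ?thesis using True by (auto simp: u_def mem_rest free_def)
    next
      case False
      then show ?thesis using loop_inD(2)[OF loop_in_rest_fore[OF adm, of "Suc k"], of c] by (simp add: u_def)
    qed
    ultimately have "?y \<le> u" by (intro fore_le[OF adm]) (simp add: loop_in_iff)
    then have "?y c \<le> u c" for c by (simp add: le_fun_def)
    then show ?thesis unfolding below_def u_def using qy
      by (smt (verit))
  qed
  moreover have "below (fore M k) (rsh ?y)" if "below ?q (rsh ?y)"
    using that fore_le_aft below_le by blast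
  ultimately show ?thesis by (auto simp: shiftable_Suc eq)
qed

text \<open>High up every position is a bead, so \<open>fore M k\<close> raised by one competes with
  \<open>fore M (Suc k)\<close>. Together with shiftability this makes \<open>fore M k\<close>
  nonincreasing, against its rise by \<open>l > 0\<close> over one period.\<close>

lemma eventually_not_shiftable: "\<exists>K. \<forall>k\<ge>K. \<not> shiftable M k"
proof -
  obtain K where K: "\<And>c y. base c + K \<le> y \<Longrightarrow> (c, y) \<in> M"
    using adm by (auto simp: admissible_def full_above_def)
  \<comment> \<open>As fore loops rise by at least one per index, this bound on \<open>k\<close>
    puts \<open>fore M k\<close> into the full region.\<close>
  have not_shiftable: "\<not> shiftable M (Suc k)" if k: "k \<ge> nat (K - fore M 0 0)" for k
  proof
    assume sh: "shiftable M (Suc k)"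
    let ?w = "fore M k"
    have lw: "loop ?w" by (rule loop_fore[OF adm])
    have "base c + K \<le> ?w c + 1" for c
      using fore_ge[OF adm, of c k] loop_base_bounds(1)[OF loop_fore[OF adm, of 0], of c] k by linarith
    moreover have "?w c + 1 \<noteq> fore M i c" if "i < Suc k" for i c
      using that fore_le_iff[OF adm, of i c k] by simp
    ultimately have "loop_in (rest M (Suc k)) (\<lambda>c. ?w c + 1)"
      using lw K by (auto simp: loop_in_iff mem_rest loop_def)
    then have "fore M (Suc k) c \<le> ?w c + 1" for c by (rule fore_le'[OF adm])
    moreover have "?w c < fore M (Suc k) (c - 1)" for c
      using sh by (simp add: shiftable_Suc below_def rsh_def)
    ultimately have le: "?w c \<le> ?w (c - 1)" for c
      by (smt (verit))
    have "?w (int n) \<le> ?w 0" for n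
    proof (induction n)
      case (Suc n)
      then show ?case using le[of "int (Suc n)"] by simp
    qed simp
    from this[of e] show False using loop_period[OF lw, of 0] l_pos by simp
  qed
  then have "\<forall>k\<ge>Suc (nat (K - fore M 0 0)). \<not> shiftable M k"
    using not_shiftable by (metis Suc_le_D Suc_le_mono)
  then show ?thesis by blast
qed

lemma admissible_shift: "admissible (shift k M)"
  unfolding shift_def
  by (intro admissible_Un_graph admissible_diff_graph adm loop_rsh loop_fore[OF adm])

text \<open>If \<open>rsh p\<close> met a bead outside \<open>p\<close> then \<open>p\<close> could be lowered.\<close>

lemma rsh_fore_disjoint:
  assumes "shiftable M k" "(c, rsh (fore M k) c) \<in> M"
  shows "rsh (fore M k) c = fore M k c"
proof -
  let ?p = "fore M k"
  have lp: "loop ?p" by (rule loop_fore[OF adm])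
  \<comment> \<open>Lowering \<open>?p\<close> to \<open>rsh ?p\<close> wherever that is a bead
    stays monotone because \<open>?p c = rsh ?p (c + 1)\<close>; shiftability keeps \<open>u\<close>
    off the earlier fore loops.\<close>
  define u where "u c = (if (c, rsh ?p c) \<in> M then rsh ?p c else ?p c)" for c
  have p1: "?p c = rsh ?p (c + 1)" for c by (simp add: rsh_def)
  have "loop u" unfolding loop_def
  proof (intro conjI allI)
    fix c
    show "u c \<le> u (c + 1)"
      using p1[of c] rsh_le[OF lp, of c] loop_step[OF lp, of c] by (auto simp: u_def)
    show "u (c + int e) = u c + int l"
      using loop_period[OF lp, of c] loop_period[OF loop_rsh[OF lp], of c] periodic_M[OF adm]
      by (auto simp: u_def)
  qed
  moreover have "(c, u c) \<in> rest M k" for c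
  proof -
    have "fore M i c < rsh ?p c \<and> fore M i c < ?p c" if "i < k" for i
      using that assms(1) fore_less[OF adm] by (auto simp: shiftable_def below_def)
    then show ?thesis
      using fore_mem[OF adm, of c k] by (fastforce simp: u_def mem_rest)
  qed
  ultimately have "?p \<le> u" by (intro fore_le[OF adm]) (simp add: loop_in_iff)
  then have "?p c \<le> rsh ?p c" using assms(2) by (auto simp: le_fun_def u_def dest: spec[of _ c])
  then show ?thesis using rsh_le[OF lp, of c] by simp
qed

lemma shift_inverse:
  assumes "shiftable M k"
  shows "(shift k M - graph (rsh (fore M k))) \<union> graph (fore M k) = M"
proof -
  have "(c, y) \<in> (shift k M - graph (rsh (fore M k))) \<union> graph (fore M k) \<longleftrightarrow> (c, y) \<in> M" for c y
    using rsh_fore_disjoint[OF assms, of c] fore_mem[OF adm, of c k] by (auto simp: mem_shift)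
  then show ?thesis by (intro set_eqI) (metis surj_pair)
qed

end

subsection \<open>Shifting a fore period to the right\<close>

lemma bounded_from_below_subset: "bounded_from_below N \<Longrightarrow> M \<subseteq> N \<Longrightarrow> bounded_from_below M"
  unfolding bounded_from_below_def by blast

context
  fixes M :: "(int \<times> int) set" and k :: nat
  assumes adm: "admissible M" and shiftable: "shiftable M k"
begin

text \<open>The candidate for the fore loop of index \<open>k\<close> after the shift. It can lie
  below the shifted loop, since it may take shortcuts through free beads.\<close>

definition new_fore :: "int \<Rightarrow> int" where
  "new_fore = minloop (free M \<union> graph (rsh (fore M k)))"

lemma mem_shift_cases:
  "(c, y) \<in> shift k M \<longleftrightarrow> y = rsh (fore M k) c \<or> (c, y) \<in> free M \<or> (\<exists>i. i \<noteq> k \<and> y = fore M i c)"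
  unfolding mem_shift using free_or_fore[OF adm, of c y] fore_mem[OF adm] fore_eq_iff[OF adm]
  by (auto simp: free_def)

lemma less_rsh_fore: "j < k \<Longrightarrow> fore M j c < rsh (fore M k) c"
  using shiftable by (simp add: shiftable_def below_def)

lemma rsh_fore_le: "rsh (fore M k) c \<le> fore M k c"
  by (rule rsh_le[OF loop_fore[OF adm]])

lemma rsh_fore_less: "k < j \<Longrightarrow> rsh (fore M k) c < fore M j c"
  using rsh_fore_le[of c] fore_less[OF adm, of k j c] by simp

lemma new_fore:
  shows loop_in_new_fore: "loop_in (free M \<union> graph (rsh (fore M k))) new_fore"
    and new_fore_le: "\<And>z. loop_in (free M \<union> graph (rsh (fore M k))) z \<Longrightarrow> new_fore \<le> z"
proof -
  have "free M \<union> graph (rsh (fore M k)) \<subseteq> shift k M"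
    using mem_shift_cases by auto
  moreover have "bounded_from_below (shift k M)"
    using admissible_shift[OF adm] by (simp add: admissible_def)
  ultimately have b: "bounded_from_below (free M \<union> graph (rsh (fore M k)))"
    by (rule bounded_from_below_subset[rotated])
  have w: "loop_in (free M \<union> graph (rsh (fore M k))) (rsh (fore M k))"
    by (simp add: loop_in_iff loop_rsh loop_fore[OF adm])
  show "loop_in (free M \<union> graph (rsh (fore M k))) new_fore"
    "\<And>z. loop_in (free M \<union> graph (rsh (fore M k))) z \<Longrightarrow> new_fore \<le> z"
    using minloop[OF b w] by (simp_all add: new_fore_def)
qed

lemma new_fore_le_rsh: "new_fore c \<le> rsh (fore M k) c"
  using new_fore_le[of "rsh (fore M k)"]
  by (simp add: loop_in_iff loop_rsh loop_fore[OF adm] le_fun_def)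

lemma new_fore_cases: "(c, new_fore c) \<in> free M \<or> new_fore c = rsh (fore M k) c"
  using loop_inD(2)[OF loop_in_new_fore] by auto

lemma new_fore_not_fore: "j \<noteq> k \<Longrightarrow> new_fore c \<noteq> fore M j c"
  using new_fore_cases[of c] free_not_fore less_rsh_fore[of j c] rsh_fore_less[of j c]
  by (metis linorder_neqE_nat order_less_irrefl)

text \<open>For indices below \<open>k\<close>, a competitor cut off at the old loop cannot reach
  \<open>rsh (fore M k)\<close>, by shiftability. At index \<open>k\<close>, cutting off at
  \<open>rsh (fore M k)\<close> leaves only free and shifted beads. Beyond \<open>Suc k\<close> only
  old beads are involved. The delicate index is \<open>Suc k\<close>, where shifted beads that
  \<open>new_fore\<close> does not use become available.\<close>

lemma fore_shift: "fore (shift k M) = (fore M)(k := new_fore)"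
proof -
  let ?P = "fore M" and ?p = "fore M k" and ?s = "rsh (fore M k)" and ?m = new_fore
  let ?y = "fore M (Suc k)"
  define f where "f = ?P(k := ?m)"
  define R where "R i = {(c, y). (c, y) \<in> shift k M \<and> (\<forall>j<i. y \<noteq> f j c)}" for i
  have fk: "f k = ?m" and fn: "\<And>i. i \<noteq> k \<Longrightarrow> f i = ?P i" by (simp_all add: f_def)
  have lP: "loop (?P i)" for i by (rule loop_fore[OF adm])
  have lm: "loop ?m" by (rule loop_inD(1)[OF loop_in_new_fore])
  have ls: "loop ?s" by (rule loop_rsh[OF lP])
  have RD: "(c, z c) \<in> shift k M" "j < i \<Longrightarrow> z c \<noteq> f j c" if "loop_in (R i) z" for c i j z
    using loop_inD(2)[OF that, of c] by (auto simp: R_def)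
  have RI: "loop_in (R i) z"
    if "loop z" "\<And>c. (c, z c) \<in> shift k M" "\<And>c j. j < i \<Longrightarrow> z c \<noteq> f j c" for z i
    using that by (simp add: R_def loop_in_iff)
  have m_mem: "(c, ?m c) \<in> shift k M" for c
    using new_fore_cases[of c] mem_shift_cases by blast
  have low: "?P i c \<le> z c" if "i < k" "loop_in (R i) z" for i z c
  proof -
    define u where "u = (\<lambda>c. min (z c) (?P i c))"
    have "(c, u c) \<in> rest M i" for c
    proof (cases "z c < ?P i c")
      case True
      then have "z c \<noteq> ?s c" using less_rsh_fore[OF that(1), of c] by simp
      then have "(c, z c) \<in> M" using RD(1)[OF that(2), of c] by (simp add: mem_shift)
      moreover have "z c \<noteq> ?P j c" if "j < i" for j
        using RD(2)[OF \<open>loop_in (R i) z\<close> that] fn[of j] that \<open>i < k\<close> by auto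
      ultimately show ?thesis using True by (simp add: mem_rest u_def)
    next
      case False
      then show ?thesis using loop_inD(2)[OF loop_in_rest_fore[OF adm, of i], of c] by (simp add: u_def)
    qed
    then have "loop_in (rest M i) u"
      using loop_min[OF loop_inD(1)[OF that(2)] lP[of i]] by (simp add: loop_in_iff u_def)
    from fore_le'[OF adm this, of c] show ?thesis by (simp add: u_def)
  qed
  have m_low: "?P j c < ?m c" if "j < k" for j c
  proof -
    have "loop_in (R j) ?m"
      using that by (intro RI lm m_mem) (simp add: fn new_fore_not_fore)
    from low[OF that this, of c] show ?thesis using new_fore_not_fore[of j c] that by simp
  qed
  have m_high: "?m c < ?P j c" if "k < j" for j c
    using new_fore_le_rsh[of c] rsh_fore_less[OF that, of c] by simp
  have cases: "(c, z c) \<in> free M \<or> z c = ?s c"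
    if "loop_in (R k) z" "z c < ?y c" for z c
  proof -
    have "z c \<noteq> ?P i c" if "i \<noteq> k" for i
    proof (cases "i < k")
      case True
      then show ?thesis using RD(2)[OF \<open>loop_in (R k) z\<close> True] fn[OF that] by simp
    next
      case False
      then have "?y c \<le> ?P i c" using that fore_le_iff[OF adm, of "Suc k" c i] by simp
      then show ?thesis using \<open>z c < ?y c\<close> by simp
    qed
    then show ?thesis using RD(1)[OF that(1), of c] mem_shift_cases by blast
  qed
  have at_k: "?m c \<le> z c" if "loop_in (R k) z" for z c
  proof -
    define u where "u = (\<lambda>c. min (z c) (?s c))"
    have "(c, u c) \<in> free M \<union> graph ?s" for c
      using cases[OF that, of c] rsh_fore_less[of "Suc k" c] by (auto simp: u_def min_def)
    then have "loop_in (free M \<union> graph ?s) u"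
      using loop_min[OF loop_inD(1)[OF that] ls] by (simp add: loop_in_iff u_def)
    from new_fore_le[OF this] show ?thesis by (auto simp: u_def le_fun_def dest: spec[of _ c])
  qed
  have R_mono: "loop_in (R j) z" if "loop_in (R i) z" "j \<le> i" for i j z
    using that by (auto simp: loop_in_iff R_def)
  have at_Suc: "?y c \<le> z c" if z: "loop_in (R (Suc k)) z" for z c
  proof -
    have zk: "loop_in (R k) z" using R_mono[OF z] by simp
    define u where "u = (\<lambda>c. min (z c) (?y c))"
    have lu: "loop u" unfolding u_def by (rule loop_min[OF loop_inD(1)[OF z] lP])
    have uc: "(c, u c) \<in> free M \<or> u c = ?s c \<or> u c = ?y c" for c
      using cases[OF zk, of c] by (auto simp: u_def min_def)
    have mu: "?m c < u c" for c
      using at_k[OF zk, of c] RD(2)[OF z, of k c] fk m_high[of "Suc k" c] by (auto simp: u_def min_def)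
    \<comment> \<open>Lifting \<open>u\<close> to at least \<open>?s\<close> makes the dichotomy
      applicable: \<open>u\<close> then either never rises above \<open>?s\<close> or never touches
      it.\<close>
    define v where "v = (\<lambda>c. max (u c) (?s c))"
    have lv: "loop v" unfolding v_def by (rule loop_max[OF lu ls])
    have "v = ?s \<or> below ?s v"
    proof (rule above_rsh_dichotomy[where X = "free M \<union> graph ?y", OF lP lv])
      show "?s \<le> v" by (simp add: v_def le_fun_def)
      show "(c, v c) \<in> free M \<union> graph ?y" if "v c \<noteq> ?s c" for c
        using that uc[of c] by (auto simp: v_def max_def split: if_splits)
      show "(c, ?p c) \<notin> free M \<union> graph ?y" for c
        using fore_eq_iff[OF adm, of k c "Suc k"] by (simp add: free_not_fore)
      show "?p \<le> w" if "loop_in (free M \<union> graph ?y \<union> graph ?p) w" for w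
      proof (rule fore_le[OF adm], rule loop_in_mono[OF that])
        show "free M \<union> graph ?y \<union> graph ?p \<subseteq> rest M k"
          by (auto simp: mem_rest free_def fore_mem[OF adm] fore_eq_iff[OF adm])
      qed
    qed
    then show ?thesis
    proof
      \<comment> \<open>Here \<open>u\<close> never exceeds \<open>?s\<close>; since
        \<open>new_fore\<close> is strictly below \<open>u\<close>, it misses \<open>?s\<close>
        everywhere and would be a free loop.\<close>
      assume "v = ?s"
      then have "u c \<le> ?s c" for c unfolding v_def by (metis max.cobounded1)
      then have "?m c \<noteq> ?s c" for c using mu[of c] by (metis not_less)
      then have "loop_in (free M) ?m" using new_fore_cases lm by (auto simp: loop_in_iff)
      then show ?thesis using no_loop_in_free[OF adm] by simp
    next
      assume "below ?s v"
      then have "?s c < u c" for c by (auto simp: below_def v_def max_def dest: spec[of _ c] split: if_splits)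
      then have "(c, u c) \<in> free M \<or> u c = ?y c" for c using uc[of c] by (metis order_less_irrefl)
      then have "(c, u c) \<in> rest M (Suc k)" for c
        using loop_inD(2)[OF loop_in_rest_fore[OF adm, of "Suc k"], of c] by (metis free_in_rest)
      then have "loop_in (rest M (Suc k)) u" using lu by (simp add: loop_in_iff)
      from fore_le'[OF adm this, of c] show ?thesis by (simp add: u_def)
    qed
  qed
  have high: "?P i c \<le> z c" if i: "Suc k < i" and z: "loop_in (R i) z" for i z c
  proof -
    have "(c, z c) \<in> rest M i" for c
    proof -
      have "?y c \<le> z c" using at_Suc R_mono[OF z] i by simp
      moreover have "z c \<noteq> ?y c" using RD(2)[OF z i] fn[of "Suc k"] by simp
      ultimately have gt: "?y c < z c" by simp
      then have s: "z c \<noteq> ?s c" using rsh_fore_less[of "Suc k" c] by simp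
      have "z c \<noteq> ?P j c" if "j < i" for j
        using RD(2)[OF z that, of c] fn[of j] fore_less[OF adm, of k "Suc k" c] gt by (cases "j = k") auto
      then show ?thesis using RD(1)[OF z, of c] s by (simp add: mem_rest mem_shift)
    qed
    then have "loop_in (rest M i) z" using loop_inD(1)[OF z] by (simp add: loop_in_iff)
    then show ?thesis by (rule fore_le'[OF adm])
  qed
  have "fore (shift k M) = f"
  proof (rule fore_eqI, fold R_def)
    fix i
    show "loop_in (R i) (f i)"
    proof (cases "i = k")
      case True
      then show ?thesis
        using new_fore_not_fore by (auto simp: fk fn intro!: RI lm m_mem)
    next
      case False
      then show ?thesis
      proof (simp add: fn, intro RI lP)
        show "(c, ?P i c) \<in> shift k M" for c using False mem_shift_cases by blast
        show "?P i c \<noteq> f j c" if "j < i" for c j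
          using that m_high[of i c] fore_eq_iff[OF adm, of i c j] by (cases "j = k") (auto simp: fk fn)
      qed
    qed
    show "f i \<le> z" if z: "loop_in (R i) z" for z
    proof (rule le_funI)
      fix c
      consider "i < k" | "i = k" | "i = Suc k" | "Suc k < i" by linarith
      then show "f i c \<le> z c"
        using low at_k at_Suc high z by cases (auto simp: fk fn)
    qed
  qed
  then show ?thesis by (simp add: f_def)
qed

lemma free_shift: "free (shift k M) = (free M \<union> graph (rsh (fore M k))) - graph new_fore"
proof -
  have "rsh (fore M k) c \<noteq> fore M i c" if "i \<noteq> k" for c i
    using less_rsh_fore[of i c] rsh_fore_less[of i c] that by (metis linorder_neqE_nat order_less_irrefl)
  then have "(c, y) \<in> free (shift k M) \<longleftrightarrow> (c, y) \<in> (free M \<union> graph (rsh (fore M k))) - graph new_fore" for c y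
    unfolding free_def[of "shift k M"] fore_shift using mem_shift_cases free_not_fore
    by (auto split: if_splits)
  then show ?thesis by (intro set_eqI) (metis surj_pair)
qed

text \<open>The aft loop may use exactly the free beads of \<open>M\<close> and the shifted ones.
  The larger of a vessel loop and \<open>rsh (fore M k)\<close>, if it differs from the latter, is
  strictly above it by the dichotomy and would be a free loop. Thus the shifted set remembers which
  loop was shifted.\<close>

lemma aft_shift: "aft (shift k M) k = rsh (fore M k)"
proof -
  let ?s = "rsh (fore M k)"
  have un: "free (shift k M) \<union> graph new_fore = free M \<union> graph ?s"
    using new_fore_cases unfolding free_shift by (auto dest: spec) metis
  have V: "vessel_loops (shift k M) k =
      {z. loop_in (free M \<union> graph ?s) z \<and> below z (fore M (Suc k))}"
    by (simp add: vessel_loops_def un fore_shift)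
  have ls: "loop ?s" by (rule loop_rsh[OF loop_fore[OF adm]])
  show ?thesis
  proof (rule aft_eqI)
    show "?s \<in> vessel_loops (shift k M) k"
      using ls rsh_fore_less by (auto simp: V loop_in_iff below_def)
    fix z assume "z \<in> vessel_loops (shift k M) k"
    then have z: "loop_in (free M \<union> graph ?s) z" by (simp add: V)
    define v where "v = (\<lambda>c. max (z c) (?s c))"
    have lv: "loop v" unfolding v_def by (rule loop_max[OF loop_inD(1)[OF z] ls])
    have zc: "(c, z c) \<in> free M \<or> z c = ?s c" for c using loop_inD(2)[OF z, of c] by simp
    have "v = ?s \<or> below ?s v"
    proof (rule above_rsh_dichotomy[where X = "free M", OF loop_fore[OF adm] lv])
      show "?s \<le> v" by (simp add: v_def le_fun_def)
      show "(c, v c) \<in> free M" if "v c \<noteq> ?s c" for c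
        using that zc[of c] by (auto simp: v_def max_def split: if_splits)
      show "fore M k \<le> w" if "loop_in (free M \<union> graph (fore M k)) w" for w
      proof (rule fore_le[OF adm], rule loop_in_mono[OF that])
        show "free M \<union> graph (fore M k) \<subseteq> rest M k"
          by (auto simp: mem_rest free_def fore_mem[OF adm] fore_eq_iff[OF adm])
      qed
    qed (rule free_not_fore)
    moreover have "\<not> below ?s v"
    proof
      assume "below ?s v"
      then have "(c, v c) \<in> free M" for c
        using zc[of c] by (auto simp: below_def v_def max_def dest: spec[of _ c] split: if_splits)
      then have "loop_in (free M) v" using lv by (simp add: loop_in_iff)
      then show False using no_loop_in_free[OF adm] by simp
    qed
    ultimately have "v = ?s" by blast
    then show "z \<le> ?s" unfolding v_def le_fun_def by (metis max.cobounded1)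
  qed
qed

end

subsection \<open>Shifting an aft period to the left\<close>

definition unshift :: "nat \<Rightarrow> (int \<times> int) set \<Rightarrow> (int \<times> int) set" where
  "unshift k M = (M - graph (aft M k)) \<union> graph (lsh (aft M k))"

context
  fixes M :: "(int \<times> int) set" and k :: nat
  assumes adm: "admissible M" and lower: "below (lsh (aft M k)) (fore M (Suc k))"
begin

lemma mem_unshift:
  "(c, y) \<in> unshift k M \<longleftrightarrow> y = lsh (aft M k) c \<or> (c, y) \<in> M \<and> y \<noteq> aft M k c"
  by (auto simp: unshift_def)

text \<open>Otherwise raising \<open>aft M k\<close> onto the beads of its left shift would give a
  larger vessel loop; \<open>lower\<close> keeps that loop under
  \<open>fore M (Suc k)\<close>.\<close>

lemma lsh_aft_not_mem:
  assumes "(c, lsh (aft M k) c) \<in> M" shows "lsh (aft M k) c = aft M k c"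
proof -
  let ?q = "aft M k" and ?y = "fore M (Suc k)"
  have lq: "loop ?q" by (rule loop_aft[OF adm])
  define v where "v = (\<lambda>c. if (c, lsh ?q c) \<in> M then lsh ?q c else ?q c)"
  have "loop v" unfolding loop_def
  proof (intro conjI allI)
    fix c
    show "v c \<le> v (c + 1)"
      using lsh_ge[OF lq, of "c + 1"] lsh_ge[OF lq, of c] by (auto simp: v_def lsh_def)
    show "v (c + int e) = v c + int l"
      using loop_period[OF lq, of c] loop_period[OF loop_lsh[OF lq], of c] periodic_M[OF adm]
      by (auto simp: v_def)
  qed
  moreover have "(c, v c) \<in> free M \<union> graph (fore M k) \<and> v c < ?y c" for c
  proof (cases "(c, lsh ?q c) \<in> M")
    case True
    have qy: "lsh ?q c < ?y c" using lower by (simp add: below_def)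
    have "fore M k c \<le> ?q c" using fore_le_aft[OF adm] by (simp add: le_fun_def)
    then have pq: "fore M k c \<le> lsh ?q c" using lsh_ge[OF lq, of c] by simp
    have "(c, lsh ?q c) \<in> free M \<or> lsh ?q c = fore M k c"
    proof (rule disjCI)
      assume ne: "lsh ?q c \<noteq> fore M k c"
      have "lsh ?q c \<noteq> fore M i c" for i
      proof
        assume i: "lsh ?q c = fore M i c"
        then have "k < i" using pq ne fore_less_iff[OF adm, of k c i] by simp
        moreover have "i < Suc k" using qy i fore_less_iff[OF adm, of i c "Suc k"] by simp
        ultimately show False by simp
      qed
      then show "(c, lsh ?q c) \<in> free M" using True by (simp add: free_def)
    qed
    then show ?thesis using True qy by (auto simp: v_def)
  next
    case False
    then show ?thesis using aft_mem[OF adm, of c k] below_aft[OF adm, of k]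
      by (auto simp: v_def below_def)
  qed
  ultimately have "v \<in> vessel_loops M k"
    by (auto simp: vessel_loops_def loop_in_iff below_def)
  then have "v c \<le> ?q c" using le_aft[OF adm] by (simp add: le_fun_def)
  then show ?thesis using assms lsh_ge[OF lq, of c] by (simp add: v_def)
qed

text \<open>Dual to \<open>fore_shift\<close>, with the maximality of the aft loop as the main
  resource. Now index \<open>k\<close> is the delicate one: competitors below
  \<open>lsh (aft M k)\<close> have to be excluded.\<close>

lemma fore_unshift: "fore (unshift k M) = (fore M)(k := lsh (aft M k))"
proof -
  let ?P = "fore M" and ?q = "aft M k" and ?t = "lsh (aft M k)" and ?m = "fore M k"
  let ?y = "fore M (Suc k)" and ?N = "unshift k M"
  define f where "f = ?P(k := ?t)"
  define R where "R i = {(c, y). (c, y) \<in> ?N \<and> (\<forall>j<i. y \<noteq> f j c)}" for i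
  have fk: "f k = ?t" and fn: "\<And>i. i \<noteq> k \<Longrightarrow> f i = ?P i" by (simp_all add: f_def)
  have lP: "loop (?P i)" for i by (rule loop_fore[OF adm])
  have lq: "loop ?q" by (rule loop_aft[OF adm])
  have lt: "loop ?t" by (rule loop_lsh[OF lq])
  have mq: "?m c \<le> ?q c" for c using fore_le_aft[OF adm] by (simp add: le_fun_def)
  have qt: "?q c \<le> ?t c" for c by (rule lsh_ge[OF lq])
  have ty: "?t c < ?y c" for c using lower by (simp add: below_def)
  have RD: "(c, z c) \<in> ?N" "j < i \<Longrightarrow> z c \<noteq> f j c" if "loop_in (R i) z" for c i j z
    using loop_inD(2)[OF that, of c] by (auto simp: R_def)
  have RI: "loop_in (R i) z"
    if "loop z" "\<And>c. (c, z c) \<in> ?N" "\<And>c j. j < i \<Longrightarrow> z c \<noteq> f j c" for z i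
    using that by (simp add: R_def loop_in_iff)
  have R_mono: "loop_in (R j) z" if "loop_in (R i) z" "j \<le> i" for i j z
    using that by (auto simp: loop_in_iff R_def)
  have low_t: "?P j c < ?t c" if "j < k" for j c
    using fore_less[OF adm that, of c] mq[of c] qt[of c] by simp
  have high_t: "?t c < ?P j c" if "k < j" for j c
    using ty[of c] fore_le_iff[OF adm, of "Suc k" c j] that by simp
  have low: "?P i c \<le> z c" if "i < k" "loop_in (R i) z" for i z c
  proof -
    define u where "u = (\<lambda>c. min (z c) (?P i c))"
    have "(c, u c) \<in> rest M i" for c
    proof (cases "z c < ?P i c")
      case True
      then have "z c \<noteq> ?t c" using low_t[OF that(1), of c] by simp
      then have "(c, z c) \<in> M" using RD(1)[OF that(2), of c] by (simp add: mem_unshift)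
      moreover have "z c \<noteq> ?P j c" if "j < i" for j
        using RD(2)[OF \<open>loop_in (R i) z\<close> that] fn[of j] that \<open>i < k\<close> by auto
      ultimately show ?thesis using True by (simp add: mem_rest u_def)
    next
      case False
      then show ?thesis using loop_inD(2)[OF loop_in_rest_fore[OF adm, of i], of c] by (simp add: u_def)
    qed
    then have "loop_in (rest M i) u"
      using loop_min[OF loop_inD(1)[OF that(2)] lP[of i]] by (simp add: loop_in_iff u_def)
    from fore_le'[OF adm this, of c] show ?thesis by (simp add: u_def)
  qed
  have cases: "z c = ?t c \<or> z c \<noteq> ?q c \<and> ((c, z c) \<in> free M \<or> z c = ?m c)"
    if "loop_in (R k) z" "z c < ?y c" for z c
  proof -
    have "z c \<noteq> ?P i c" if "i \<noteq> k" for i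
    proof (cases "i < k")
      case True
      then show ?thesis using RD(2)[OF \<open>loop_in (R k) z\<close> True] fn[OF that] by simp
    next
      case False
      then have "?y c \<le> ?P i c" using that fore_le_iff[OF adm, of "Suc k" c i] by simp
      then show ?thesis using \<open>z c < ?y c\<close> by simp
    qed
    then show ?thesis
      using RD(1)[OF that(1), of c] free_or_fore[OF adm, of c "z c"] unfolding mem_unshift by metis
  qed
  have at_k: "?t c \<le> z c" if z: "loop_in (R k) z" for z c
  proof -
    define u where "u = (\<lambda>c. min (z c) (?t c))"
    have lu: "loop u" unfolding u_def by (rule loop_min[OF loop_inD(1)[OF z] lt])
    have uc: "u c = ?t c \<or> u c \<noteq> ?q c \<and> ((c, u c) \<in> free M \<or> u c = ?m c)" for c
      using cases[OF z, of c] ty[of c] by (auto simp: u_def min_def)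
    have ut: "u c \<le> ?t c" for c by (simp add: u_def)
    have ne: "u c < ?q c" if "u c \<noteq> ?t c" for c
    proof -
      \<comment> \<open>If \<open>u\<close> left \<open>?t\<close> while above \<open>?q\<close>,
        following \<open>u\<close> there would enlarge the aft loop. Monotonicity survives because
        \<open>u c <= ?t c = ?q (c + 1)\<close>.\<close>
      define v where "v = (\<lambda>c. if u c \<noteq> ?t c \<and> ?q c < u c then u c else ?q c)"
      have "loop v" unfolding loop_def
      proof (intro conjI allI)
        fix c
        have "u c \<le> ?q (c + 1)" using ut[of c] by (simp add: lsh_def)
        then show "v c \<le> v (c + 1)"
          using loop_step[OF lq, of c] loop_step[OF lu, of c] by (auto simp: v_def)
        show "v (c + int e) = v c + int l"
          using loop_period[OF lq, of c] loop_period[OF lu, of c] loop_period[OF lt, of c]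
          by (auto simp: v_def)
      qed
      moreover have "(c, v c) \<in> free M \<union> graph ?m \<and> v c < ?y c" for c
        using uc[of c] aft_mem[OF adm, of c k] below_aft[OF adm, of k] ut[of c] ty[of c]
        by (auto simp: v_def below_def)
      ultimately have "v \<in> vessel_loops M k"
        by (auto simp: vessel_loops_def loop_in_iff below_def)
      then have "v c \<le> ?q c" using le_aft[OF adm] by (simp add: le_fun_def)
      then show ?thesis using that uc[of c] by (auto simp: v_def split: if_splits)
    qed
    have "u c = ?t c" for c
    proof (rule ccontr)
      assume neq: "u c \<noteq> ?t c"
      \<comment> \<open>One contact with \<open>?t\<close> spreads everywhere:
        \<open>u c = ?t c\<close> gives \<open>u (c + 1) >= ?q (c + 1)\<close>, which by
        \<open>ne\<close> is impossible off \<open>?t\<close>.\<close>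
      have "u d \<noteq> ?t d" for d
      proof
        assume d: "u d = ?t d"
        have "u c = ?t c"
        proof (rule propagate[of "\<lambda>c. u c = ?t c", OF _ _ d])
          show "u (c + int e) = ?t (c + int e) \<longleftrightarrow> u c = ?t c" for c
            using loop_period[OF lu, of c] loop_period[OF lt, of c] by auto
          show "u (c + 1) = ?t (c + 1)" if "u c = ?t c" for c
            using that ne[of "c + 1"] loop_step[OF lu, of c] by (force simp: lsh_def)
        qed
        then show False using neq by simp
      qed
      then have lt_q: "u c < ?q c" "(c, u c) \<in> free M \<or> u c = ?m c" for c
        using ne uc by blast+
      have "(c, u c) \<in> rest M k" for c
        using lt_q(2)[of c] loop_inD(2)[OF loop_in_rest_fore[OF adm, of k], of c]
          free_in_rest[of c "u c" M k] by auto
      then have "loop_in (rest M k) u" using lu by (simp add: loop_in_iff)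
      \<comment> \<open>The aft loop is now strictly above \<open>?m\<close> in every column, so all
        its beads are free.\<close>
      then have "?m c < ?q c" for c using fore_le'[OF adm, of k u c] lt_q(1)[of c] by simp
      then have "loop_in (free M) ?q" 
        using aft_mem[OF adm, of _ k] lq by (auto simp: loop_in_iff) (metis order_less_irrefl)
      then show False using no_loop_in_free[OF adm] by simp
    qed
    from this[of c] show ?thesis by (simp add: u_def min_def split: if_splits)
  qed
  have at_Suc: "?y c \<le> z c" if z: "loop_in (R (Suc k)) z" for z c
  proof -
    have zk: "loop_in (R k) z" using R_mono[OF z] by simp
    define u where "u = (\<lambda>c. min (z c) (?y c))"
    have lu: "loop u" unfolding u_def by (rule loop_min[OF loop_inD(1)[OF z] lP])
    have "(c, u c) \<in> rest M (Suc k)" for c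
    proof (cases "z c < ?y c")
      case True
      have "?t c < z c" using at_k[OF zk, of c] RD(2)[OF z, of k c] fk by simp
      then have "z c \<noteq> ?t c" "z c \<noteq> ?m c" using mq[of c] qt[of c] by simp_all
      then have "(c, z c) \<in> free M" using cases[OF zk True] by blast
      then show ?thesis using True by (simp add: u_def free_in_rest)
    next
      case False
      then show ?thesis
        using loop_inD(2)[OF loop_in_rest_fore[OF adm, of "Suc k"], of c] by (simp add: u_def)
    qed
    then have "loop_in (rest M (Suc k)) u" using lu by (simp add: loop_in_iff)
    from fore_le'[OF adm this, of c] show ?thesis by (simp add: u_def)
  qed
  have high: "?P i c \<le> z c" if i: "Suc k < i" and z: "loop_in (R i) z" for i z c
  proof -
    have "(c, z c) \<in> rest M i" for c
    proof -
      have gt: "?t c < z c" "?m c < z c"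
        using at_Suc[OF R_mono[OF z], of c] i ty[of c] mq[of c] qt[of c] by linarith+
      have "z c \<noteq> ?P j c" if "j < i" for j
        using RD(2)[OF z that, of c] fn[of j] gt by (cases "j = k") auto
      then show ?thesis using RD(1)[OF z, of c] gt by (simp add: mem_rest mem_unshift)
    qed
    then have "loop_in (rest M i) z" using loop_inD(1)[OF z] by (simp add: loop_in_iff)
    then show ?thesis by (rule fore_le'[OF adm])
  qed
  have "fore ?N = f"
  proof (rule fore_eqI, fold R_def)
    fix i
    show "loop_in (R i) (f i)"
    proof (cases "i = k")
      case True
      have "?t c \<noteq> ?P j c" if "j < k" for j c using low_t[OF that, of c] by simp
      then show ?thesis using True
        by (auto simp: fk fn mem_unshift intro!: RI lt)
    next
      case False
      then show ?thesis
      proof (simp add: fn, intro RI lP)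
        show "(c, ?P i c) \<in> ?N" for c
          using False aft_mem[OF adm, of c k] fore_mem[OF adm, of c i] fore_eq_iff[OF adm, of i c k]
            free_not_fore[of c M i] by (auto simp: mem_unshift)
        show "?P i c \<noteq> f j c" if "j < i" for c j
          using that high_t[of i c] fore_eq_iff[OF adm, of i c j] by (cases "j = k") (auto simp: fk fn)
      qed
    qed
    show "f i \<le> z" if z: "loop_in (R i) z" for z
    proof (rule le_funI)
      fix c
      consider "i < k" | "i = k" | "i = Suc k" | "Suc k < i" by linarith
      then show "f i c \<le> z c"
        using low at_k at_Suc high z by cases (auto simp: fk fn)
    qed
  qed
  then show ?thesis by (simp add: f_def)
qed

lemma shiftable_unshift: "shiftable (unshift k M) k"
  using le_below[OF below_fore[OF adm] fore_le_aft[OF adm]]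
  by (simp add: shiftable_def fore_unshift)

lemma shift_unshift: "shift k (unshift k M) = M"
proof -
  have "(c, aft M k c) \<in> M" for c
    using aft_mem[OF adm, of c k] fore_mem[OF adm, of c k] by (auto simp: free_def)
  then have "(c, y) \<in> shift k (unshift k M) \<longleftrightarrow> (c, y) \<in> M" for c y
    using lsh_aft_not_mem[of c] by (auto simp: mem_shift mem_unshift fore_unshift)
  then show ?thesis by (intro set_eqI) (metis surj_pair)
qed

end

section \<open>Injectivity, domains, commutation and termination of the shifts\<close>

lemma shift_inject:
  assumes "admissible M" "admissible N" "shiftable M k" "shiftable N k" "shift k M = shift k N"
  shows "M = N"
proof -
  have "fore M k = fore N k"
    using aft_shift assms by (metis rsh_inject)
  then show ?thesis
    using shift_inverse assms by metis
qed

lemma shiftable_shift_Suc: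
  assumes "admissible M" "shiftable M k"
  shows "shiftable (shift k M) (Suc k)"
proof -
  have "new_fore M k c < rsh (fore M (Suc k)) c" for c
    using new_fore_le_rsh[OF assms, of c] fore_less[OF assms(1), of k "Suc k" "c - 1"]
    by (simp add: rsh_def)
  then show ?thesis
    by (simp add: shiftable_Suc[OF admissible_shift[OF assms(1)]] fore_shift[OF assms] below_def)
qed

text \<open>For positive \<open>j\<close>, shiftability depends only on the fore loops
  \<open>j\<close> and \<open>j - 1\<close>, and neither of them changes.\<close>

lemma shiftable_shift_iff:
  assumes "admissible M" "shiftable M k" "j \<noteq> k" "j \<noteq> Suc k"
  shows "shiftable (shift k M) j \<longleftrightarrow> shiftable M j"
  using assms(3,4)
  by (cases j) (simp_all add: shiftable_Suc admissible_shift fore_shift[OF assms(1,2)] assms)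

text \<open>Each shift leaves the fore loop of the other alone, and each shifted loop misses the
  fore loop of the other; so both orders remove and insert the same beads.\<close>

lemma shift_commute:
  assumes "admissible M" "shiftable M k" "shiftable M j" "j \<noteq> k"
  shows "shift j (shift k M) = shift k (shift j M)"
proof -
  have "rsh (fore M k) c \<noteq> fore M j c" if "j \<noteq> k" "shiftable M k" for j k c
    using less_rsh_fore[OF assms(1) that(2), of j c] rsh_fore_less[OF assms(1) that(2), of j c] that(1)
    by (metis linorder_neqE_nat order_less_irrefl)
  from this[of j k] this[of k j]
  have "(c, y) \<in> shift j (shift k M) \<longleftrightarrow> (c, y) \<in> shift k (shift j M)" for c y
    using assms by (auto simp: mem_shift fore_shift[OF assms(1,2)] fore_shift[OF assms(1,3)])
  then show ?thesis by (intro set_eqI) (metis surj_pair)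
qed

text \<open>\<open>fore M k\<close> stays in place while its successor moves at least one column to
  the right per step, hence falls by at least \<open>l\<close> in \<open>e\<close> steps and would
  have to cross it. The index is a successor because the first fore loop can be shifted
  forever.\<close>

lemma finitely_many_shifts:
  assumes "admissible M"
  shows "\<exists>n. \<not> shiftable ((shift (Suc k) ^^ n) M) (Suc k)"
proof (rule ccontr)
  assume "\<not> ?thesis"
  then have all: "shiftable ((shift (Suc k) ^^ n) M) (Suc k)" for n by blast
  have inv: "admissible ((shift (Suc k) ^^ n) M) \<and> fore ((shift (Suc k) ^^ n) M) k = fore M k \<and>
      (\<forall>c. fore ((shift (Suc k) ^^ n) M) (Suc k) c \<le> fore M (Suc k) (c - int n))" for n
  proof (induction n)
    case (Suc n)
    let ?N = "(shift (Suc k) ^^ n) M"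
    have "fore (shift (Suc k) ?N) (Suc k) c \<le> fore M (Suc k) (c - int (Suc n))" for c
      using new_fore_le_rsh[of ?N "Suc k" c] Suc all[of n] 
        Suc[THEN conjunct2, THEN conjunct2, rule_format, of "c - 1"]
      by (simp add: fore_shift rsh_def algebra_simps)
    then show ?case using Suc all[of n] by (simp add: admissible_shift fore_shift)
  qed (use assms in simp)
  have "fore M k 0 < fore M (Suc k) 0 - int l * int t" for t
  proof -
    have "fore M k 0 < fore M (Suc k) (- int (e * t))"
      using inv[of "e * t"] fore_less[of "(shift (Suc k) ^^ (e * t)) M" k "Suc k" 0]
      by (smt (verit, best) lessI)
    then show ?thesis
      using loop_period_int[OF loop_fore[OF assms, of "Suc k"], of 0 "- int t"] by simp
  qed
  from this[of "nat (fore M (Suc k) 0 - fore M k 0)"]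
  have "int l * (fore M (Suc k) 0 - fore M k 0) < fore M (Suc k) 0 - fore M k 0"
    using fore_less[OF assms, of k "Suc k" 0] by (simp add: less_diff_eq add.commute)
  then show False
    using l_pos fore_less[OF assms lessI, of k 0]
      mult_right_mono[of 1 "int l" "fore M (Suc k) 0 - fore M k 0"] by simp
qed

text \<open>The earlier fore loops of the shifted set lie below its aft loop, so they do not touch
  \<open>rsh (fore M k)\<close> and use only old beads. By induction they are the earlier fore loops
  of \<open>M\<close>, which therefore lie below the shifted loop.\<close>

lemma shiftable_if_aft_shift:
  assumes "admissible M" "aft (shift k M) k = rsh (fore M k)"
  shows "shiftable M k"
proof -
  let ?N = "shift k M" and ?p = "fore M k" and ?s = "rsh (fore M k)"
  have admN: "admissible ?N" by (rule admissible_shift[OF assms(1)])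
  have sp: "?s c \<le> ?p c" for c by (rule rsh_le[OF loop_fore[OF assms(1)]])
  have low: "fore ?N i c < ?s c" if "i < k" for i c
    using fore_less[OF admN that, of c] fore_le_aft[OF admN, of k] assms(2)
    by (metis le_fun_def order_less_le_trans)
  have "fore M i = fore ?N i" if "i < k" for i
    using that
  proof (induction i rule: less_induct)
    case (less i)
    have eq: "fore M j = fore ?N j" if "j < i" for j using less that by simp
    have "(c, fore ?N i c) \<in> rest M i" for c
      using loop_inD(2)[OF loop_in_rest_fore[OF admN, of i], of c] low[OF less.prems, of c]
      by (auto simp: mem_rest mem_shift eq)
    then have le: "fore M i \<le> fore ?N i"
      by (intro fore_le[OF assms(1)]) (simp add: loop_in_iff loop_fore[OF admN])
    have "(c, fore M i c) \<in> rest ?N i" for c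
    proof -
      have "fore M i c < ?p c" using fore_less[OF assms(1) less.prems] by simp
      then show ?thesis
        using loop_inD(2)[OF loop_in_rest_fore[OF assms(1), of i], of c]
        by (auto simp: mem_rest mem_shift eq)
    qed
    then have "fore ?N i \<le> fore M i"
      by (intro fore_le[OF admN]) (simp add: loop_in_iff loop_fore[OF assms(1)])
    then show ?case using le by simp
  qed
  then show ?thesis using low by (simp add: shiftable_def below_def)
qed

end

section \<open>Crystals generated by partially commuting shifts\<close>

lemma part_0 [simp]: "part \<sigma> 0 = 0"
  by (simp add: part_def)

lemma part_beyond: "length \<sigma> < k \<Longrightarrow> part \<sigma> k = 0"
  by (simp add: part_def)

lemma part_mono:
  assumes "partition \<sigma>" "1 \<le> i" "i \<le> j" shows "part \<sigma> j \<le> part \<sigma> i"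
proof (cases "j \<le> length \<sigma> \<and> i < j")
  case True
  then have "i - 1 < j - 1" "j - 1 < length \<sigma>" using assms(2) by auto
  then have "\<sigma> ! (j - 1) \<le> \<sigma> ! (i - 1)"
    using assms(1) by (simp add: partition_def sorted_wrt_iff_nth_less)
  then show ?thesis
    using assms(2) True by (simp add: part_def)
next
  case False
  then show ?thesis using assms by (cases "i = j") (auto simp: part_def)
qed

lemma part_dec: "partition \<sigma> \<Longrightarrow> \<forall>k\<ge>1. part \<sigma> (Suc k) \<le> part \<sigma> k"
  using part_mono by simp

lemma part_pos_iff:
  assumes "partition \<sigma>" shows "0 < part \<sigma> k \<longleftrightarrow> 1 \<le> k \<and> k \<le> length \<sigma>"
proof -
  have "\<sigma> ! (k - 1) \<noteq> 0" if "1 \<le> k" "k \<le> length \<sigma>"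
  proof -
    have "\<sigma> ! (k - 1) \<in> set \<sigma>" using that by (intro nth_mem) simp
    then show ?thesis using assms by (metis partition_def)
  qed
  then show ?thesis by (simp add: part_def)
qed

lemma partition_eqI:
  assumes "partition \<sigma>" "partition \<tau>" "\<And>k. 1 \<le> k \<Longrightarrow> part \<sigma> k = part \<tau> k"
  shows "\<sigma> = \<tau>"
proof (rule nth_equalityI)
  have "(1 \<le> k \<and> k \<le> length \<sigma>) \<longleftrightarrow> (1 \<le> k \<and> k \<le> length \<tau>)" for k
    using part_pos_iff[OF assms(1), of k] part_pos_iff[OF assms(2), of k] assms(3)[of k] by auto
  from this[of "length \<sigma>"] this[of "length \<tau>"] show len: "length \<sigma> = length \<tau>"
    by (cases "length \<sigma>"; cases "length \<tau>") auto
  show "\<sigma> ! i = \<tau> ! i" if "i < length \<sigma>" for i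
    using assms(3)[of "Suc i"] that len by (simp add: part_def)
qed

lemma partition_of_fun:
  fixes f :: "nat \<Rightarrow> nat"
  assumes dec: "\<And>k. 1 \<le> k \<Longrightarrow> f (Suc k) \<le> f k" and fin: "\<And>k. n < k \<Longrightarrow> f k = 0"
  obtains \<sigma> where "partition \<sigma>" "\<And>k. 1 \<le> k \<Longrightarrow> part \<sigma> k = f k"
proof -
  \<comment> \<open>Taking the least bound strips the trailing zeros, which a list representing a
    partition must not contain.\<close>
  define N where "N = (LEAST N. \<forall>k>N. f k = 0)"
  have N: "\<And>k. N < k \<Longrightarrow> f k = 0"
    unfolding N_def using fin LeastI[of "\<lambda>N. \<forall>k>N. f k = 0" n] by blast
  have mono: "f j \<le> f i" if "1 \<le> i" "i \<le> j" for i j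
    using that(2)
  proof (induction j rule: dec_induct)
    case (step j)
    then show ?case using dec[of j] that(1) by simp
  qed simp
  have pos: "f k \<noteq> 0" if "1 \<le> k" "k \<le> N" for k
  proof
    assume "f k = 0"
    have "f j = 0" if "k - 1 < j" for j
      using mono[of k j] \<open>f k = 0\<close> \<open>1 \<le> k\<close> that by simp
    then have "\<forall>j>k - 1. f j = 0" by blast
    then have "N \<le> k - 1" unfolding N_def by (rule Least_le)
    then show False using that by simp
  qed
  let ?s = "map f [1..<Suc N]"
  have "partition ?s"
    unfolding partition_def sorted_wrt_iff_nth_less
  proof (intro conjI allI impI)
    show "?s ! j \<le> ?s ! i" if "i < j" "j < length ?s" for i j
      using that mono[of "Suc i" "Suc j"] by (simp del: upt_Suc)
    show "0 \<notin> set ?s" using pos by (force simp del: upt_Suc)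
  qed
  moreover have "part ?s k = f k" if "1 \<le> k" for k
    using that N[of k] by (auto simp: part_def simp del: upt_Suc)
  ultimately show ?thesis using that by blast
qed

text \<open>\<open>S k\<close> is total, but its laws are required only on \<open>dom k\<close>. The
  termination axiom starts at index 2, because \<open>dom 1\<close> always holds.\<close>

locale crystal =
  fixes valid :: "'a \<Rightarrow> bool" and S :: "nat \<Rightarrow> 'a \<Rightarrow> 'a" and dom :: "nat \<Rightarrow> 'a \<Rightarrow> bool"
  assumes valid_S: "valid X \<Longrightarrow> 1 \<le> k \<Longrightarrow> valid (S k X)"
    and dom_1: "valid X \<Longrightarrow> dom 1 X"
    and S_commute: "valid X \<Longrightarrow> 1 \<le> j \<Longrightarrow> 1 \<le> k \<Longrightarrow> j \<noteq> k \<Longrightarrow> dom j X \<Longrightarrow> dom k X \<Longrightarrow>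
      S j (S k X) = S k (S j X)"
    and dom_S_iff: "valid X \<Longrightarrow> 1 \<le> j \<Longrightarrow> 1 \<le> k \<Longrightarrow> dom k X \<Longrightarrow> j \<noteq> k \<Longrightarrow> j \<noteq> Suc k \<Longrightarrow>
      dom j (S k X) \<longleftrightarrow> dom j X"
    and dom_S_Suc: "valid X \<Longrightarrow> 1 \<le> k \<Longrightarrow> dom k X \<Longrightarrow> dom (Suc k) (S k X)"
    and dom_Suc_imp: "valid X \<Longrightarrow> 1 \<le> k \<Longrightarrow> dom (Suc k) X \<Longrightarrow> \<exists>Y. valid Y \<and> dom k Y \<and> S k Y = X"
    and S_inject: "valid X \<Longrightarrow> valid Y \<Longrightarrow> 1 \<le> k \<Longrightarrow> dom k X \<Longrightarrow> dom k Y \<Longrightarrow> S k X = S k Y \<Longrightarrow> X = Y"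
    and finitely_S: "valid X \<Longrightarrow> 1 \<le> k \<Longrightarrow> \<exists>n. \<not> dom (Suc k) ((S (Suc k) ^^ n) X)"
    and eventually_not_dom: "valid X \<Longrightarrow> \<exists>K. \<forall>k\<ge>K. \<not> dom k X"
begin

text \<open>The number of unit moves separating the periods \<open>k\<close> and \<open>k + 1\<close>; it turns out to be
  the difference of the parts \<open>k\<close> and \<open>k + 1\<close> of the position.\<close>

definition gap :: "nat \<Rightarrow> 'a \<Rightarrow> nat" where
  "gap k X = (LEAST n. \<not> dom (Suc k) ((S (Suc k) ^^ n) X))"

lemma gap_0_iff:
  assumes "valid X" "1 \<le> k" shows "gap k X = 0 \<longleftrightarrow> \<not> dom (Suc k) X"
proof
  assume "gap k X = 0"
  then show "\<not> dom (Suc k) X"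
    unfolding gap_def using LeastI_ex[OF finitely_S[OF assms]] by simp
next
  assume "\<not> dom (Suc k) X"
  then show "gap k X = 0"
    unfolding gap_def by (intro Least_eq_0) simp
qed

lemma gap_S_Suc:
  assumes "valid X" "1 \<le> k" "dom (Suc k) X" shows "gap k X = Suc (gap k (S (Suc k) X))"
proof -
  obtain n where n: "\<not> dom (Suc k) ((S (Suc k) ^^ n) X)" using finitely_S assms by blast
  show ?thesis
    unfolding gap_def using assms(3) Least_Suc[of "\<lambda>n. \<not> dom (Suc k) ((S (Suc k) ^^ n) X)", OF n]
    by (simp add: funpow_Suc_right del: funpow.simps(2))
qed

lemma dom_S:
  assumes "valid X" "1 \<le> j" "1 \<le> k" "j \<noteq> k" "dom j X" "dom k X" shows "dom j (S k X)"
  using assms dom_S_iff dom_S_Suc by (cases "j = Suc k") auto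

text \<open>The heart of the counting: \<open>S k\<close> opens room for at most one more
  \<open>S (Suc k)\<close>. The element \<open>M\<close> lies in the domains of \<open>Suc k\<close>
  and \<open>Suc (Suc k)\<close>, so \<open>S k\<close> and then \<open>S (Suc k)\<close> can be
  undone. Commuting and cancelling shows that the element so reached, which is in
  \<open>dom (Suc k)\<close> by construction, is \<open>X\<close>.\<close>

lemma dom_before_S:
  assumes X: "valid X" "1 \<le> k" "dom k X" and 2: "dom (Suc k) (S (Suc k) (S k X))"
  shows "dom (Suc k) X"
proof -
  define N where "N = S k X"
  define M where "M = S (Suc k) N"
  have N: "valid N" "dom (Suc k) N" using X by (simp_all add: N_def valid_S dom_S_Suc)
  then have M: "valid M" "dom (Suc (Suc k)) M" "dom (Suc k) M"
    using 2 by (simp_all add: M_def N_def valid_S dom_S_Suc)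
  obtain M' where M': "valid M'" "dom k M'" "S k M' = M" using dom_Suc_imp M X by metis
  then have "dom (Suc (Suc k)) M'" using dom_S_iff[of M' "Suc (Suc k)" k] M X by simp
  then obtain X' where X': "valid X'" "dom (Suc k) X'" "S (Suc k) X' = M'"
    using dom_Suc_imp[of M' "Suc k"] M' by auto
  then have kX': "dom k X'" using dom_S_iff[of X' k "Suc k"] M' X by simp
  have "S (Suc k) (S k X') = M"
    using S_commute[of X' "Suc k" k] X' kX' X M' by simp
  then have "S k X' = N"
    using S_inject[of "S k X'" N "Suc k"] X' kX' X N dom_S_Suc by (simp add: M_def valid_S)
  then have "X' = X" using S_inject[of X' X k] X' kX' X by (simp add: N_def)
  then show ?thesis using X' by simp
qed

text \<open>Induction on the gap: \<open>dom_before_S\<close> is the start, and the step moves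
  \<open>S k\<close> past one \<open>S (Suc k)\<close>.\<close>

lemma gap_S_same:
  assumes "valid X" "1 \<le> k" "dom k X" shows "gap k (S k X) = Suc (gap k X)"
  using assms
proof (induction "gap k X" arbitrary: X)
  case 0
  then have "\<not> dom (Suc k) (S (Suc k) (S k X))"
    using gap_0_iff dom_before_S by metis
  then have "gap k (S (Suc k) (S k X)) = 0"
    using 0 by (simp add: gap_0_iff valid_S)
  then show ?case using gap_S_Suc[of "S k X" k] 0 dom_S_Suc by (simp add: valid_S)
next
  case (Suc n)
  then have d: "dom (Suc k) X" using gap_0_iff by (metis Zero_not_Suc)
  then have n: "n = gap k (S (Suc k) X)" using gap_S_Suc Suc by (metis Suc_inject)
  have "gap k (S k (S (Suc k) X)) = Suc n"
    using Suc(1)[OF n] Suc(3-) d dom_S[of X k "Suc k"] n by (simp add: valid_S)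
  then have "gap k (S (Suc k) (S k X)) = Suc n"
    using S_commute[of X "Suc k" k] Suc d by simp
  then show ?case using gap_S_Suc[of "S k X" k] Suc dom_S_Suc by (simp add: valid_S)
qed

lemma gap_S_other:
  assumes "valid X" "1 \<le> k" "1 \<le> j" "dom k X" "j \<noteq> k" "Suc j \<noteq> k"
  shows "gap j (S k X) = gap j X"
  using assms
proof (induction "gap j X" arbitrary: X)
  case 0
  then have "\<not> dom (Suc j) (S k X)"
    using gap_0_iff[of X j] dom_S_iff[of X "Suc j" k] by simp
  then have "gap j (S k X) = 0" using 0 by (simp add: gap_0_iff valid_S)
  then show ?case using 0 by simp
next
  case (Suc n)
  then have d: "dom (Suc j) X" using gap_0_iff by (metis Zero_not_Suc)
  then have n: "n = gap j (S (Suc j) X)" using gap_S_Suc Suc by (metis Suc_inject)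
  have "gap j (S k (S (Suc j) X)) = n"
    using Suc(1)[OF n] Suc(3-) d dom_S[of X k "Suc j"] n by (simp add: valid_S)
  then have "gap j (S (Suc j) (S k X)) = n"
    using S_commute[of X "Suc j" k] Suc d by simp
  then show ?case
    using gap_S_Suc[of "S k X" j] Suc d dom_S[of X "Suc j" k] by (simp add: valid_S)
qed

text \<open>For \<open>Suc j = k\<close> the truncated subtraction is a genuine one, since
  \<open>dom k X\<close> makes \<open>gap j X\<close> positive.\<close>

lemma gap_S:
  assumes "valid X" "1 \<le> k" "1 \<le> j" "dom k X"
  shows "gap j (S k X) = (if j = k then Suc (gap j X) else if Suc j = k then gap j X - 1 else gap j X)"
  using assms gap_S_same gap_S_other gap_S_Suc[of X j] by (auto simp: valid_S)

lemma dom_iff: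
  assumes "valid X" "1 \<le> k" shows "dom k X \<longleftrightarrow> k = 1 \<or> 0 < gap (k - 1) X"
proof (cases k)
  case (Suc j)
  then show ?thesis using gap_0_iff[of X j] dom_1[of X] assms by (cases "j = 0") auto
qed (use assms in simp)

section \<open>Blocks of shifts and the gaps they produce\<close>

definition apply_upto :: "(nat \<Rightarrow> nat) \<Rightarrow> nat \<Rightarrow> 'a \<Rightarrow> 'a" where
  "apply_upto f n X = fold (\<lambda>k. S k ^^ f k) [1..<Suc n] X"

lemma apply_upto_0 [simp]: "apply_upto f 0 X = X"
  by (simp add: apply_upto_def)

lemma apply_upto_Suc: "apply_upto f (Suc n) X = (S (Suc n) ^^ f (Suc n)) (apply_upto f n X)"
  by (simp add: apply_upto_def)

text \<open>The gap at \<open>k - 1\<close> is the room available to \<open>S k\<close>, and each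
  application uses up one unit; for \<open>k = 1\<close> the room is unlimited.\<close>

lemma S_pow:
  assumes "valid X" "1 \<le> k" "k = 1 \<or> m \<le> gap (k - 1) X"
  shows "valid ((S k ^^ m) X)" "i < m \<Longrightarrow> dom k ((S k ^^ i) X)"
    "1 \<le> j \<Longrightarrow> gap j ((S k ^^ m) X) = (if j = k then gap j X + m else if Suc j = k then gap j X - m else gap j X)"
proof -
  have *: "valid ((S k ^^ m) X) \<and> (\<forall>i<m. dom k ((S k ^^ i) X)) \<and>
    (\<forall>j\<ge>1. gap j ((S k ^^ m) X) = (if j = k then gap j X + m else if Suc j = k then gap j X - m else gap j X))"
    using assms(3)
  proof (induction m)
    case (Suc m)
    let ?Y = "(S k ^^ m) X"
    have IH: "valid ?Y" "\<forall>i<m. dom k ((S k ^^ i) X)"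
      "\<And>j. j \<ge> 1 \<Longrightarrow> gap j ?Y = (if j = k then gap j X + m else if Suc j = k then gap j X - m else gap j X)"
      using Suc by auto
    have "k = 1 \<or> 0 < gap (k - 1) ?Y"
    proof (cases "k = 1")
      case False
      then show ?thesis using Suc(2) IH(3)[of "k - 1"] assms(2) by auto
    qed simp
    then have "dom k ?Y"
      using dom_iff[OF IH(1) assms(2)] by blast
    then show ?case
      using IH assms(2) by (auto simp: valid_S gap_S less_Suc_eq)
  qed (use assms in auto)
  then show "valid ((S k ^^ m) X)" "i < m \<Longrightarrow> dom k ((S k ^^ i) X)"
    "1 \<le> j \<Longrightarrow> gap j ((S k ^^ m) X) = (if j = k then gap j X + m else if Suc j = k then gap j X - m else gap j X)"
    by auto
qed

text \<open>After \<open>n\<close> blocks the gap at \<open>n\<close> still contains all of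
  \<open>f n\<close>, because block \<open>n + 1\<close> has not yet taken its share. Weak decrease
  of \<open>f\<close> leaves enough room for that block.\<close>

lemma apply_upto:
  assumes "valid X" and dec: "\<forall>k\<ge>1. f (Suc k) \<le> f k"
  shows "valid (apply_upto f n X)"
    "1 \<le> j \<Longrightarrow> gap j (apply_upto f n X) =
      gap j X + (if j < n then f j - f (Suc j) else if j = n then f n else 0)"
proof -
  have "valid (apply_upto f n X) \<and> (\<forall>j\<ge>1. gap j (apply_upto f n X) =
      gap j X + (if j < n then f j - f (Suc j) else if j = n then f n else 0))"
  proof (induction n)
    case (Suc n)
    have c: "Suc n = 1 \<or> f (Suc n) \<le> gap (Suc n - 1) (apply_upto f n X)"
      using Suc dec[rule_format, of n] by (cases "n = 0") auto
    show ?case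
      using S_pow[OF Suc[THEN conjunct1] _ c] Suc[THEN conjunct2] dec
      by (auto simp: apply_upto_Suc)
  qed (use assms in auto)
  then show "valid (apply_upto f n X)"
    "1 \<le> j \<Longrightarrow> gap j (apply_upto f n X) =
      gap j X + (if j < n then f j - f (Suc j) else if j = n then f n else 0)"
    by auto
qed

lemma S_pow_inject:
  assumes "valid X" "valid Y" "1 \<le> k" "k = 1 \<or> m \<le> gap (k - 1) X" "k = 1 \<or> m \<le> gap (k - 1) Y"
    "(S k ^^ m) X = (S k ^^ m) Y"
  shows "X = Y"
  using assms(4-)
proof (induction m)
  case (Suc m)
  have "dom k ((S k ^^ m) X)" "dom k ((S k ^^ m) Y)" "valid ((S k ^^ m) X)" "valid ((S k ^^ m) Y)"
    using S_pow[OF assms(1,3) Suc(2)] S_pow[OF assms(2,3) Suc(3)] 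
      S_pow(1)[OF assms(1,3), of m] S_pow(1)[OF assms(2,3), of m] Suc(2,3) by auto
  then have "(S k ^^ m) X = (S k ^^ m) Y" using S_inject Suc(4) assms(3) by simp
  then show ?case using Suc by auto
qed simp

lemma apply_upto_inject:
  assumes "valid X" "valid Y" and dec: "\<forall>k\<ge>1. f (Suc k) \<le> f k"
    and "apply_upto f n X = apply_upto f n Y"
  shows "X = Y"
  using assms(4)
proof (induction n)
  case (Suc n)
  have "f (Suc n) \<le> gap n (apply_upto f n Z)" if "valid Z" "n \<noteq> 0" for Z
    using apply_upto(2)[OF that(1) dec, of n n] that(2) dec[rule_format, of n] by simp
  then have "apply_upto f n X = apply_upto f n Y"
    using Suc(2) apply_upto(1) assms
    by (intro S_pow_inject[of "apply_upto f n X" "apply_upto f n Y" "Suc n" "f (Suc n)"])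
      (auto simp: apply_upto_Suc)
  then show ?case by (rule Suc(1))
qed simp

lemma S_pow_commute:
  assumes "valid X" "1 \<le> j" "1 \<le> k" "j \<noteq> k" "dom k X" "j = 1 \<or> m \<le> gap (j - 1) X"
  shows "dom k ((S j ^^ m) X)" "S k ((S j ^^ m) X) = (S j ^^ m) (S k X)"
proof -
  have "dom k ((S j ^^ m) X) \<and> S k ((S j ^^ m) X) = (S j ^^ m) (S k X)"
    using assms(6)
  proof (induction m)
    case (Suc m)
    have v: "valid ((S j ^^ m) X)" "dom j ((S j ^^ m) X)"
      using S_pow[OF assms(1,2) Suc(2)] S_pow(1)[OF assms(1,2), of m] Suc(2) by auto
    have "dom k ((S j ^^ m) X)" "S k ((S j ^^ m) X) = (S j ^^ m) (S k X)" using Suc by auto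
    then show ?case
      using v assms dom_S[of "(S j ^^ m) X" k j] S_commute[of "(S j ^^ m) X" j k] by simp
  qed (use assms in simp)
  then show "dom k ((S j ^^ m) X)" "S k ((S j ^^ m) X) = (S j ^^ m) (S k X)" by auto
qed

text \<open>The additional \<open>S k\<close> joins block \<open>k\<close>, where strictness leaves
  one unit of room, after it has commuted with all later blocks.\<close>

lemma S_apply_upto:
  assumes X: "valid X" and dec: "\<forall>k\<ge>1. f (Suc k) \<le> f k"
    and k: "1 \<le> k" "k = 1 \<or> f k < f (k - 1)" "k \<le> n"
  shows "dom k (apply_upto f n X) \<and> S k (apply_upto f n X) = apply_upto (f(k := Suc (f k))) n X"
  using k(3)
proof (induction n rule: dec_induct)
  case base
  obtain m where m: "k = Suc m" using k(1) by (cases k) auto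
  have same: "apply_upto (f(k := Suc (f k))) m X = apply_upto f m X"
    unfolding apply_upto_def by (rule fold_cong) (auto simp: m)
  have c: "k = 1 \<or> Suc (f k) \<le> gap (k - 1) (apply_upto f m X)"
    using apply_upto(2)[OF X dec, of m m] k m by (cases "m = 0") auto
  have "dom k ((S k ^^ f k) (apply_upto f m X))"
    using S_pow(2)[OF apply_upto(1)[OF X dec] k(1) c] by blast
  then show ?case using same by (simp add: m apply_upto_Suc del: fun_upd_apply) simp
next
  case (step n)
  have c: "Suc n = 1 \<or> f (Suc n) \<le> gap (Suc n - 1) (apply_upto f n X)"
    using apply_upto(2)[OF X dec, of n n] dec[rule_format, of n] by (cases "n = 0") auto
  show ?case
    using S_pow_commute[OF apply_upto(1)[OF X dec] _ k(1) _ _ c] step by (simp add: apply_upto_Suc)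
qed

definition b :: "nat list \<Rightarrow> 'a \<Rightarrow> 'a" where
  "b \<sigma> X = fold (\<lambda>k. S k ^^ part \<sigma> k) [1..<Suc (length \<sigma>)] X"

lemma b_eq_apply_upto:
  assumes "length \<sigma> \<le> n" shows "b \<sigma> X = apply_upto (part \<sigma>) n X"
  using assms
proof (induction n rule: dec_induct)
  case base
  then show ?case by (simp add: b_def apply_upto_def)
next
  case (step n)
  then show ?case by (simp add: apply_upto_Suc part_beyond)
qed

lemma b_Nil [simp]: "b [] X = X"
  by (simp add: b_def)

lemma gap_b:
  assumes "partition \<sigma>" "valid X" "1 \<le> j"
  shows "gap j (b \<sigma> X) = gap j X + (part \<sigma> j - part \<sigma> (Suc j))"
  using b_eq_apply_upto[of \<sigma> "length \<sigma>"] apply_upto(2)[OF assms(2) part_dec[OF assms(1)] assms(3)]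
    part_beyond[of \<sigma> "Suc j"] part_beyond[of \<sigma> j] by auto

lemma S_b:
  assumes "adds_box k \<theta> \<rho>" "valid X"
  shows "dom k (b \<theta> X)" "S k (b \<theta> X) = b \<rho> X"
proof -
  have p: "partition \<theta>" "partition \<rho>" "1 \<le> k" and eq: "part \<rho> = (part \<theta>)(k := Suc (part \<theta> k))"
    using assms(1) by (auto simp: adds_box_def)
  define n where "n = max k (max (length \<theta>) (length \<rho>))"
  have "k = 1 \<or> part \<theta> k < part \<theta> (k - 1)"
  proof (cases "k = 1")
    case False
    then obtain j where "k = Suc j" "1 \<le> j" using p(3) by (cases k) auto
    then show ?thesis using part_mono[OF p(2), of j k] unfolding eq by auto
  qed simp
  then have "dom k (apply_upto (part \<theta>) n X) \<and> S k (apply_upto (part \<theta>) n X) = apply_upto (part \<rho>) n X"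
    unfolding eq using p by (intro S_apply_upto assms(2) part_dec) (auto simp: n_def)
  then show "dom k (b \<theta> X)" "S k (b \<theta> X) = b \<rho> X"
    by (simp_all add: b_eq_apply_upto[of _ n] n_def)
qed

section \<open>Existence and uniqueness of the position\<close>

lemma ex_adds_box:
  assumes "partition \<theta>" "1 \<le> k" "k = 1 \<or> part \<theta> k < part \<theta> (k - 1)"
  obtains \<rho> where "adds_box k \<theta> \<rho>"
proof -
  let ?f = "(part \<theta>)(k := Suc (part \<theta> k))"
  have "?f (Suc j) \<le> ?f j" if "1 \<le> j" for j
    using assms part_dec[OF assms(1)] that by auto
  moreover have "?f j = 0" if "max k (length \<theta>) < j" for j
    using that by (simp add: part_beyond)
  ultimately obtain \<rho> where "partition \<rho>" "\<And>j. 1 \<le> j \<Longrightarrow> part \<rho> j = ?f j"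
    using partition_of_fun[of ?f "max k (length \<theta>)"] by blast
  moreover have "part \<rho> 0 = ?f 0" using assms(2) by simp
  ultimately have "adds_box k \<theta> \<rho>"
    using assms unfolding adds_box_def by (metis One_nat_def Suc_eq_plus1 ext less_one linorder_not_less)
  then show ?thesis by (rule that)
qed

lemma ex_decomposition:
  assumes "valid X"
  obtains \<theta> B where "partition \<theta>" "valid B" "\<And>k. 1 \<le> k \<Longrightarrow> gap k B = 0" "X = b \<theta> B"
proof -
  obtain K where K: "\<forall>k\<ge>K. \<not> dom k X" using eventually_not_dom assms by blast
  have K': "gap k X = 0" if "K \<le> k" "1 \<le> k" for k
    using gap_0_iff[OF assms that(2)] K that by simp
  have "\<exists>\<theta> B. partition \<theta> \<and> valid B \<and> (\<forall>k\<ge>1. gap k B = 0) \<and> X = b \<theta> B"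
    if "\<And>k. K \<le> k \<Longrightarrow> 1 \<le> k \<Longrightarrow> gap k X = 0" "valid X" for X
    using that
  \<comment> \<open>Since gaps become differences of consecutive parts, this weight is the size of
    the partition sought. Undoing a shift of index \<open>k\<close> changes it by \<open>- k\<close>
    at index \<open>k\<close> and, if \<open>k > 1\<close>, by \<open>+ (k - 1)\<close> at index
    \<open>k - 1\<close>, so it drops by one. The bound \<open>K\<close> makes the sum
    finite.\<close>
  proof (induction "\<Sum>k=1..K. k * gap k X" arbitrary: X rule: less_induct)
    case less
    show ?case
    proof (cases "\<forall>k\<ge>1. gap k X = 0")
      case True
      then show ?thesis using less(3) by (intro exI[of _ "[]"] exI[of _ X]) (simp add: partition_def)
    next
      case False
      then obtain k where k: "1 \<le> k" "gap k X \<noteq> 0" by blast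
      then have kK: "k < K" using less(2)[of k] by (metis not_less)
      obtain Y where Y: "valid Y" "dom k Y" "S k Y = X"
        using dom_Suc_imp[OF less(3) k(1)] gap_0_iff[OF less(3) k(1)] k(2) by blast
      have g: "gap j X = (if j = k then Suc (gap j Y) else if Suc j = k then gap j Y - 1 else gap j Y)"
        if "1 \<le> j" for j
        using gap_S[OF Y(1) k(1) that Y(2)] Y(3) by simp
      have gY: "0 < gap (k - 1) Y" if "k \<noteq> 1" using dom_iff[OF Y(1) k(1)] Y(2) that by simp
      have sum: "(\<Sum>j=1..K. j * gap j Y) < (\<Sum>j=1..K. j * gap j X)"
      proof -
        have "(\<Sum>j=1..K. j * gap j Y) + k = (\<Sum>j=1..K. j * gap j Y + (if j = k then k else 0))"
          using k kK by (simp add: sum.distrib)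
        also have "\<dots> = (\<Sum>j=1..K. j * gap j X + (if Suc j = k then k - 1 else 0))"
        proof (rule sum.cong)
          fix j assume "j \<in> {1..K}"
          then have j: "1 \<le> j" by simp
          show "j * gap j Y + (if j = k then k else 0) = j * gap j X + (if Suc j = k then k - 1 else 0)"
            using g[OF j] gY j by (cases "gap j Y") auto
        qed simp
        also have "\<dots> \<le> (\<Sum>j=1..K. j * gap j X) + (k - 1)"
        proof -
          have "(\<Sum>j=1..K. if Suc j = k then k - 1 else 0) = (\<Sum>j=1..K. if j = k - 1 then k - 1 else 0)"
            using k(1) by (intro sum.cong) auto
          also have "\<dots> \<le> k - 1" by simp
          finally show ?thesis by (simp add: sum.distrib)
        qed
        finally show ?thesis using k(1) by linarith
      qed
      have "gap j Y = 0" if "K \<le> j" "1 \<le> j" for j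
        using g[OF that(2)] less(2)[OF that] kK that by simp
      then obtain \<theta> B where B: "partition \<theta>" "valid B" "\<forall>k\<ge>1. gap k B = 0" "Y = b \<theta> B"
        using less(1)[OF sum _ Y(1)] by blast
      have "k = 1 \<or> part \<theta> k < part \<theta> (k - 1)"
        using gap_b[OF B(1,2), of "k - 1"] B(3,4) gY k by (cases "k = 1") auto
      then obtain \<rho> where \<rho>: "adds_box k \<theta> \<rho>" using ex_adds_box B(1) k(1) by metis
      then have "X = b \<rho> B" using S_b(2)[OF \<rho> B(2)] B(4) Y(3) by simp
      then show ?thesis using \<rho> B by (auto simp: adds_box_def)
    qed
  qed
  then show ?thesis using K' assms that by blast
qed

definition hw :: "'a \<Rightarrow> bool" where
  "hw X \<longleftrightarrow> valid X \<and> \<not> (\<exists>\<sigma> Y. partition \<sigma> \<and> \<sigma> \<noteq> [] \<and> valid Y \<and> X = b \<sigma> Y)"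

text \<open>A highest weight element decomposes over a gap-free one, and the partition involved must
  be empty. Conversely, the last row of a nonempty partition creates a positive gap.\<close>

lemma hw_iff: "hw X \<longleftrightarrow> valid X \<and> (\<forall>k\<ge>1. gap k X = 0)"
proof (intro iffI conjI)
  assume X: "hw X"
  then show "valid X" by (simp add: hw_def)
  then obtain \<theta> B where B: "partition \<theta>" "valid B" "\<And>k. 1 \<le> k \<Longrightarrow> gap k B = 0" "X = b \<theta> B"
    using ex_decomposition by metis
  then have "\<theta> = []" using X by (auto simp: hw_def)
  then show "\<forall>k\<ge>1. gap k X = 0" using B by simp
next
  assume X: "valid X \<and> (\<forall>k\<ge>1. gap k X = 0)"
  have False if s: "partition \<sigma>" "\<sigma> \<noteq> []" "valid Y" "X = b \<sigma> Y" for \<sigma> Y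
  proof -
    have "1 \<le> length \<sigma>" using s(2) by (cases \<sigma>) auto
    then show False
      using gap_b[OF s(1,3), of "length \<sigma>"] X s(4) part_pos_iff[OF s(1), of "length \<sigma>"]
        part_beyond[of \<sigma> "Suc (length \<sigma>)"] by simp
  qed
  then show "hw X" using X by (auto simp: hw_def)
qed

lemma gap_b_hw:
  assumes "partition \<theta>" "hw B" "1 \<le> k"
  shows "gap k (b \<theta> B) = part \<theta> k - part \<theta> (Suc k)"
  using assms by (simp add: gap_b hw_iff)

text \<open>Gaps give the differences of consecutive parts, and descending from an index beyond both
  lengths recovers the parts. Injectivity of the shifts then recovers the source.\<close>

lemma decomposition_unique:
  assumes "partition \<theta>" "hw B" "partition \<rho>" "hw C" "b \<theta> B = b \<rho> C"
  shows "\<theta> = \<rho>" "B = C"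
proof -
  have d: "part \<theta> k - part \<theta> (Suc k) = part \<rho> k - part \<rho> (Suc k)" if "1 \<le> k" for k
    using gap_b_hw that assms by metis
  define n where "n = Suc (max (length \<theta>) (length \<rho>))"
  have eq: "part \<theta> k = part \<rho> k" if "1 \<le> k" for k
  proof (cases "k \<le> n")
    case True
    then show ?thesis using that
    proof (induction k rule: inc_induct)
      case base
      then show ?case by (simp add: n_def part_beyond)
    next
      case (step k)
      then have "part \<theta> (Suc k) \<le> part \<theta> k" "part \<rho> (Suc k) \<le> part \<rho> k"
        using part_dec assms(1,3) by blast+
      then show ?case using step d[of k] by simp
    qed
  next
    case False
    then show ?thesis by (simp add: n_def part_beyond)
  qed
  then show "\<theta> = \<rho>" by (rule partition_eqI[OF assms(1,3)])
  then show "B = C"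
    using apply_upto_inject[of B C "part \<theta>" "length \<theta>", OF _ _ part_dec[OF assms(1)]] assms
    by (auto simp: b_eq_apply_upto[OF order_refl] hw_iff)
qed

lemma ex_hw_decomposition:
  assumes "valid X" obtains \<theta> B where "partition \<theta>" "hw B" "X = b \<theta> B"
  using ex_decomposition[OF assms] hw_iff by metis

lemma arrow_iff:
  assumes "valid X" "1 \<le> k"
  shows "(\<exists>B \<theta> \<rho>. hw B \<and> adds_box k \<theta> \<rho> \<and> X = b \<theta> B \<and> X' = b \<rho> B) \<longleftrightarrow> dom k X \<and> X' = S k X"
proof
  assume "dom k X \<and> X' = S k X"
  moreover obtain \<theta> B where B: "partition \<theta>" "hw B" "X = b \<theta> B"
    using ex_hw_decomposition assms(1) by blast
  moreover have "k = 1 \<or> part \<theta> k < part \<theta> (k - 1)"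
    using calculation dom_iff[OF assms] gap_b_hw[OF B(1,2), of "k - 1"] assms(2) by (cases "k = 1") auto
  then obtain \<rho> where "adds_box k \<theta> \<rho>" using ex_adds_box B(1) assms(2) by metis
  ultimately show "\<exists>B \<theta> \<rho>. hw B \<and> adds_box k \<theta> \<rho> \<and> X = b \<theta> B \<and> X' = b \<rho> B"
    using S_b(2) hw_iff by metis
qed (use S_b hw_iff in metis)

end

section \<open>Unfolding an abacus\<close>

lemma abacus_exchange:
  assumes "abacus l A" "finite P" "finite Q" "Q \<subseteq> UNIV \<times> {1..l}"
  shows "abacus l ((A - P) \<union> Q)"
proof -
  obtain m n where mn: "\<And>j c. j \<in> {1..l} \<Longrightarrow> c \<le> m \<Longrightarrow> (c, j) \<in> A"
      "\<And>j c. j \<in> {1..l} \<Longrightarrow> n \<le> c \<Longrightarrow> (c, j) \<notin> A"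
    using assms(1) unfolding abacus_def by blast
  \<comment> \<open>Inserting \<open>0\<close> keeps the minimum meaningful when \<open>P\<close> is
    empty.\<close>
  define p where "p = Min (insert 0 (fst ` P)) - 1"
  have p: "p < c" if "(c, j) \<in> P" for c j
  proof -
    have "Min (insert 0 (fst ` P)) \<le> c"
      using assms(2) that by (intro Min_le) (auto intro: rev_image_eqI)
    then show ?thesis by (simp add: p_def)
  qed
  define q where "q = Max (insert 0 (fst ` Q)) + 1"
  have q: "c < q" if "(c, j) \<in> Q" for c j
  proof -
    have "c \<le> Max (insert 0 (fst ` Q))"
      using assms(3) that by (intro Max_ge) (auto intro: rev_image_eqI)
    then show ?thesis by (simp add: q_def)
  qed
  have "(c, j) \<in> (A - P) \<union> Q" if "j \<in> {1..l}" "c \<le> min m p" for c j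
    using mn(1)[OF that(1), of c] p[of c j] that(2) by auto
  moreover have "(c, j) \<notin> (A - P) \<union> Q" if "j \<in> {1..l}" "max n q \<le> c" for c j
    using mn(2)[OF that(1), of c] q[of c j] that(2) by auto
  moreover have "(A - P) \<union> Q \<subseteq> UNIV \<times> {1..l}"
    using assms(1,4) by (auto simp: abacus_def)
  ultimately show ?thesis unfolding abacus_def by blast
qed

lemma asym_bead_less: "asym bead_less"
  by (auto simp: bead_less_def intro!: asymI)

lemma largest_eqI:
  assumes "P \<in> S" "\<And>P'. P' \<in> S \<Longrightarrow> P' \<noteq> P \<Longrightarrow> (P', P) \<in> lexord bead_less"
  shows "largest S = P"
  unfolding largest_def
proof (rule the_equality)
  fix P' assume P': "P' \<in> S \<and> (\<forall>P''\<in>S. P'' \<noteq> P' \<longrightarrow> (P'', P') \<in> lexord bead_less)"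
  show "P' = P"
  proof (rule ccontr)
    assume "P' \<noteq> P"
    then have "(P', P) \<in> lexord bead_less" "(P, P') \<in> lexord bead_less" using assms P' by auto
    then show False using lexord_asymmetric[OF asym_bead_less] by blast
  qed
qed (use assms in blast)

lemma smallest_eqI:
  assumes "P \<in> S" "\<And>P'. P' \<in> S \<Longrightarrow> P' \<noteq> P \<Longrightarrow> (P, P') \<in> lexord bead_less"
  shows "smallest S = P"
  unfolding smallest_def
proof (rule the_equality)
  fix P' assume P': "P' \<in> S \<and> (\<forall>P''\<in>S. P'' \<noteq> P' \<longrightarrow> (P', P'') \<in> lexord bead_less)"
  show "P' = P"
  proof (rule ccontr)
    assume "P' \<noteq> P"
    then have "(P', P) \<in> lexord bead_less" "(P, P') \<in> lexord bead_less" using assms P' by auto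
    then show False using lexord_asymmetric[OF asym_bead_less] by blast
  qed
qed (use assms in blast)

context cylinder
begin

text \<open>The quotient counts the translations by \<open>(e, l)\<close> that bring
  \<open>y\<close> into the rows 1 to \<open>l\<close>; the offset 1 is there because rows are
  numbered from 1.\<close>

definition cover :: "bead set \<Rightarrow> (int \<times> int) set" where
  "cover A = {(c, y). (c - int e * ((y - 1) div int l), nat ((y - 1) mod int l + 1)) \<in> A}"

lemma cover_shift: "(c + int e * t, y + int l * t) \<in> cover A \<longleftrightarrow> (c, y) \<in> cover A"
proof -
  have "(y + int l * t - 1) div int l = t + (y - 1) div int l"
    using l_pos div_mult_self2[of "int l" "y - 1" t] by (simp add: algebra_simps)
  moreover have "(y + int l * t - 1) mod int l = (y - 1) mod int l"
    using mod_mult_self2[of "y - 1" "int l" t] by (simp add: algebra_simps)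
  moreover have "c + int e * t - int e * (t + d) = c - int e * d" for d
    by (simp add: algebra_simps)
  ultimately show ?thesis
    unfolding cover_def mem_Collect_eq prod.case by metis
qed

lemma cover_row: "1 \<le> j \<Longrightarrow> j \<le> l \<Longrightarrow> (c, int j) \<in> cover A \<longleftrightarrow> (c, j) \<in> A"
  by (simp add: cover_def div_pos_pos_trivial mod_pos_pos_trivial)

lemma cover_inject:
  assumes "A \<subseteq> UNIV \<times> {1..l}" "B \<subseteq> UNIV \<times> {1..l}" "cover A = cover B"
  shows "A = B"
proof -
  have "(c, j) \<in> A \<longleftrightarrow> (c, j) \<in> B" for c j
    using assms cover_row[of j c A] cover_row[of j c B] by (cases "j \<in> {1..l}") auto
  then show ?thesis by (intro set_eqI) (metis surj_pair)
qed

lemma cover_Diff: "cover (A - B) = cover A - cover B"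
  and cover_Un: "cover (A \<union> B) = cover A \<union> cover B"
  by (auto simp: cover_def)

lemma row_range: "1 \<le> y mod int l + 1" "y mod int l + 1 \<le> int l"
proof -
  have "0 \<le> y mod int l" "y mod int l < int l" using l_pos by simp_all
  then show "1 \<le> y mod int l + 1" "y mod int l + 1 \<le> int l" by linarith+
qed

lemma nat_row: "1 \<le> y \<Longrightarrow> y \<le> int l \<Longrightarrow> 1 \<le> nat y \<and> nat y \<le> l"
  by linarith

lemma admissible_cover:
  assumes "abacus l A" shows "admissible (cover A)"
proof -
  obtain m n where mn: "\<And>j c. j \<in> {1..l} \<Longrightarrow> c \<le> m \<Longrightarrow> (c, j) \<in> A"
      "\<And>j c. j \<in> {1..l} \<Longrightarrow> n \<le> c \<Longrightarrow> (c, j) \<notin> A"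
    using assms unfolding abacus_def by blast
  have row: "nat ((y - 1) mod int l + 1) \<in> {1..l}" for y
    using nat_row[OF row_range] by simp
  have "periodic (cover A)"
    using cover_shift[of _ 1] by (simp add: periodic_def)
  moreover have "full_above (cover A)"
    unfolding full_above_def
  proof (intro exI allI impI)
    \<comment> \<open>With this constant the number of translations is at least
      \<open>c div e + |m| + 1\<close>, so the translated column is at most
      \<open>m\<close>.\<close>
    fix c y assume y: "base c + (int l * (\<bar>m\<bar> + 1) + 1) \<le> y"
    have "int l * (c div int e + \<bar>m\<bar> + 1) \<le> y - 1" using y by (simp add: base_def algebra_simps)
    then have "c div int e + \<bar>m\<bar> + 1 \<le> (y - 1) div int l"
      using l_pos by (metis mult.commute of_nat_0_less_iff zdiv_mono1 nonzero_mult_div_cancel_right less_irrefl)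
    then have "int e * (c div int e + \<bar>m\<bar> + 1) \<le> int e * ((y - 1) div int l)" by (simp add: mult_left_mono)
    moreover have "c < int e * (c div int e) + int e"
      using e_pos mult_div_mod_eq[of "int e" c] pos_mod_bound[of "int e" c] by linarith
    moreover have "\<bar>m\<bar> \<le> int e * \<bar>m\<bar>" using e_pos by (simp add: mult_le_cancel_right1)
    ultimately have "c - int e * ((y - 1) div int l) \<le> m" by (simp add: algebra_simps)
    then show "(c, y) \<in> cover A" using mn(1)[OF row] by (simp add: cover_def)
  qed
  moreover have "bounded_from_below (cover A)"
    unfolding bounded_from_below_def
  proof (intro exI allI impI)
    fix c y assume "(c, y) \<in> cover A"
    then have "c - int e * ((y - 1) div int l) < n"
      using mn(2)[OF row, of n y] mn(2)[OF row] by (fastforce simp: cover_def not_le[symmetric])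
    moreover have "int e * (c div int e) \<le> c"
      using e_pos mult_div_mod_eq[of "int e" c] pos_mod_sign[of "int e" c] by linarith
    ultimately have "int e * (c div int e - (y - 1) div int l) < n" by (simp add: algebra_simps)
    moreover have "c div int e - (y - 1) div int l \<le> \<bar>n\<bar>"
    proof (rule ccontr)
      assume "\<not> ?thesis"
      then have "\<bar>n\<bar> \<le> c div int e - (y - 1) div int l" by simp
      then have "\<bar>n\<bar> \<le> int e * (c div int e - (y - 1) div int l)"
        using e_pos by (smt (verit, best) mult_le_cancel_right1 of_nat_0_less_iff)
      then show False using calculation by simp
    qed
    then have "int l * (c div int e - \<bar>n\<bar>) \<le> int l * ((y - 1) div int l)" by (intro mult_left_mono) auto
    moreover have "int l * ((y - 1) div int l) \<le> y - 1"
      using l_pos mult_div_mod_eq[of "int l" "y - 1"] pos_mod_sign[of "int l" "y - 1"] by linarith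
    ultimately show "base c + (- int l * \<bar>n\<bar>) \<le> y" by (simp add: base_def algebra_simps)
  qed
  ultimately show ?thesis by (simp add: admissible_def)
qed

section \<open>Loops and the quasiperiods they cut out\<close>

definition top :: "(int \<Rightarrow> int) \<Rightarrow> int" where
  "top x = (THE c. x c \<le> int l \<and> int l < x (c + 1))"

lemma ex_top:
  assumes "loop x" shows "\<exists>c. x c \<le> int l \<and> int l < x (c + 1)"
proof (rule ccontr)
  assume no: "\<nexists>c. x c \<le> int l \<and> int l < x (c + 1)"
  define a where "a = int e * (- \<bar>x 0\<bar>)"
  have l1: "t \<le> int l * t" if "0 \<le> t" for t
    using l_pos that by (simp add: mult_le_cancel_right1)
  have "x a = x 0 + int l * (- \<bar>x 0\<bar>)"
    using loop_period_int[OF assms, of 0 "- \<bar>x 0\<bar>"] by (simp add: a_def)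
  then have a: "x a \<le> int l" using l1[of "\<bar>x 0\<bar>"] by simp
  have "x (a + int n) \<le> int l" for n
  proof (induction n)
    case (Suc n)
    moreover have "a + int (Suc n) = a + int n + 1" by simp
    ultimately show ?case using no by (metis not_le)
  qed (use a in simp)
  from this[of "e * nat (2 * \<bar>x 0\<bar> + int l + 1)"] 
  have "x (a + int e * (2 * \<bar>x 0\<bar> + int l + 1)) \<le> int l" by simp
  moreover have "a + int e * (2 * \<bar>x 0\<bar> + int l + 1) = 0 + int e * (\<bar>x 0\<bar> + int l + 1)"
    by (simp add: a_def algebra_simps)
  ultimately have "x 0 + int l * (\<bar>x 0\<bar> + int l + 1) \<le> int l"
    using loop_period_int[OF assms, of 0] by metis
  then show False using l1[of "\<bar>x 0\<bar> + int l + 1"] by linarith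
qed

lemma top_eqI:
  assumes "loop x" "x c \<le> int l" "int l < x (c + 1)"
  shows "top x = c"
  unfolding top_def
proof (rule the_equality)
  fix d assume d: "x d \<le> int l \<and> int l < x (d + 1)"
  have "\<not> c + 1 \<le> d" "\<not> d + 1 \<le> c"
    using loop_mono[OF assms(1), of "c + 1" d] loop_mono[OF assms(1), of "d + 1" c] assms d by auto
  then show "d = c" by simp
qed (use assms in simp)

lemma le_top_iff:
  assumes "loop x" shows "x c \<le> int l \<longleftrightarrow> c \<le> top x"
proof -
  obtain d where d: "x d \<le> int l" "int l < x (d + 1)" using ex_top[OF assms] by blast
  then have "top x = d" using top_eqI[OF assms] by blast
  then show ?thesis
    using d loop_mono[OF assms, of c d] loop_mono[OF assms, of "d + 1" c] by force
qed

lemma pos_iff_top: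
  assumes "loop x" shows "1 \<le> x c \<longleftrightarrow> top x - int e < c"
  using le_top_iff[OF assms, of "c + int e"] loop_period[OF assms, of c] by auto

text \<open>A loop descends by \<open>l\<close> in \<open>e\<close> columns, so exactly \<open>e\<close> of its beads lie in the rows
  \<open>1, \<dots>, l\<close>; they form a quasiperiod.\<close>

definition word :: "(int \<Rightarrow> int) \<Rightarrow> bead list" where
  "word x = map (\<lambda>i. (top x - int i, nat (x (top x - int i)))) [0..<e]"

lemma length_word [simp]: "length (word x) = e"
  by (simp add: word_def)

lemma nth_word: "i < e \<Longrightarrow> word x ! i = (top x - int i, nat (x (top x - int i)))"
  by (simp add: word_def)

lemma mem_word:
  assumes "loop x" shows "(c, j) \<in> set (word x) \<longleftrightarrow> 1 \<le> j \<and> j \<le> l \<and> x c = int j"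
proof -
  have "(c, j) \<in> set (word x) \<longleftrightarrow> top x - int e < c \<and> c \<le> top x \<and> j = nat (x c)"
  proof
    assume "top x - int e < c \<and> c \<le> top x \<and> j = nat (x c)"
    then have "nat (top x - c) < e" "top x - int (nat (top x - c)) = c" "j = nat (x c)" by auto
    then show "(c, j) \<in> set (word x)"
      unfolding word_def by (auto intro!: image_eqI[of _ _ "nat (top x - c)"])
  qed (auto simp: word_def)
  then show ?thesis
    using le_top_iff[OF assms, of c] pos_iff_top[OF assms, of c] by auto
qed

lemma hd_word: "fst (hd (word x)) = top x"
  using e_pos by (simp add: hd_conv_nth[of "word x"] nth_word flip: length_greater_0_conv)

lemma last_word: "fst (last (word x)) = top x - int e + 1"
  using e_pos by (simp add: last_conv_nth[of "word x"] nth_word of_nat_diff flip: length_greater_0_conv)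

lemma cover_word:
  assumes "loop x" shows "cover (set (word x)) = graph x"
proof -
  have "(c, y) \<in> cover (set (word x)) \<longleftrightarrow> y = x c" for c y
  proof -
    let ?t = "(y - 1) div int l" and ?r = "(y - 1) mod int l + 1"
    have r: "1 \<le> ?r" "?r \<le> int l" by (rule row_range)+
    have "y = int l * ?t + ?r" by simp
    moreover have "x (c - int e * ?t) = x c - int l * ?t"
      using loop_period_int[OF assms, of c "- ?t"] by simp
    moreover have "(c, y) \<in> cover (set (word x)) \<longleftrightarrow> x (c - int e * ?t) = ?r"
      using r nat_row[OF r] by (simp add: cover_def mem_word[OF assms])
    ultimately show ?thesis by linarith
  qed
  then show ?thesis by (intro set_eqI) (metis surj_pair mem_graph)
qed

lemma word_inject:
  assumes "loop x" "loop y" "set (word x) = set (word y)" shows "x = y"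
proof -
  have "graph x = graph y" using assms cover_word by metis
  then show ?thesis by (auto simp: graph_def)
qed

lemma loop_in_cover_iff:
  assumes "loop x" shows "loop_in (cover A) x \<longleftrightarrow> set (word x) \<subseteq> A"
proof
  assume x: "loop_in (cover A) x"
  show "set (word x) \<subseteq> A"
  proof (rule subrelI)
    fix c j assume "(c, j) \<in> set (word x)"
    then have "1 \<le> j" "j \<le> l" "x c = int j" by (simp_all add: mem_word[OF assms])
    then show "(c, j) \<in> A" using loop_inD(2)[OF x, of c] cover_row by metis
  qed
next
  assume "set (word x) \<subseteq> A"
  then have "cover (set (word x)) \<subseteq> cover A" by (auto simp: cover_def)
  then show "loop_in (cover A) x" using assms cover_word by (simp add: loop_in_def)
qed

lemma quasiperiod_word:
  assumes "loop_in (cover A) x" shows "quasiperiod e A (word x)"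
proof -
  have lx: "loop x" by (rule loop_inD(1)[OF assms])
  have "fst (word x ! Suc i) = fst (word x ! i) - 1 \<and> snd (word x ! Suc i) \<le> snd (word x ! i)"
    if "Suc i < e" for i
    using that loop_step'[OF lx, of "top x - int i"] by (simp add: nth_word nat_mono diff_diff_eq add.commute)
  then show ?thesis
    using assms loop_in_cover_iff[OF lx] by (simp add: quasiperiod_def)
qed

lemma quasiperiod_imp_word:
  assumes A: "A \<subseteq> UNIV \<times> {1..l}" and P: "quasiperiod e A P"
  obtains x where "loop_in (cover A) x" "P = word x"
proof -
  define c0 where "c0 = fst (P ! 0)"
  \<comment> \<open>Periodic extension of \<open>P\<close>: column \<open>c0 - i - e * t\<close>
    receives the row of the bead with index \<open>i\<close>, lowered by
    \<open>l * t\<close>.\<close>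
  define x where "x = (\<lambda>c. int (snd (P ! nat ((c0 - c) mod int e))) - int l * ((c0 - c) div int e))"
  have len: "length P = e" and sub: "set P \<subseteq> A"
    and step: "\<And>i. Suc i < e \<Longrightarrow> fst (P ! Suc i) = fst (P ! i) - 1 \<and> snd (P ! Suc i) \<le> snd (P ! i)"
    using P by (auto simp: quasiperiod_def)
  have fst: "fst (P ! i) = c0 - int i" if "i < e" for i
    using that by (induction i) (use step in \<open>auto simp: c0_def\<close>)
  have row: "1 \<le> snd (P ! i) \<and> snd (P ! i) \<le> l" if "i < e" for i
  proof -
    have "P ! i \<in> A" using that sub len nth_mem[of i P] by auto
    then show ?thesis using A by (cases "P ! i") auto
  qed
  have xi: "x (c0 - int i - int e * t) = int (snd (P ! i)) - int l * t" if "i < e" for i t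
  proof -
    have "(int i + int e * t) mod int e = int i" "(int i + int e * t) div int e = t"
      using that by simp_all
    moreover have "c0 - (c0 - int i - int e * t) = int i + int e * t" by simp
    ultimately show ?thesis by (simp add: x_def)
  qed
  have col: "\<exists>i t. i < e \<and> c = c0 - int i - int e * t" for c
  proof -
    have "nat ((c0 - c) mod int e) < e" using e_pos by (simp add: nat_less_iff)
    moreover have "c = c0 - int (nat ((c0 - c) mod int e)) - int e * ((c0 - c) div int e)"
    proof -
      have "int (nat ((c0 - c) mod int e)) = (c0 - c) mod int e" using e_pos by simp
      then show ?thesis using mult_div_mod_eq[of "int e" "c0 - c"] by linarith
    qed
    ultimately show ?thesis by blast
  qed
  have lx: "loop x" unfolding loop_def
  proof (intro conjI allI)
    fix c
    obtain i t where it: "i < e" "c = c0 - int i - int e * t" using col by blast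
    have c1: "c + int e = c0 - int i - int e * (t - 1)" using it(2) by (simp add: algebra_simps)
    then show "x (c + int e) = x c + int l"
      using xi[OF it(1), of t] xi[OF it(1), of "t - 1"] unfolding c1 it(2) by (simp add: algebra_simps)
    show "x c \<le> x (c + 1)"
    proof (cases i)
      case 0
      \<comment> \<open>This is the seam between two copies of \<open>P\<close>, where monotonicity
        comes from all rows lying between 1 and \<open>l\<close>.\<close>
      have c2: "c + 1 = c0 - int (e - 1) - int e * (t - 1)"
        using it(2) 0 e_pos by (simp add: algebra_simps of_nat_diff)
      have "int (snd (P ! 0)) \<le> int (snd (P ! (e - 1))) + int l"
        using row[of 0] e_pos by simp
      then show ?thesis
        using xi[of 0 t] xi[of "e - 1" "t - 1"] e_pos 0 unfolding c2 it(2) by (simp add: algebra_simps)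
    next
      case (Suc i')
      have c3: "c + 1 = c0 - int i' - int e * t" using it(2) Suc by simp
      have "x c = int (snd (P ! Suc i')) - int l * t" using xi[OF it(1), of t] it(2) Suc by simp
      moreover have "x (c + 1) = int (snd (P ! i')) - int l * t"
        using xi[of i' t] it(1) Suc unfolding c3 by simp
      ultimately show ?thesis using step[of i'] it(1) Suc by simp
    qed
  qed
  have "x c0 \<le> int l" using xi[of 0 0] row[of 0] e_pos by simp
  moreover have "int l < x (c0 + 1)"
    using xi[of "e - 1" "-1"] row[of "e - 1"] e_pos by (simp add: of_nat_diff)
  ultimately have "top x = c0" by (rule top_eqI[OF lx])
  then have "word x ! i = P ! i" if "i < e" for i
    using that fst[OF that] xi[OF that, of 0] by (simp add: nth_word prod_eq_iff)
  then have w: "P = word x" using len by (intro nth_equalityI) auto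
  then have "loop_in (cover A) x" using loop_in_cover_iff[OF lx] sub by simp
  then show ?thesis using w that by blast
qed

text \<open>A higher loop passes row \<open>l\<close> no later, so its word starts no further right.
  If the starting columns agree, the first difference lies within one column, where the higher row
  is the smaller bead. Treating comparable loops suffices for families with a pointwise least or
  greatest member.\<close>

lemma word_less:
  assumes "loop x" "loop y" "x \<le> y" "x \<noteq> y"
  shows "(word y, word x) \<in> lexord bead_less"
proof -
  have le: "x c \<le> y c" for c using assms(3) by (simp add: le_fun_def)
  have "x (top y) \<le> int l" using le_top_iff[OF assms(2), of "top y"] le[of "top y"] by simp
  then have "top y \<le> top x" using le_top_iff[OF assms(1)] by simp
  then consider "top y < top x" | "top y = top x" by linarith
  then have "\<exists>i<e. take i (word y) = take i (word x) \<and> (word y ! i, word x ! i) \<in> bead_less"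
  proof cases
    case 1
    then show ?thesis using e_pos by (intro exI[of _ 0]) (simp add: nth_word bead_less_def)
  next
    case 2
    have "\<exists>i. i < e \<and> word y ! i \<noteq> word x ! i"
    proof (rule ccontr)
      assume "\<not> ?thesis"
      then have "word y = word x" by (intro nth_equalityI) auto
      then show False using word_inject[OF assms(1,2)] assms(4) by simp
    qed
    then obtain i where i: "i < e" "word y ! i \<noteq> word x ! i" "\<And>j. j < i \<Longrightarrow> word y ! j = word x ! j"
      using exists_least_iff[of "\<lambda>i. i < e \<and> word y ! i \<noteq> word x ! i"] by (metis order_less_trans)
    have "take i (word y) = take i (word x)"
      using i(1,3) by (intro nth_equalityI) auto
    moreover have "nat (x (top x - int i)) \<le> nat (y (top x - int i))" using le by (rule nat_mono)
    then have "(word y ! i, word x ! i) \<in> bead_less"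
      using i(1,2) 2 by (auto simp: nth_word bead_less_def)
    ultimately show ?thesis using i(1) by blast
  qed
  then show ?thesis by (auto simp: lexord_take_index_conv)
qed

lemma largest_words:
  assumes "x \<in> Z" "\<And>z. z \<in> Z \<Longrightarrow> loop z" "\<And>z. z \<in> Z \<Longrightarrow> x \<le> z"
  shows "largest (word ` Z) = word x"
proof (rule largest_eqI)
  fix P assume "P \<in> word ` Z" "P \<noteq> word x"
  then obtain z where "z \<in> Z" "P = word z" "x \<noteq> z" by blast
  then show "(P, word x) \<in> lexord bead_less" using assms word_less by simp
qed (use assms in blast)

lemma smallest_words:
  assumes "x \<in> Z" "\<And>z. z \<in> Z \<Longrightarrow> loop z" "\<And>z. z \<in> Z \<Longrightarrow> z \<le> x"
  shows "smallest (word ` Z) = word x"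
proof (rule smallest_eqI)
  fix P assume "P \<in> word ` Z" "P \<noteq> word x"
  then obtain z where "z \<in> Z" "P = word z" "z \<noteq> x" by blast
  then show "(word x, P) \<in> lexord bead_less" using assms word_less by simp
qed (use assms in blast)

lemma disjoint_words:
  assumes "loop x" "loop y"
  shows "set (word x) \<inter> set (word y) = {} \<longleftrightarrow> (\<forall>c. x c \<noteq> y c)"
proof -
  have "set (word x) \<inter> set (word y) = {} \<longleftrightarrow> graph x \<inter> graph y = {}"
  proof
    assume "set (word x) \<inter> set (word y) = {}"
    then show "graph x \<inter> graph y = {}"
      unfolding cover_word[OF assms(1), symmetric] cover_word[OF assms(2), symmetric]
      by (auto simp: cover_def)
  next
    assume d: "graph x \<inter> graph y = {}"
    have "graph x \<inter> graph y \<noteq> {}" if "(c, j) \<in> set (word x)" "(c, j) \<in> set (word y)" for c j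
    proof -
      have "(c, int j) \<in> graph x \<inter> graph y"
        using that by (simp add: mem_word assms)
      then show ?thesis by blast
    qed
    then show "set (word x) \<inter> set (word y) = {}" using d by auto
  qed
  also have "\<dots> \<longleftrightarrow> (\<forall>c. x c \<noteq> y c)" by (auto simp: graph_def)
  finally show ?thesis .
qed

section \<open>Fore periods, vessels and aft periods read off from the cover\<close>

context
  fixes A :: "bead set"
  assumes abacus: "abacus l A"
begin

lemma abacus_rows: "A \<subseteq> UNIV \<times> {1..l}"
  using abacus by (simp add: abacus_def)

lemma adm: "admissible (cover A)"
  by (rule admissible_cover[OF abacus])

lemma fore_period_eq_word: "fore_period e A (Suc k) = word (fore (cover A) k)"
proof (induction k rule: less_induct)
  case (less k)
  let ?S = "{P. quasiperiod e A P \<and>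
     (1 < Suc k \<longrightarrow> (P, fore_period e A (Suc k - 1)) \<in> lexord bead_less) \<and>
     (\<forall>i\<in>{1..<Suc k}. set P \<inter> set (fore_period e A i) = {})}"
  have dis: "(\<forall>i\<in>{1..<Suc k}. set (word z) \<inter> set (fore_period e A i) = {}) \<longleftrightarrow>
      (\<forall>i<k. \<forall>c. z c \<noteq> fore (cover A) i c)" if "loop z" for z
  proof -
    have "(\<forall>i\<in>{1..<Suc k}. set (word z) \<inter> set (fore_period e A i) = {}) \<longleftrightarrow>
        (\<forall>i<k. set (word z) \<inter> set (fore_period e A (Suc i)) = {})"
      by (auto simp: Ball_def Suc_le_eq gr0_conv_Suc)
    also have "\<dots> \<longleftrightarrow> (\<forall>i<k. \<forall>c. z c \<noteq> fore (cover A) i c)"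
      using disjoint_words[OF that loop_fore[OF adm]] less by auto
    finally show ?thesis .
  qed
  have "?S = word ` {z. loop_in (rest (cover A) k) z}"
  proof (intro equalityI subsetI)
    fix P assume P: "P \<in> ?S"
    then obtain z where z: "loop_in (cover A) z" "P = word z"
      using quasiperiod_imp_word[OF abacus_rows] by blast
    then have "\<forall>i<k. \<forall>c. z c \<noteq> fore (cover A) i c"
      using dis[OF loop_inD(1)[OF z(1)]] P by simp
    then have "loop_in (rest (cover A) k) z"
      using z(1) by (simp add: loop_in_iff mem_rest)
    then show "P \<in> word ` {z. loop_in (rest (cover A) k) z}" using z(2) by blast
  next
    fix P assume "P \<in> word ` {z. loop_in (rest (cover A) k) z}"
    then obtain z where z: "loop_in (rest (cover A) k) z" "P = word z" by blast
    have lz: "loop z" by (rule loop_inD(1)[OF z(1)])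
    have zc: "loop_in (cover A) z" "\<forall>i<k. \<forall>c. z c \<noteq> fore (cover A) i c"
      using z(1) by (auto simp: loop_in_iff mem_rest)
    \<comment> \<open>The order clause follows from avoidance: \<open>z\<close> competed in the
      preceding minimisation, so it lies above the preceding fore loop and differs from it.\<close>
    have "(P, fore_period e A (Suc k - 1)) \<in> lexord bead_less" if k: "1 < Suc k"
    proof -
      obtain j where j: "k = Suc j" using k by (cases k) auto
      have "loop_in (rest (cover A) j) z"
        using z(1) j by (auto simp: loop_in_iff mem_rest)
      then have "fore (cover A) j \<le> z" by (rule fore_le[OF adm])
      moreover have "fore (cover A) j \<noteq> z" using zc(2) j by auto
      ultimately show ?thesis
        using word_less[OF loop_fore[OF adm] lz] less[of j] j z(2) by simp
    qed
    then show "P \<in> ?S"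
      using zc dis[OF lz] z(2) quasiperiod_word by auto
  qed
  then show ?case
    unfolding fore_period.simps[of e A "Suc k"]
    using largest_words[of "fore (cover A) k" "{z. loop_in (rest (cover A) k) z}"]
      loop_in_rest_fore[OF adm] fore_le[OF adm] loop_inD(1) by simp
qed

lemma mem_fore_period:
  "(c, j) \<in> set (fore_period e A (Suc k)) \<longleftrightarrow> 1 \<le> j \<and> j \<le> l \<and> fore (cover A) k c = int j"
  by (simp add: fore_period_eq_word mem_word[OF loop_fore[OF adm]])

lemma free_bead_iff: "free_bead e A (c, j) \<longleftrightarrow> 1 \<le> j \<and> j \<le> l \<and> (c, int j) \<in> free (cover A)"
proof -
  have "(\<forall>k\<ge>1. (c, j) \<notin> set (fore_period e A k)) \<longleftrightarrow> (\<forall>k. (c, j) \<notin> set (fore_period e A (Suc k)))"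
    by (metis Suc_le_D One_nat_def le_numeral_extra(4) Suc_le_mono le0)
  moreover have "(c, j) \<in> A \<longleftrightarrow> 1 \<le> j \<and> j \<le> l \<and> (c, int j) \<in> cover A"
    using abacus_rows cover_row[of j c A] by auto
  ultimately show ?thesis
    by (auto simp: free_bead_def free_def mem_fore_period eq_commute)
qed

text \<open>The column bound by the last bead of the next fore period makes the next loop positive
  in this column. Were its value at most \<open>j\<close>, it would be a bead of that period there,
  contrary to the row condition.\<close>

lemma vessel_imp:
  assumes "(c, j) \<in> vessel e A (Suc k)"
  shows "1 \<le> j \<and> j \<le> l \<and> ((c, int j) \<in> free (cover A) \<or> int j = fore (cover A) k c) \<and>
    int j < fore (cover A) (Suc k) c"
  using assms
proof cases
  case fore
  then show ?thesis using fore_less[OF adm, of k "Suc k" c] by (auto simp: mem_fore_period)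
next
  case free
  let ?y = "fore (cover A) (Suc k)"
  have ly: "loop ?y" by (rule loop_fore[OF adm])
  have j: "1 \<le> j" "j \<le> l" "(c, int j) \<in> free (cover A)" using free(1) by (simp_all add: free_bead_iff)
  have "int j < ?y c"
  proof (rule ccontr)
    assume "\<not> ?thesis"
    then have yj: "?y c \<le> int j" by simp
    have "1 \<le> ?y c"
      using free(2) by (simp add: pos_iff_top[OF ly] fore_period_eq_word last_word)
    then have "(c, nat (?y c)) \<in> set (fore_period e A (Suc (Suc k)))"
      using yj j nat_row[of "?y c"] by (simp add: mem_fore_period)
    then have "j < nat (?y c)" using free(5) by auto
    then show False using yj by simp
  qed
  then show ?thesis using j by blast
qed

text \<open>From left to right, every column of the loop is translated until its bead lies in the
  rows 1 to \<open>l\<close>. From right to left, the word is followed from its first bead: each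
  bead supplies the recursive clause of \<open>vessel\<close> for the next one, so that clause needs
  an argument only at the first bead.\<close>

lemma words_in_vessel:
  "{P. quasiperiod e A P \<and> set P \<subseteq> vessel e A (Suc k)} = word ` vessel_loops (cover A) k"
proof (intro equalityI subsetI)
  fix P assume P: "P \<in> {P. quasiperiod e A P \<and> set P \<subseteq> vessel e A (Suc k)}"
  then obtain z where z: "loop_in (cover A) z" "P = word z"
    using quasiperiod_imp_word[OF abacus_rows] by blast
  have lz: "loop z" by (rule loop_inD(1)[OF z(1)])
  have "((c, z c) \<in> free (cover A) \<or> z c = fore (cover A) k c) \<and> z c < fore (cover A) (Suc k) c" for c
  proof -
    define t where "t = (z c - 1) div int l"
    define d where "d = c - int e * t"
    have zd: "z d = z c - int l * t"
      using loop_period_int[OF lz, of c "- t"] by (simp add: d_def)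
    have "z c - 1 = int l * t + (z c - 1) mod int l" by (simp add: t_def)
    then have r: "1 \<le> z d" "z d \<le> int l"
      using zd row_range[of "z c - 1"] by linarith+
    then have "(d, nat (z d)) \<in> set (word z)" using nat_row[of "z d"] by (simp add: mem_word[OF lz])
    then have "(d, nat (z d)) \<in> vessel e A (Suc k)" using P z(2) by blast
    from vessel_imp[OF this] r
    have v: "(d, z d) \<in> free (cover A) \<or> z d = fore (cover A) k d" "z d < fore (cover A) (Suc k) d"
      by auto
    have f: "fore (cover A) i c = fore (cover A) i d + int l * t" for i
      using loop_period_int[OF loop_fore[OF adm, of i], of d t] by (simp add: d_def)
    have c: "c = d + int e * t" by (simp add: d_def)
    have "(d + int e * t, y + int l * t) \<in> free (cover A) \<longleftrightarrow> (d, y) \<in> free (cover A)" for y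
      using f by (simp add: free_def cover_shift c)
    from this[of "z d"] have "(c, z c) \<in> free (cover A) \<longleftrightarrow> (d, z d) \<in> free (cover A)"
      by (simp add: zd c[symmetric])
    then show ?thesis using v zd f by auto
  qed
  then have "z \<in> vessel_loops (cover A) k"
    using lz by (auto simp: vessel_loops_def loop_in_iff below_def)
  then show "P \<in> word ` vessel_loops (cover A) k" using z(2) by blast
next
  fix P assume "P \<in> word ` vessel_loops (cover A) k"
  then obtain z where z: "z \<in> vessel_loops (cover A) k" "P = word z" by blast
  let ?p = "fore (cover A) k" and ?y = "fore (cover A) (Suc k)"
  have lz: "loop z" and zc: "\<And>c. (c, z c) \<in> free (cover A) \<or> z c = ?p c" and zy: "\<And>c. z c < ?y c"
    using z(1) by (auto simp: vessel_loops_def loop_in_iff below_def)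
  have lp: "loop ?p" and ly: "loop ?y" by (rule loop_fore[OF adm])+
  have pz: "?p c \<le> z c" for c using fore_le_vessel[OF adm z(1)] by (simp add: le_fun_def)
  have "loop_in (cover A) z"
    using lz zc fore_mem[OF adm] by (auto simp: loop_in_iff free_def) metis
  then have "quasiperiod e A P" using quasiperiod_word z(2) by simp
  moreover have "word z ! i \<in> vessel e A (Suc k)" if "i < e" for i
  proof -
    let ?b = "top ?p - int e + 1"
    have bead: "(c, nat (z c)) \<in> vessel e A (Suc k)"
      if r: "1 \<le> z c" "z c \<le> int l" and con: "c < ?b \<Longrightarrow> \<exists>j'. (c + 1, j') \<in> vessel e A (Suc k)" for c
    proof (cases "z c = ?p c")
      case True
      then show ?thesis using r nat_row[OF r] by (intro vessel.fore) (simp add: mem_fore_period)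
    next
      case False
      then have f: "(c, z c) \<in> free (cover A)" using zc by blast
      have "?p c < z c" using pz[of c] False by simp
      show ?thesis
      proof (rule vessel.free)
        show "free_bead e A (c, nat (z c))" using r f nat_row[OF r] by (simp add: free_bead_iff)
        have "1 \<le> ?y c" using zy[of c] r by simp
        then show "fst (last (fore_period e A (Suc (Suc k)))) \<le> c"
          by (simp add: fore_period_eq_word last_word pos_iff_top[OF ly])
        have "?p c \<le> int l" using pz[of c] r by simp
        then show "c \<le> fst (hd (fore_period e A (Suc k)))"
          by (simp add: fore_period_eq_word hd_word le_top_iff[OF lp])
        show "\<forall>b\<in>set (fore_period e A (Suc k)). c = fst b \<longrightarrow> snd b < nat (z c)"
          using \<open>?p c < z c\<close> by (auto simp: mem_fore_period)
        show "\<forall>b\<in>set (fore_period e A (Suc (Suc k))). c = fst b \<longrightarrow> nat (z c) < snd b"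
          using zy[of c] r by (auto simp: mem_fore_period)
        show "c < fst (last (fore_period e A (Suc k))) \<longrightarrow> (\<exists>j'. (c + 1, j') \<in> vessel e A (Suc k))"
          using con by (simp add: fore_period_eq_word last_word)
      qed
    qed
    have r: "1 \<le> z (top z - int i)" "z (top z - int i) \<le> int l" if "i < e" for i
      using that by (simp_all add: pos_iff_top[OF lz] le_top_iff[OF lz])
    have "(top z - int i, nat (z (top z - int i))) \<in> vessel e A (Suc k)" if "i < e" for i
      using that
    proof (induction i)
      case 0
      have "\<exists>j'. (top z + 1, j') \<in> vessel e A (Suc k)" if top: "top z < ?b"
      proof (cases "top z + 1 = ?b")
        case True
        then have "1 \<le> ?p (top z + 1)" "?p (top z + 1) \<le> int l"
          using e_pos by (simp_all add: pos_iff_top[OF lp] le_top_iff[OF lp])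
        then have "(top z + 1, nat (?p (top z + 1))) \<in> vessel e A (Suc k)"
          using nat_row[of "?p (top z + 1)"] by (intro vessel.fore) (simp add: mem_fore_period)
        then show ?thesis by blast
      next
        case False
        text \<open>Here \<open>z\<close> lies entirely to the left of the fore period, hence is free.\<close>
        have "z c \<noteq> ?p c" for c
        proof -
          have "set (word z) \<inter> set (word ?p) = {}"
          proof -
            have "c \<le> top z" if "(c, j) \<in> set (word z)" for c j
              using that by (simp add: mem_word[OF lz] flip: le_top_iff[OF lz])
            moreover have "?b \<le> c" if "(c, j) \<in> set (word ?p)" for c j
            proof -
              have "1 \<le> ?p c" using that by (simp add: mem_word[OF lp])
              then show ?thesis by (simp add: pos_iff_top[OF lp])
            qed
            ultimately show ?thesis using top by fastforce
          qed
          then show ?thesis using disjoint_words[OF lz lp] by blast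
        qed
        then have "loop_in (free (cover A)) z" using zc lz by (auto simp: loop_in_iff)
        then show ?thesis using no_loop_in_free[OF adm] by blast
      qed
      then show ?case using bead[of "top z"] r[of 0] e_pos by simp
    next
      case (Suc i)
      have "top z - int (Suc i) + 1 = top z - int i" by simp
      then show ?case using bead[of "top z - int (Suc i)"] r[OF Suc(2)] Suc by (metis Suc_lessD)
    qed
    then show ?thesis using that by (simp add: nth_word)
  qed
  ultimately show "P \<in> {P. quasiperiod e A P \<and> set P \<subseteq> vessel e A (Suc k)}"
    using z(2) by (simp add: subset_iff in_set_conv_nth) metis
qed

lemma aft_period_eq_word: "aft_period e A (Suc k) = word (aft (cover A) k)"
  unfolding aft_period_def words_in_vessel
  using aft_in[OF adm] le_aft[OF adm] by (intro smallest_words) (auto simp: vessel_loops_def loop_in_iff)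

end

end

section \<open>Charges\<close>

text \<open>The elements beyond \<open>m\<close> are compared with the packed state, in which they
  fill the next \<open>n\<close> columns. Part \<open>k\<close> is the displacement of the
  \<open>k\<close>-th largest, which is why the increasing list is read at
  \<open>n - k\<close>.\<close>

lemma ex_charge_partition:
  fixes R :: "int set"
  assumes low: "\<And>c. c \<le> m \<Longrightarrow> c \<in> R" and fin: "finite {c \<in> R. m < c}"
  obtains \<sigma> where "partition \<sigma>"
    "R = {int (part \<sigma> k) + (m + int (card {c \<in> R. m < c})) - int k + 1 | k. 1 \<le> k}"
proof -
  define T where "T = {c \<in> R. m < c}"
  define xs where "xs = sorted_list_of_set T"
  define n where "n = card T"
  have xs: "sorted_wrt (<) xs" "set xs = T" "length xs = n"
    using fin by (simp_all add: xs_def n_def T_def)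
  have less: "xs ! i < xs ! j" if "i < j" "j < n" for i j
    using xs(1,3) that by (simp add: sorted_wrt_iff_nth_less)
  have ge: "m + 1 + int i \<le> xs ! i" if "i < n" for i
    using that
  proof (induction i)
    case 0
    then have "xs ! 0 \<in> T" using xs by (metis nth_mem)
    then show ?case by (simp add: T_def)
  next
    case (Suc i)
    then show ?case using less[of i "Suc i"] by simp
  qed
  define f where "f k = (if 1 \<le> k \<and> k \<le> n then nat (xs ! (n - k) - (m + int (n - k) + 1)) else 0)" for k
  have f: "int (f k) + (m + int n) - int k + 1 = (if k \<le> n then xs ! (n - k) else m + int n - int k + 1)"
    if "1 \<le> k" for k
    using that ge[of "n - k"] by (auto simp: f_def of_nat_diff)
  have "f (Suc k) \<le> f k" if k: "1 \<le> k" for k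
  proof (cases "Suc k \<le> n")
    case True
    then have "xs ! (n - Suc k) < xs ! (n - k)" using k by (intro less) auto
    then show ?thesis using f[of k] f[of "Suc k"] k True by simp
  qed (simp add: f_def)
  moreover have "f k = 0" if "n < k" for k using that by (simp add: f_def)
  ultimately obtain \<sigma> where \<sigma>: "partition \<sigma>" "\<And>k. 1 \<le> k \<Longrightarrow> part \<sigma> k = f k"
    using partition_of_fun by metis
  have "R = {int (part \<sigma> k) + (m + int n) - int k + 1 | k. 1 \<le> k}"
  proof (intro equalityI subsetI)
    fix c assume c: "c \<in> R"
    have "\<exists>k\<ge>1. c = int (f k) + (m + int n) - int k + 1"
    proof (cases "c \<le> m")
      case True
      then have "1 \<le> nat (m + int n - c + 1)" "\<not> nat (m + int n - c + 1) \<le> n"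
        "c = m + int n - int (nat (m + int n - c + 1)) + 1" by auto
      then show ?thesis using f by metis
    next
      case False
      then have "c \<in> set xs" using c xs by (simp add: T_def)
      then obtain i where i: "i < n" "c = xs ! i" using xs(3) by (auto simp: in_set_conv_nth)
      then have "1 \<le> n - i" "n - i \<le> n" "n - (n - i) = i" by auto
      then show ?thesis using f i by metis
    qed
    then show "c \<in> {int (part \<sigma> k) + (m + int n) - int k + 1 | k. 1 \<le> k}"
      unfolding mem_Collect_eq using \<sigma>(2) by metis
  next
    fix c assume "c \<in> {int (part \<sigma> k) + (m + int n) - int k + 1 | k. 1 \<le> k}"
    then obtain k where k: "1 \<le> k" "c = int (f k) + (m + int n) - int k + 1" using \<sigma>(2) by auto
    show "c \<in> R"
    proof (cases "k \<le> n")
      case True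
      then have "n - k < length xs" using k xs by simp
      then have "xs ! (n - k) \<in> set xs" by (rule nth_mem)
      then have "xs ! (n - k) \<in> T" using xs by simp
      then show ?thesis using f[OF k(1)] k True by (simp add: T_def)
    next
      case False
      then show ?thesis using f[OF k(1)] k by (intro low) simp
    qed
  qed
  then show ?thesis using that \<sigma>(1) by (simp add: n_def T_def)
qed

lemma has_chargeI:
  assumes "A \<subseteq> UNIV \<times> {1..l}"
    and low: "\<And>j c. j \<in> {1..l} \<Longrightarrow> c \<le> m j \<Longrightarrow> (c, j) \<in> A"
    and fin: "\<And>j. j \<in> {1..l} \<Longrightarrow> finite {c. (c, j) \<in> A \<and> m j < c}"
    and s: "\<And>j. j \<in> {1..l} \<Longrightarrow> s j = m j + int (card {c. (c, j) \<in> A \<and> m j < c})"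
  shows "has_charge l A s"
proof -
  have "\<exists>\<sigma>. partition \<sigma> \<and> {c. (c, j) \<in> A} = {int (part \<sigma> k) + s j - int k + 1 | k. 1 \<le> k}"
    if j: "j \<in> {1..l}" for j
  proof -
    have R: "{c \<in> {c. (c, j) \<in> A}. m j < c} = {c. (c, j) \<in> A \<and> m j < c}" by simp
    show ?thesis
      using ex_charge_partition[of "m j" "{c. (c, j) \<in> A}", unfolded R, folded s[OF j], OF _ fin[OF j]] low[OF j]
      by blast
  qed
  then obtain \<mu> where "\<forall>j\<in>{1..l}. partition (\<mu> j) \<and>
      {c. (c, j) \<in> A} = {int (part (\<mu> j) k) + s j - int k + 1 | k. 1 \<le> k}"
    using bchoice[of "{1..l}" "\<lambda>j \<sigma>. partition \<sigma> \<and>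
      {c. (c, j) \<in> A} = {int (part \<sigma> k) + s j - int k + 1 | k. 1 \<le> k}"] by blast
  then have \<mu>: "\<And>j. j \<in> {1..l} \<Longrightarrow> partition (\<mu> j)"
      "\<And>j. j \<in> {1..l} \<Longrightarrow> {c. (c, j) \<in> A} = {int (part (\<mu> j) k) + s j - int k + 1 | k. 1 \<le> k}"
    by blast+
  have "(c, j) \<in> A \<longleftrightarrow> (c, j) \<in> abacus_of l \<mu> s" for c j
  proof (cases "j \<in> {1..l}")
    case True
    then have "(c, j) \<in> A \<longleftrightarrow> c \<in> {int (part (\<mu> j) k) + s j - int k + 1 | k. 1 \<le> k}"
      using \<mu>(2) by blast
    then show ?thesis using True by (auto simp: abacus_of_def)
  next
    case False
    then show ?thesis using assms(1) by (auto simp: abacus_of_def)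
  qed
  then have "A = abacus_of l \<mu> s" by (intro set_eqI) (metis surj_pair)
  then show ?thesis unfolding has_charge_def using \<mu>(1) by blast
qed

lemma finite_row:
  assumes "finite P" shows "finite {c. (c, j) \<in> P}"
proof (rule finite_subset)
  show "{c. (c, j) \<in> P} \<subseteq> fst ` P" by (auto intro: rev_image_eqI)
qed (use assms in simp)

lemma mem_right_shift: "(c, j) \<in> right_shift P \<longleftrightarrow> (c - 1, j) \<in> P"
  by (force simp: right_shift_def)

text \<open>Both ends of an arrow must share a charge. With \<open>m\<close> to the left of all
  beads of \<open>P\<close>, the charge of a row is \<open>m\<close> plus the number of beads beyond
  \<open>m\<close>, and disjointness ensures that the shift preserves this number.\<close>

lemma ex_common_charge:
  assumes A: "abacus l A" and P: "finite P" "P \<subseteq> A"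
    and disjoint: "(A - P) \<inter> right_shift P = {}"
  obtains s where "has_charge l A s" "has_charge l (shift_right A P) s"
proof -
  have rows: "A \<subseteq> UNIV \<times> {1..l}" using A by (simp add: abacus_def)
  have rs: "right_shift P = (\<lambda>(c, j). (c + 1, j)) ` P" by (force simp: right_shift_def)
  then have finQ: "finite (right_shift P)" using P by simp
  have A': "abacus l (shift_right A P)"
    unfolding shift_right_def using rows P finQ by (intro abacus_exchange A) (auto simp: rs)
  obtain m0 n where mn: "\<And>j c. j \<in> {1..l} \<Longrightarrow> c \<le> m0 \<Longrightarrow> (c, j) \<in> A"
      "\<And>j c. j \<in> {1..l} \<Longrightarrow> n \<le> c \<Longrightarrow> (c, j) \<notin> A"
    using A unfolding abacus_def by blast
  define p where "p = Min (insert 0 (fst ` P)) - 1"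
  have p: "p < c" if "(c, j) \<in> P" for c j
  proof -
    have "Min (insert 0 (fst ` P)) \<le> c"
      using P(1) that by (intro Min_le) (auto intro: rev_image_eqI)
    then show ?thesis by (simp add: p_def)
  qed
  define m where "m = min m0 p"
  have mem': "(c, j) \<in> shift_right A P \<longleftrightarrow> (c, j) \<in> A \<and> (c, j) \<notin> P \<or> (c - 1, j) \<in> P" for c j
    by (simp add: shift_right_def mem_right_shift)
  have low: "(c, j) \<in> A \<and> (c, j) \<in> shift_right A P" if "j \<in> {1..l}" "c \<le> m" for c j
    using mn(1)[OF that(1), of c] p[of c j] that(2) by (auto simp: mem' m_def)
  have fin: "finite {c. (c, j) \<in> A \<and> m < c}" if "j \<in> {1..l}" for j
  proof (rule finite_subset)
    show "{c. (c, j) \<in> A \<and> m < c} \<subseteq> {m..n}"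
    proof
      fix c assume c: "c \<in> {c. (c, j) \<in> A \<and> m < c}"
      then have "\<not> n \<le> c" using mn(2)[OF that] by blast
      then show "c \<in> {m..n}" using c by simp
    qed
  qed simp
  have fst_fin: "finite {c. (c, j) \<in> P}" for j
    by (rule finite_row[OF P(1)])
  have eq: "{c. (c, j) \<in> shift_right A P \<and> m < c} =
      ({c. (c, j) \<in> A \<and> m < c} - {c. (c, j) \<in> P}) \<union> (\<lambda>c. c + 1) ` {c. (c, j) \<in> P}" for j
  proof (rule set_eqI)
    fix c
    have "c \<in> (\<lambda>c. c + 1) ` {c. (c, j) \<in> P} \<longleftrightarrow> (c - 1, j) \<in> P"
      by (auto intro: rev_image_eqI[of "c - 1"])
    moreover have "m < c" if "(c - 1, j) \<in> P" using p[OF that] by (simp add: m_def)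
    ultimately show "c \<in> {c. (c, j) \<in> shift_right A P \<and> m < c} \<longleftrightarrow>
      c \<in> ({c. (c, j) \<in> A \<and> m < c} - {c. (c, j) \<in> P}) \<union> (\<lambda>c. c + 1) ` {c. (c, j) \<in> P}"
      unfolding Un_iff Diff_iff mem_Collect_eq mem' by blast
  qed
  have card: "card {c. (c, j) \<in> shift_right A P \<and> m < c} = card {c. (c, j) \<in> A \<and> m < c}"
    if j: "j \<in> {1..l}" for j
  proof -
    have "({c. (c, j) \<in> A \<and> m < c} - {c. (c, j) \<in> P}) \<inter> (\<lambda>c. c + 1) ` {c. (c, j) \<in> P} = {}"
      using disjoint by (auto simp: right_shift_def)
    moreover have "{c. (c, j) \<in> P} \<subseteq> {c. (c, j) \<in> A \<and> m < c}"
      using P(2) p by (force simp: m_def)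
    moreover have "card ((\<lambda>c. c + 1) ` {c. (c, j) \<in> P}) = card {c. (c, j) \<in> P}"
      by (intro card_image) (simp add: inj_on_def)
    ultimately show ?thesis
      unfolding eq using fin[OF j] fst_fin[of j] card_mono[of "{c. (c, j) \<in> A \<and> m < c}" "{c. (c, j) \<in> P}"]
      by (simp add: card_Un_disjoint card_Diff_subset)
  qed
  have fin': "finite {c. (c, j) \<in> shift_right A P \<and> m < c}" if "j \<in> {1..l}" for j
    unfolding eq using fin[OF that] fst_fin by simp
  let ?s = "\<lambda>j. m + int (card {c. (c, j) \<in> A \<and> m < c})"
  have "has_charge l A ?s" by (rule has_chargeI[where m = "\<lambda>_. m"]) (use rows low fin in auto)
  moreover have "has_charge l (shift_right A P) ?s"
    by (rule has_chargeI[where m = "\<lambda>_. m"]) (use A' low fin' card in \<open>auto simp: abacus_def\<close>)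
  ultimately show ?thesis by (rule that)
qed

section \<open>The crystal of abaci\<close>

context cylinder
begin

section \<open>Abaci as an instance of the abstract crystal\<close>

definition shift_fore :: "nat \<Rightarrow> bead set \<Rightarrow> bead set" where
  "shift_fore k A = shift_right A (set (fore_period e A k))"

lemma right_shift_word:
  assumes "loop x" shows "right_shift (set (word x)) = set (word (rsh x))"
proof -
  have "(c, j) \<in> right_shift (set (word x)) \<longleftrightarrow> (c, j) \<in> set (word (rsh x))" for c j
    unfolding mem_right_shift mem_word[OF assms] mem_word[OF loop_rsh[OF assms]] by (simp add: rsh_def)
  then show ?thesis by (intro set_eqI) (metis surj_pair)
qed

lemma set_word_rows: "loop x \<Longrightarrow> set (word x) \<subseteq> UNIV \<times> {1..l}"
  by (auto simp: mem_word)

context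
  fixes A :: "bead set"
  assumes abacus: "abacus l A"
begin

lemma right_shift_fore_period:
  "right_shift (set (fore_period e A (Suc k))) = set (word (rsh (fore (cover A) k)))"
  by (simp add: fore_period_eq_word[OF abacus] right_shift_word loop_fore[OF adm[OF abacus]])

lemma cover_shift_fore: "cover (shift_fore (Suc k) A) = shift k (cover A)"
  unfolding shift_fore_def shift_right_def right_shift_fore_period
  by (simp add: fore_period_eq_word[OF abacus] cover_Un cover_Diff shift_def cover_word
      loop_rsh loop_fore[OF adm[OF abacus]])

lemma abacus_shift_fore: "abacus l (shift_fore (Suc k) A)"
  unfolding shift_fore_def shift_right_def right_shift_fore_period
  by (intro abacus_exchange abacus set_word_rows loop_rsh loop_fore adm) simp_all

text \<open>The preimage is formed by exchanging finite words, so it is visibly an abacus; that it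
  shifts back to \<open>A\<close> is then checked on the cover.\<close>

lemma ex_unshift_fore:
  assumes "shiftable (cover A) (Suc k)"
  obtains B where "abacus l B" "shiftable (cover B) k" "shift_fore (Suc k) B = A"
proof -
  let ?q = "aft (cover A) k"
  have lq: "loop ?q" by (rule loop_aft[OF adm[OF abacus]])
  have low: "below (lsh ?q) (fore (cover A) (Suc k))"
    using assms shiftable_Suc_iff_aft[OF adm[OF abacus]] by simp
  define B where "B = (A - set (word ?q)) \<union> set (word (lsh ?q))"
  have B: "abacus l B"
    unfolding B_def by (intro abacus_exchange abacus set_word_rows loop_lsh lq) simp_all
  have cB: "cover B = unshift k (cover A)"
    by (simp add: B_def cover_Un cover_Diff cover_word lq loop_lsh unshift_def)
  show ?thesis
  proof (rule that[OF B])
    show "shiftable (cover B) k" unfolding cB by (rule shiftable_unshift[OF adm[OF abacus] low])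
    have "cover (shift_fore (Suc k) B) = shift k (cover B)"
      unfolding shift_fore_def shift_right_def fore_period_eq_word[OF B]
      by (simp add: right_shift_word cover_Un cover_Diff shift_def cover_word loop_rsh loop_fore[OF adm[OF B]])
    also have "\<dots> = cover A" unfolding cB by (rule shift_unshift[OF adm[OF abacus] low])
    finally have eq: "cover (shift_fore (Suc k) B) = cover A" .
    have "abacus l (shift_fore (Suc k) B)"
      unfolding shift_fore_def shift_right_def fore_period_eq_word[OF B] right_shift_word[OF loop_fore[OF adm[OF B]]]
      by (intro abacus_exchange B set_word_rows loop_rsh loop_fore adm) simp_all
    then show "shift_fore (Suc k) B = A"
      using eq cover_inject abacus by (simp add: abacus_def)
  qed
qed

text \<open>A bead directly to the right of the last bead in row \<open>j\<close> would lie on the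
  shifted loop; by \<open>rsh_fore_disjoint\<close> it would belong to the period, against the
  maximality of the column.\<close>

lemma right_shiftable_fore_period:
  assumes "shiftable (cover A) k"
  shows "right_shiftable A (set (fore_period e A (Suc k)))"
  unfolding right_shiftable_def
proof
  let ?P = "set (fore_period e A (Suc k))" and ?x = "fore (cover A) k"
  fix j assume "j \<in> snd ` ?P"
  then obtain c where c: "(c, j) \<in> ?P" by force
  then have j: "1 \<le> j" "j \<le> l" by (simp_all add: mem_fore_period[OF abacus])
  let ?C = "{c. (c, j) \<in> ?P}"
  have fin: "finite ?C" by (rule finite_row) simp
  define d where "d = Max ?C"
  have "d \<in> ?C" unfolding d_def using c by (intro Max_in fin) blast
  then have xd: "?x d = int j" by (simp add: mem_fore_period[OF abacus])
  show "(d + 1, j) \<notin> A"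
  proof
    assume "(d + 1, j) \<in> A"
    then have "(d + 1, rsh ?x (d + 1)) \<in> cover A" using cover_row[OF j] xd by (simp add: rsh_def)
    from rsh_fore_disjoint[OF adm[OF abacus] assms this] have "?x (d + 1) = int j"
      using xd by (simp add: rsh_def)
    then have "d + 1 \<in> ?C" using j by (simp add: mem_fore_period[OF abacus])
    then have "d + 1 \<le> d" unfolding d_def using fin by (intro Max_ge)
    then show False by simp
  qed
qed

lemma disjoint_right_shift:
  assumes "shiftable (cover A) k"
  shows "(A - set (fore_period e A (Suc k))) \<inter> right_shift (set (fore_period e A (Suc k))) = {}"
proof -
  have False if "(c, j) \<in> A - set (fore_period e A (Suc k))" "(c, j) \<in> right_shift (set (fore_period e A (Suc k)))"
    for c j
  proof -
    have j: "1 \<le> j" "j \<le> l" "rsh (fore (cover A) k) c = int j"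
      using that(2) by (simp_all add: right_shift_fore_period mem_word loop_rsh loop_fore[OF adm[OF abacus]])
    then have "(c, rsh (fore (cover A) k) c) \<in> cover A" using that(1) cover_row[OF j(1,2)] by simp
    from rsh_fore_disjoint[OF adm[OF abacus] assms this] have "fore (cover A) k c = int j"
      using j by simp
    then show False using that(1) j by (simp add: mem_fore_period[OF abacus])
  qed
  then show ?thesis by auto
qed

text \<open>Words determine loops, so the aft condition is an equation between loops.
  \<open>aft_shift\<close> and \<open>shiftable_if_aft_shift\<close> are the two directions, and
  right-shiftability comes from \<open>right_shiftable_fore_period\<close>.\<close>

lemma shiftable_iff:
  assumes A': "A' = shift_fore (Suc k) A"
  shows "shiftable (cover A) k \<longleftrightarrow> right_shiftable A (set (fore_period e A (Suc k))) \<and>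
    right_shift (set (fore_period e A (Suc k))) = set (aft_period e A' (Suc k))"
proof -
  have ab': "abacus l A'" and c': "cover A' = shift k (cover A)"
    by (simp_all add: A' abacus_shift_fore cover_shift_fore)
  let ?s = "rsh (fore (cover A) k)" and ?q = "aft (shift k (cover A)) k"
  have ls: "loop ?s" by (rule loop_rsh[OF loop_fore[OF adm[OF abacus]]])
  have lq: "loop ?q" using loop_aft[OF adm[OF ab']] by (simp add: c')
  have "right_shift (set (fore_period e A (Suc k))) = set (aft_period e A' (Suc k)) \<longleftrightarrow>
      set (word ?s) = set (word ?q)"
    by (simp add: right_shift_fore_period aft_period_eq_word[OF ab'] c')
  moreover have "set (word ?s) = set (word ?q) \<longleftrightarrow> ?q = ?s"
    using word_inject[OF ls lq] by metis
  moreover have "?q = ?s \<longleftrightarrow> shiftable (cover A) k"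
    using aft_shift[OF adm[OF abacus]] shiftable_if_aft_shift[OF adm[OF abacus]] by blast
  ultimately show ?thesis
    using right_shiftable_fore_period by blast
qed

end

lemma cover_shift_fore_pow:
  assumes "abacus l A"
  shows "abacus l ((shift_fore (Suc k) ^^ n) A) \<and>
    cover ((shift_fore (Suc k) ^^ n) A) = (shift k ^^ n) (cover A)"
proof (induction n)
  case (Suc n)
  then show ?case using abacus_shift_fore cover_shift_fore by simp
qed (use assms in simp)

lemma shift_fore_eqI:
  "abacus l A \<Longrightarrow> abacus l B \<Longrightarrow> cover A = cover B \<Longrightarrow> A = B"
  by (rule cover_inject[OF abacus_rows abacus_rows])

text \<open>The index \<open>k - 1\<close> reconciles periods numbered from 1 with loops numbered
  from 0.\<close>

sublocale crystal "abacus l" shift_fore "\<lambda>k A. shiftable (cover A) (k - 1)"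
proof
  fix A assume A: "abacus l A"
  have c: "cover (shift_fore k A) = shift (k - 1) (cover A)" "abacus l (shift_fore k A)" if "1 \<le> k" for k
    using that cover_shift_fore[OF A, of "k - 1"] abacus_shift_fore[OF A, of "k - 1"] by simp_all
  show "abacus l (shift_fore k A)" if "1 \<le> k" for k by (rule c[OF that])
  show "shiftable (cover A) (1 - 1)" by (simp add: shiftable_def)
  show "shift_fore j (shift_fore k A) = shift_fore k (shift_fore j A)"
    if "1 \<le> j" "1 \<le> k" "j \<noteq> k" "shiftable (cover A) (j - 1)" "shiftable (cover A) (k - 1)" for j k
  proof (rule shift_fore_eqI)
    obtain j' k' where jk: "j = Suc j'" "k = Suc k'" using \<open>1 \<le> j\<close> \<open>1 \<le> k\<close> by (cases j; cases k) auto
    show "abacus l (shift_fore j (shift_fore k A))" "abacus l (shift_fore k (shift_fore j A))"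
      using A by (simp_all add: jk abacus_shift_fore)
    show "cover (shift_fore j (shift_fore k A)) = cover (shift_fore k (shift_fore j A))"
      using that shift_commute[OF adm[OF A], of k' j'] A
      by (simp add: jk abacus_shift_fore cover_shift_fore)
  qed
  show "shiftable (cover (shift_fore k A)) (j - 1) \<longleftrightarrow> shiftable (cover A) (j - 1)"
    if "1 \<le> j" "1 \<le> k" "shiftable (cover A) (k - 1)" "j \<noteq> k" "j \<noteq> Suc k" for j k
    using shiftable_shift_iff[OF adm[OF A] that(3), of "j - 1"] that by (simp add: c)
  show "shiftable (cover (shift_fore k A)) (Suc k - 1)"
    if "1 \<le> k" "shiftable (cover A) (k - 1)" for k
    using shiftable_shift_Suc[OF adm[OF A] that(2)] that by (simp add: c)
  show "\<exists>Y. abacus l Y \<and> shiftable (cover Y) (k - 1) \<and> shift_fore k Y = A"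
    if k: "1 \<le> k" "shiftable (cover A) (Suc k - 1)" for k
  proof -
    obtain k' where k': "k = Suc k'" using k(1) by (cases k) auto
    then have "shiftable (cover A) (Suc k')" using k(2) by simp
    then show ?thesis using ex_unshift_fore[OF A] k' by (metis diff_Suc_1)
  qed
  show "A = B" if "abacus l B" "1 \<le> k" "shiftable (cover A) (k - 1)" "shiftable (cover B) (k - 1)"
    "shift_fore k A = shift_fore k B" for B k
  proof (rule shift_fore_eqI[OF A that(1)])
    have cB: "cover (shift_fore k B) = shift (k - 1) (cover B)"
      using cover_shift_fore[OF that(1), of "k - 1"] that(2) by simp
    have "shift (k - 1) (cover A) = shift (k - 1) (cover B)"
      using c(1)[OF that(2)] cB that(5) by simp
    then show "cover A = cover B" using shift_inject[OF adm[OF A] adm[OF that(1)]] that by blast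
  qed
  show "\<exists>n. \<not> shiftable (cover ((shift_fore (Suc k) ^^ n) A)) (Suc k - 1)" if "1 \<le> k" for k
  proof -
    obtain k' where k: "k = Suc k'" using \<open>1 \<le> k\<close> by (cases k) auto
    then show ?thesis
      using finitely_many_shifts[OF adm[OF A], of k'] cover_shift_fore_pow[OF A, where k = k] by simp
  qed
  show "\<exists>K. \<forall>k\<ge>K. \<not> shiftable (cover A) (k - 1)"
  proof -
    obtain K where "\<forall>k\<ge>K. \<not> shiftable (cover A) k" using eventually_not_shiftable[OF adm[OF A]] by blast
    then show ?thesis by (intro exI[of _ "Suc K"]) auto
  qed
qed

section \<open>Positions and the removal of boxes\<close>

lemma b_op_eq: "b_op e = b"
proof -
  have "shift_fore k = (\<lambda>B. shift_right B (set (fore_period e B k)))" for k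
    by (rule ext) (simp add: shift_fore_def)
  then show ?thesis
    by (intro ext) (simp only: b_op_def b_def)
qed

lemma highest_weight_eq: "highest_weight e l = hw"
  by (intro ext) (simp add: highest_weight_def hw_def b_op_eq)

lemma crystal_decomp_b:
  assumes "partition \<theta>" "hw B" shows "crystal_decomp e l (b \<theta> B) = (\<theta>, B)"
  unfolding crystal_decomp_def b_op_eq highest_weight_eq
  using assms by (intro the_equality) (auto dest: decomposition_unique)

lemma position_b: "partition \<theta> \<Longrightarrow> hw B \<Longrightarrow> position e l (b \<theta> B) = \<theta>"
  and source_b: "partition \<theta> \<Longrightarrow> hw B \<Longrightarrow> source e l (b \<theta> B) = B"
  by (simp_all add: position_def source_def crystal_decomp_b)

text \<open>Justifies the definite description in \<open>upsilon_minus\<close>.\<close>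

lemma adds_box_unique: "adds_box k \<rho> \<theta> \<Longrightarrow> adds_box k \<rho>' \<theta> \<Longrightarrow> \<rho> = \<rho>'"
  by (rule partition_eqI) (auto simp: adds_box_def fun_eq_iff split: if_splits)

lemma upsilon_minus_b:
  assumes "partition \<theta>" "hw B" "adds_box k \<rho> \<theta>"
  shows "upsilon_minus e l k (Some (b \<theta> B)) = Some (b \<rho> B)"
proof -
  have "(THE \<rho>. adds_box k \<rho> \<theta>) = \<rho>" using assms(3) adds_box_unique by blast
  then show ?thesis
    using assms by (auto simp: upsilon_minus_def position_b source_b b_op_eq)
qed

lemma upsilon_minus_None: "(upsilon_minus e l k ^^ q) None = None"
  by (induction q) (simp_all add: upsilon_minus_def)

lemma ex_removes_box_iff:
  assumes "partition \<theta>" "1 \<le> k"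
  shows "(\<exists>\<rho>. adds_box k \<rho> \<theta>) \<longleftrightarrow> part \<theta> (Suc k) < part \<theta> k"
proof
  assume "\<exists>\<rho>. adds_box k \<rho> \<theta>"
  then obtain \<rho> where \<rho>: "partition \<rho>" "part \<theta> = (part \<rho>)(k := part \<rho> k + 1)"
    by (auto simp: adds_box_def)
  then show "part \<theta> (Suc k) < part \<theta> k"
    using part_mono[OF \<rho>(1), of k "Suc k"] assms(2) by simp
next
  assume less: "part \<theta> (Suc k) < part \<theta> k"
  let ?f = "(part \<theta>)(k := part \<theta> k - 1)"
  have "?f (Suc j) \<le> ?f j" if "1 \<le> j" for j
    using part_mono[OF assms(1) that, of "Suc j"] less by auto
  moreover have "?f j = 0" if "length \<theta> < j" for j using that by (simp add: part_beyond)
  ultimately obtain \<rho> where \<rho>: "partition \<rho>" "\<And>j. 1 \<le> j \<Longrightarrow> part \<rho> j = ?f j"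
    using partition_of_fun[of ?f "length \<theta>"] by blast
  have "part \<theta> j = ((part \<rho>)(k := part \<rho> k + 1)) j" for j
    using \<rho>(2)[of j] assms(2) less by (cases j) auto
  then have "adds_box k \<rho> \<theta>" using \<rho>(1) assms by (auto simp: adds_box_def)
  then show "\<exists>\<rho>. adds_box k \<rho> \<theta>" by blast
qed

text \<open>A box can leave row \<open>k\<close> exactly while the difference to the next part is
  positive, and each removal lowers that difference by one.\<close>

lemma upsilon_minus_pow:
  assumes "partition \<theta>" "hw B" "1 \<le> k"
  shows "(upsilon_minus e l k ^^ q) (Some (b \<theta> B)) \<noteq> None \<longleftrightarrow> q \<le> part \<theta> k - part \<theta> (Suc k)"
  using assms(1)
proof (induction q arbitrary: \<theta>)
  case (Suc q)
  show ?case
  proof (cases "\<exists>\<rho>. adds_box k \<rho> \<theta>")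
    case True
    then obtain \<rho> where \<rho>: "adds_box k \<rho> \<theta>" by blast
    then have p: "partition \<rho>" "part \<theta> = (part \<rho>)(k := part \<rho> k + 1)" by (auto simp: adds_box_def)
    have "part \<theta> k - part \<theta> (Suc k) = Suc (part \<rho> k - part \<rho> (Suc k))"
      using part_mono[OF p(1), of k "Suc k"] assms(3) by (simp add: p(2) Suc_diff_le)
    moreover have "(upsilon_minus e l k ^^ Suc q) (Some (b \<theta> B)) = (upsilon_minus e l k ^^ q) (Some (b \<rho> B))"
      using upsilon_minus_b[OF Suc(2) assms(2) \<rho>] by (simp add: funpow_Suc_right del: funpow.simps)
    ultimately show ?thesis using Suc(1)[OF p(1)] by simp
  next
    case False
    then have "upsilon_minus e l k (Some (b \<theta> B)) = None"
      using Suc(2) assms(2) by (simp add: upsilon_minus_def position_b)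
    then show ?thesis
      using False ex_removes_box_iff[OF Suc(2) assms(3)]
      by (simp add: funpow_Suc_right upsilon_minus_None del: funpow.simps)
  qed
qed simp

text \<open>The numbers \<alpha> are differences of consecutive parts, so their sums telescope. The
  last nonzero difference occurs at the length of the partition, which is therefore
  \<open>r\<close>.\<close>

lemma position_eq_sums:
  assumes "partition \<theta>" "hw B"
  defines "\<alpha> \<equiv> (\<lambda>k. Max {q. (upsilon_minus e l k ^^ q) (Some (b \<theta> B)) \<noteq> None})"
  defines "r \<equiv> Max {n. n \<ge> 1 \<and> \<alpha> n \<noteq> 0}"
  shows "\<theta> = (if \<forall>n\<ge>1. \<alpha> n = 0 then [] else map (\<lambda>k. \<Sum>m=k..r. \<alpha> m) [1..<Suc r])"
proof -
  have \<alpha>: "\<alpha> k = part \<theta> k - part \<theta> (Suc k)" if "1 \<le> k" for k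
  proof -
    have "{q. (upsilon_minus e l k ^^ q) (Some (b \<theta> B)) \<noteq> None} = {..part \<theta> k - part \<theta> (Suc k)}"
      using upsilon_minus_pow[OF assms(1,2) that] by auto
    then show ?thesis unfolding \<alpha>_def by (auto intro!: Max_eqI)
  qed
  \<comment> \<open>Admitting \<open>k = Suc n\<close>, the empty sum, gives the downward induction
    its start.\<close>
  have sum: "(\<Sum>m=k..n. \<alpha> m) = part \<theta> k" if "1 \<le> k" "k \<le> Suc n" "length \<theta> \<le> n" for k n
    using that(2,1)
  proof (induction k rule: inc_induct)
    case base
    then show ?case using that(3) by (simp add: part_beyond)
  next
    case (step k)
    then have "(\<Sum>m=k..n. \<alpha> m) = \<alpha> k + part \<theta> (Suc k)" by (simp add: sum.atLeast_Suc_atMost)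
    then show ?case using \<alpha>[OF step(4)] part_mono[OF assms(1) step(4), of "Suc k"] by simp
  qed
  show ?thesis
  proof (cases "\<theta> = []")
    case True
    then show ?thesis using \<alpha> by (simp add: part_def)
  next
    case False
    let ?n = "length \<theta>"
    have n: "1 \<le> ?n" using False by (cases \<theta>) auto
    have \<alpha>n: "\<alpha> ?n \<noteq> 0"
      using \<alpha>[OF n] part_pos_iff[OF assms(1), of ?n] n by (simp add: part_beyond)
    have r: "r = ?n"
      unfolding r_def
    proof (rule Max_eqI)
      show le: "y \<le> ?n" if "y \<in> {n. 1 \<le> n \<and> \<alpha> n \<noteq> 0}" for y
        using that \<alpha>[of y] by (auto simp: part_beyond intro: ccontr simp flip: not_less)
      show "finite {n. 1 \<le> n \<and> \<alpha> n \<noteq> 0}"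
        by (rule finite_subset[of _ "{..?n}"]) (use le in auto)
    qed (use n \<alpha>n in simp)
    have sums: "\<theta> = map (\<lambda>k. \<Sum>m=k..?n. \<alpha> m) [1..<Suc ?n]"
    proof (rule nth_equalityI)
      fix i assume "i < length \<theta>"
      then show "\<theta> ! i = map (\<lambda>k. \<Sum>m=k..?n. \<alpha> m) [1..<Suc ?n] ! i"
        using sum[of "Suc i" ?n] by (simp add: part_def del: upt_Suc)
    qed (simp del: upt_Suc)
    have ne: "\<not> (\<forall>n\<ge>1. \<alpha> n = 0)"
    proof
      assume "\<forall>n\<ge>1. \<alpha> n = 0"
      then have "1 \<le> ?n \<longrightarrow> \<alpha> ?n = 0" by (rule spec)
      then have "\<alpha> ?n = 0" using n by (rule mp)
      then show False using \<alpha>n by contradiction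
    qed
    show ?thesis unfolding r if_not_P[OF ne] by (rule sums)
  qed
qed

text \<open>Apart from the charge, an arrow is the addition of a box; \<open>arrow_iff\<close> turns
  this into a shift inside its domain, and \<open>shiftable_iff\<close> into the condition on fore
  and aft periods. For the converse direction the common charge is supplied by
  \<open>ex_common_charge\<close>.\<close>

lemma arrow_iff_fore_aft:
  assumes A: "abacus l A" and A': "abacus l A'"
  shows "(\<exists>s. (A, A') \<in> sl_inf_crystal e l s) \<longleftrightarrow>
    (\<exists>k\<ge>1. right_shiftable A (set (fore_period e A k)) \<and>
      A' = shift_right A (set (fore_period e A k)) \<and>
      right_shift (set (fore_period e A k)) = set (aft_period e A' k))"
proof -
  define edge where "edge k \<longleftrightarrow> shiftable (cover A) (k - 1) \<and> A' = shift_fore k A" for k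
  have arrow: "(\<exists>s. (A, A') \<in> sl_inf_crystal e l s) \<longleftrightarrow>
      (\<exists>s. has_charge l A s \<and> has_charge l A' s) \<and>
      (\<exists>k B \<theta> \<rho>. hw B \<and> adds_box k \<theta> \<rho> \<and> A = b \<theta> B \<and> A' = b \<rho> B)"
    unfolding sl_inf_crystal_def mem_Collect_eq prod.case b_op_eq highest_weight_eq
    using A A' by blast
  have "(\<exists>B \<theta> \<rho>. hw B \<and> adds_box k \<theta> \<rho> \<and> A = b \<theta> B \<and> A' = b \<rho> B) \<longleftrightarrow> 1 \<le> k \<and> edge k" for k
  proof (cases "1 \<le> k")
    case True
    then show ?thesis unfolding arrow_iff[OF A True] edge_def by simp
  next
    case False
    then show ?thesis unfolding adds_box_def by blast
  qed
  then have box: "(\<exists>k B \<theta> \<rho>. hw B \<and> adds_box k \<theta> \<rho> \<and> A = b \<theta> B \<and> A' = b \<rho> B) \<longleftrightarrow>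
      (\<exists>k\<ge>1. edge k)" by simp
  have charge: "\<exists>s. has_charge l A s \<and> has_charge l A' s" if "1 \<le> k" "edge k" for k
  proof -
    obtain i where i: "k = Suc i" using \<open>1 \<le> k\<close> by (cases k) auto
    then have sh: "shiftable (cover A) i" "A' = shift_fore (Suc i) A"
      using \<open>edge k\<close> by (simp_all add: edge_def)
    have "set (fore_period e A (Suc i)) \<subseteq> A"
      unfolding fore_period_eq_word[OF A]
      using fore_mem[OF adm[OF A]] loop_fore[OF adm[OF A]]
      by (simp add: loop_in_iff flip: loop_in_cover_iff)
    then obtain s where "has_charge l A s" "has_charge l (shift_fore (Suc i) A) s"
      unfolding shift_fore_def
      by (rule ex_common_charge[OF A finite_set _ disjoint_right_shift[OF A sh(1)]])
    then show ?thesis using sh(2) by blast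
  qed
  have "edge k \<longleftrightarrow> right_shiftable A (set (fore_period e A k)) \<and>
      A' = shift_right A (set (fore_period e A k)) \<and>
      right_shift (set (fore_period e A k)) = set (aft_period e A' k)" if "1 \<le> k" for k
  proof -
    obtain i where i: "k = Suc i" using \<open>1 \<le> k\<close> by (cases k) auto
    show ?thesis
      using shiftable_iff[OF A, of A' i] unfolding edge_def i shift_fore_def diff_Suc_1 by blast
  qed
  then show ?thesis unfolding arrow box using charge by blast
qed

end

theorem theoremA:
  fixes e l :: nat
  assumes "e \<ge> 2" and "l \<ge> 2"
  shows "(\<forall>A A'. abacus l A \<longrightarrow> abacus l A' \<longrightarrow>
      ((\<exists>s. (A, A') \<in> sl_inf_crystal e l s) \<longleftrightarrow>
       (\<exists>k\<ge>1. right_shiftable A (set (fore_period e A k)) \<and>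
          A' = shift_right A (set (fore_period e A k)) \<and>
          right_shift (set (fore_period e A k)) = set (aft_period e A' k))))
    \<and> (\<forall>A. abacus l A \<longrightarrow>
      (let \<alpha> = (\<lambda>k. Max {q. (upsilon_minus e l k ^^ q) (Some A) \<noteq> None});
           r = Max {n. n \<ge> 1 \<and> \<alpha> n \<noteq> 0};
           \<delta> = (\<lambda>k. \<Sum>m=k..r. \<alpha> m)
       in position e l A = (if \<forall>n\<ge>1. \<alpha> n = 0 then [] else map \<delta> [1..<Suc r])))"
proof -
  interpret cylinder e l
    by unfold_locales (use assms in auto)
  show ?thesis
  proof (intro conjI allI impI)
    fix A A' assume "abacus l A" "abacus l A'"
    then show "(\<exists>s. (A, A') \<in> sl_inf_crystal e l s) \<longleftrightarrow>
      (\<exists>k\<ge>1. right_shiftable A (set (fore_period e A k)) \<and>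
        A' = shift_right A (set (fore_period e A k)) \<and>
        right_shift (set (fore_period e A k)) = set (aft_period e A' k))"
      by (rule arrow_iff_fore_aft)
  next
    fix A assume "abacus l A"
    then obtain \<theta> B where B: "partition \<theta>" "hw B" "A = b \<theta> B" by (rule ex_hw_decomposition)
    show "let \<alpha> = (\<lambda>k. Max {q. (upsilon_minus e l k ^^ q) (Some A) \<noteq> None});
           r = Max {n. n \<ge> 1 \<and> \<alpha> n \<noteq> 0};
           \<delta> = (\<lambda>k. \<Sum>m=k..r. \<alpha> m)
       in position e l A = (if \<forall>n\<ge>1. \<alpha> n = 0 then [] else map \<delta> [1..<Suc r])"
      unfolding Let_def B(3) position_b[OF B(1,2)] by (rule position_eq_sums[OF B(1,2)])
  qed
qed

end
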